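(* Let $r\geq 3$, $k\geq 1$ and $\ell_1,\dots,\ell_k\geq 5$ be integers, let $s\geq r$ be an integer, and let $t=\sum_{i=1}^k\lfloor\frac{\ell_i+1}{2}\rfloor-1$. Suppose either $Q_i=P_{\ell_i}^r$ for all $i\in[k]$, or $Q_i=C_{\ell_i}^r$ for all $i\in[k]$. Let $n\to\infty$. (i) If $s\leq t+r-1$, then $$\mathrm{ex}_r(n,K_s^{(r)},Q_1\cup\cdots\cup Q_k)=(1+o(1))\,\mathcal{N}(K_s^{(r)},S_{n,t}^r)=\binom{t}{s-r+1}\frac{n^{r-1}}{(r-1)!}+o(n^{r-1}).$$ (ii) If $s\geq t+r$, then $\mathrm{ex}_r(n,K_s^{(r)},Q_1\cup\cdots\cup Q_k)=o(n^{r-1})$.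
   Context: An $r$-graph is a hypergraph all of whose hyperedges have exactly $r$ vertices. $K_s^{(r)}$ is the complete $r$-graph on $s$ vertices. $P_\ell$ and $C_\ell$ are the path and cycle with $\ell$ edges. For a graph $F$, the $r$-expansion $F^r$ is obtained from $F$ by adding $r-2$ new vertices to each edge, all new vertices distinct from each other and from $V(F)$. $\cup$ denotes vertex-disjoint union. $S_{n,t}^r$ is the $n$-vertex $r$-graph whose hyperedges are all $r$-sets intersecting a fixed set of $t$ vertices. $\mathcal{N}(\mathcal{G}_1,\mathcal{G}_2)$ is the number of copies of $\mathcal{G}_1$ in $\mathcal{G}_2$. $\mathrm{ex}_r(n,\mathcal{H},\mathcal{F})$ is the maximum number of copies of $\mathcal{H}$ in an $n$-vertex $r$-graph containing no copy of $\mathcal{F}$. $\binom{a}{b}=0$ if $a<b$. *)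

theory Defs
  imports Complex_Main "HOL-Library.Landau_Symbols"
begin

record 'a hypergraph =
  verts :: "'a set"
  edges :: "'a set set"

definition r_graph :: "nat \<Rightarrow> 'a hypergraph \<Rightarrow> bool" where
  "r_graph r G \<longleftrightarrow> finite (verts G) \<and> (\<forall>e\<in>edges G. e \<subseteq> verts G \<and> card e = r)"

definition subhypergraph :: "'a hypergraph \<Rightarrow> 'a hypergraph \<Rightarrow> bool" where
  "subhypergraph G' G \<longleftrightarrow> verts G' \<subseteq> verts G \<and> edges G' \<subseteq> edges G"

definition isomorphic :: "'a hypergraph \<Rightarrow> 'b hypergraph \<Rightarrow> bool" where
  "isomorphic H G \<longleftrightarrow>
     (\<exists>f. bij_betw f (verts H) (verts G) \<and> edges G = (\<lambda>e. f ` e) ` edges H)"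

text \<open>A copy of \<open>H\<close> in \<open>G\<close> is a (not necessarily induced) subhypergraph of \<open>G\<close> isomorphic
  to \<open>H\<close>; copies are thus counted as subhypergraphs, not as embeddings.\<close>

definition copies :: "'a hypergraph \<Rightarrow> 'b hypergraph \<Rightarrow> 'b hypergraph set" where
  "copies H G = {G'. subhypergraph G' G \<and> isomorphic H G'}"

definition num_copies :: "'a hypergraph \<Rightarrow> 'b hypergraph \<Rightarrow> nat" where
  "num_copies H G = card (copies H G)"

text \<open>Every finite hypergraph has an isomorphic copy on natural numbers, so it suffices to let
  the host hypergraph range over those. The maximum is taken over a finite set of values, see
  \<open>finite_num_copies_values\<close> below.\<close>

definition ex_r :: "nat \<Rightarrow> nat \<Rightarrow> 'a hypergraph \<Rightarrow> 'b hypergraph \<Rightarrow> nat" where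
  "ex_r r n H F = Max {num_copies H G | G :: nat hypergraph.
      r_graph r G \<and> card (verts G) = n \<and> copies F G = {}}"

definition complete_r_graph :: "nat \<Rightarrow> nat \<Rightarrow> nat hypergraph" where
  "complete_r_graph r s = \<lparr>verts = {..<s}, edges = {e. e \<subseteq> {..<s} \<and> card e = r}\<rparr>"

text \<open>The fixed set of \<open>t\<close> vertices is \<open>{..<t}\<close>, which presupposes \<open>t \<le> n\<close>.\<close>

definition S_graph :: "nat \<Rightarrow> nat \<Rightarrow> nat \<Rightarrow> nat hypergraph" where
  "S_graph r n t = \<lparr>verts = {..<n},
     edges = {e. e \<subseteq> {..<n} \<and> card e = r \<and> e \<inter> {..<t} \<noteq> {}}\<rparr>"

text \<open>In both cases the parameter is the number of edges.\<close>

definition path_graph :: "nat \<Rightarrow> nat hypergraph" where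
  "path_graph l = \<lparr>verts = {..l}, edges = {{i, i + 1} | i. i < l}\<rparr>"

definition cycle_graph :: "nat \<Rightarrow> nat hypergraph" where
  "cycle_graph l = \<lparr>verts = {..<l}, edges = {{i, (i + 1) mod l} | i. i < l}\<rparr>"

text \<open>The new vertices added to the edge \<open>e\<close> are \<open>Inr (e, j)\<close> for \<open>j < r - 2\<close>.\<close>

definition expansion :: "nat \<Rightarrow> 'a hypergraph \<Rightarrow> ('a + 'a set \<times> nat) hypergraph" where
  "expansion r F = \<lparr>verts = Inl ` verts F \<union> Inr ` (edges F \<times> {..<r - 2}),
     edges = (\<lambda>e. Inl ` e \<union> Inr ` ({e} \<times> {..<r - 2})) ` edges F\<rparr>"

definition disjoint_union :: "'i set \<Rightarrow> ('i \<Rightarrow> 'a hypergraph) \<Rightarrow> ('i \<times> 'a) hypergraph" where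
  "disjoint_union I Q = \<lparr>verts = (SIGMA i:I. verts (Q i)),
     edges = (\<Union>i\<in>I. (\<lambda>e. Pair i ` e) ` edges (Q i))\<rparr>"

lemma num_copies_le:
  fixes G :: "'b hypergraph"
  assumes "r_graph r G"
  shows "num_copies H G \<le> 2 ^ card (verts G) * 2 ^ (2 ^ card (verts G))"
proof -
  let ?V = "verts G"
  let ?S = "Pow ?V \<times> Pow (Pow ?V)"
  let ?f = "\<lambda>(V, E). \<lparr>verts = V, edges = E\<rparr> :: 'b hypergraph"
  have fin: "finite ?V" and sub: "edges G \<subseteq> Pow ?V"
    using assms by (auto simp: r_graph_def)
  have "copies H G \<subseteq> ?f ` ?S"
  proof
    fix G' assume "G' \<in> copies H G"
    then have "(verts G', edges G') \<in> ?S"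
      using sub by (auto simp: copies_def subhypergraph_def)
    moreover have "G' = ?f (verts G', edges G')" by simp
    ultimately show "G' \<in> ?f ` ?S" by (rule rev_image_eqI)
  qed
  then have "card (copies H G) \<le> card (?f ` ?S)"
    using fin by (intro card_mono) auto
  also have "\<dots> \<le> card ?S" using fin by (intro card_image_le) auto
  also have "\<dots> = 2 ^ card ?V * 2 ^ (2 ^ card ?V)"
    using fin by (simp add: card_cartesian_product card_Pow)
  finally show ?thesis by (simp add: num_copies_def)
qed

lemma finite_num_copies_values:
  "finite {num_copies H G | G :: nat hypergraph.
      r_graph r G \<and> card (verts G) = n \<and> copies F G = {}}"
  by (rule finite_subset[of _ "{..2 ^ n * 2 ^ (2 ^ n)}"]) (use num_copies_le in fastforce)+

end

theory Submission
  imports Defs "HOL-Library.FuncSet"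
begin

text \<open>
  Lower bound: every vertex of a path or cycle expansion lies in at most two edges, so a copy of
  \<open>Q\<^sub>1 \<union> \<dots> \<union> Q\<^sub>k\<close> in \<open>S\<^sub>n\<^sub>,\<^sub>t\<close> would need \<open>t + 1\<close> vertices of the fixed \<open>t\<close>-set.

  Upper bound: peeling off \<open>(r-1)\<close>-sets of codegree at most \<open>t\<close> destroys at most \<open>(t choose (s-r+1))\<close>
  cliques per \<open>(r-1)\<close>-set, so one may assume that every \<open>(r-1)\<close>-set of the shadow has codegree at least
  \<open>t + 1\<close>, and has to find the forbidden configuration if \<open>\<epsilon> n\<^sup>r\<^sup>-\<^sup>1\<close> edges are left. If all codegrees are
  large, it can be embedded greedily; hence otherwise there is a dense family \<open>A\<close> of \<open>(r-1)\<close>-sets whose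
  neighbourhoods have bounded size at least \<open>t + 1\<close>. After passing to a dense subfamily there is a
  set \<open>C\<close> of common neighbours while every other vertex is a neighbour of few members of \<open>A\<close>. By
  supersaturation there is a complete \<open>(r-1)\<close>-partite subfamily in which disjoint members have no
  common neighbours outside \<open>C\<close>. If \<open>|C| \<ge> t - 1\<close>, the vertices of \<open>C\<close> are used as every second vertex of the
  paths or cycles, and at most two missing ones are compensated in one component by neighbours
  outside \<open>C\<close>. If \<open>|C| \<le> t - 2\<close>, there are three neighbours outside \<open>C\<close> for each member, and a greedy list
  colouring chooses distinct ones for the edges of a cycle in the \<open>(r-1)\<close>-partite family; only odd
  cycles for \<open>r = 3\<close> need an extra argument.
\<close>

section \<open>Supersaturation\<close>

text \<open>The components need \<open>(l i + 1) div 2\<close> covering vertices each,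
  \<open>t + 1\<close> in all. So \<open>t - 1\<close> common neighbours leave at most two to be
  replaced, and a codegree of \<open>t + 1\<close> supplies as many neighbours outside C as are
  missing. With at most \<open>t - 2\<close> there are three outside: one colour is spent on closing
  the cycle, and two are enough for greedy colouring. Density of the poor sets rests on a linear
  bound of the edges by D times the shadow. It leaves at most r D |shadow| / d sets of codegree at
  least d, so edges without a poor subset are negligible once d is large against D^2 / \<epsilon>.
  The obstacle is r = 3: joints alternate between two parts, so no odd cycle has all its joints in
  the blow-up. The repair uses neighbours of pairs outside A. Hence labels also record the
  neighbours of poor pairs one exchange away, and these pairs too must have three neighbours outside
  C. Members of A violating this are few by the case of many common neighbours. They can be deleted
  only after C is fixed, so the structure found must survive the loss of half of A.\<close>

lemma power_ge_tangent:
  fixes a c :: real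
  assumes "a \<ge> 0" "c \<ge> 0"
  shows "a ^ k \<ge> c ^ k + real k * c ^ (k - 1) * (a - c)"
proof (induction k)
  case 0
  then show ?case by simp
next
  case (Suc k)
  have "a * a ^ k \<ge> a * (c ^ k + real k * c ^ (k - 1) * (a - c))"
    using Suc assms by (intro mult_left_mono) auto
  moreover have "a * (c ^ k + real k * c ^ (k - 1) * (a - c)) =
      c ^ Suc k + real (Suc k) * c ^ k * (a - c) + real k * c ^ (k - 1) * (a - c)\<^sup>2"
    by (cases k) (simp_all add: algebra_simps power2_eq_square)
  moreover have "real k * c ^ (k - 1) * (a - c)\<^sup>2 \<ge> 0" using assms by simp
  ultimately show ?case by simp
qed

text \<open>The tangent lines at \<open>c\<close> have nonnegative slope, so a lower bound
  \<open>c\<close> for the mean can replace the mean itself.\<close>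

lemma power_mean:
  fixes f :: "'i \<Rightarrow> real" and c :: real
  assumes "finite I" "I \<noteq> {}" "\<And>i. i \<in> I \<Longrightarrow> f i \<ge> 0" "c \<ge> 0" "sum f I \<ge> card I * c"
  shows "(\<Sum>i\<in>I. f i ^ k) \<ge> card I * c ^ k"
proof -
  have "(\<Sum>i\<in>I. f i ^ k) \<ge> (\<Sum>i\<in>I. c ^ k + real k * c ^ (k - 1) * (f i - c))"
    using assms by (intro sum_mono power_ge_tangent) auto
  moreover have "(\<Sum>i\<in>I. c ^ k + real k * c ^ (k - 1) * (f i - c))
      = card I * c ^ k + real k * c ^ (k - 1) * (sum f I - card I * c)"
    by (simp add: sum.distrib sum_distrib_left[symmetric] sum_subtractf)
  moreover have "real k * c ^ (k - 1) * (sum f I - card I * c) \<ge> 0"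
    using assms by simp
  ultimately show ?thesis by linarith
qed

definition nlists :: "nat \<Rightarrow> 'a set \<Rightarrow> 'a list set" where
  "nlists k V = {xs. set xs \<subseteq> V \<and> length xs = k}"

lemma finite_nlists: "finite V \<Longrightarrow> finite (nlists k V)"
  by (simp add: nlists_def finite_lists_length_eq)

lemma card_nlists: "finite V \<Longrightarrow> card (nlists k V) = card V ^ k"
  by (simp add: nlists_def card_lists_length_eq)

lemma nlists_0 [simp]: "nlists 0 V = {[]}"
  by (auto simp: nlists_def)

lemma nlists_Suc: "nlists (Suc k) V = (\<lambda>(x, xs). x # xs) ` (V \<times> nlists k V)"
  by (auto simp: nlists_def length_Suc_conv image_iff)

lemma inj_Cons: "inj_on (\<lambda>(x, xs). x # xs) A"
  by (auto simp: inj_on_def)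

text \<open>Lists instead of sets admit degenerate boxes, which keeps the induction free of error
  terms. For a list \<open>xs\<close> of first coordinates the induction hypothesis is applied to
  the common link \<open>As xs\<close>; convexity is used once for the average density of the links
  and once for the sum over them.\<close>

lemma supersaturation:
  fixes V :: "'a set"
  assumes V: "finite V" "V \<noteq> {}" and "c \<ge> 0" "A \<subseteq> nlists q V"
    and "real (card A) \<ge> c * real (card V) ^ q"
  shows "real (card {xss \<in> nlists q (nlists m V). listset (map set xss) \<subseteq> A})
     \<ge> c ^ (m ^ q) * real (card V) ^ (q * m)"
  using assms(3-)
proof (induction q arbitrary: A c)
  case 0
  show ?case
  proof (cases "A = {}")
    case True
    then show ?thesis using 0 by simp
  next
    case False
    then have "A = {[]}" using 0(2) by (simp add: subset_singleton_iff)
    moreover have "{xss \<in> nlists 0 (nlists m V). listset (map set xss) \<subseteq> {[]}} = {[]}"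
      by auto
    ultimately show ?thesis using 0(3) by simp
  qed
next
  case (Suc q)
  define N where "N = real (card V)"
  have N: "N > 0" using V by (simp add: N_def card_gt_0_iff)
  define As where "As xs = {ys \<in> nlists q V. \<forall>x\<in>set xs. x # ys \<in> A}" for xs
  define d where "d ys = card {x\<in>V. x # ys \<in> A}" for ys
  have fin: "finite (nlists k V)" for k using V by (simp add: finite_nlists)
  have "A = (\<lambda>(x, xs). x # xs) ` {(x, ys). x \<in> V \<and> ys \<in> nlists q V \<and> x # ys \<in> A}"
    using Suc.prems(2) by (fastforce simp: nlists_Suc)
  from arg_cong[OF this, of card] have "card A = card {(x, ys). x \<in> V \<and> ys \<in> nlists q V \<and> x # ys \<in> A}"
    by (rule trans) (rule card_image[OF inj_Cons])
  also have "\<dots> = card (prod.swap ` {(x, ys). x \<in> V \<and> ys \<in> nlists q V \<and> x # ys \<in> A})"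
    by (simp add: card_image)
  also have "prod.swap ` {(x, ys). x \<in> V \<and> ys \<in> nlists q V \<and> x # ys \<in> A}
      = (SIGMA ys:nlists q V. {x\<in>V. x # ys \<in> A})" by (auto simp: image_iff)
  also have "card \<dots> = (\<Sum>ys\<in>nlists q V. d ys)"
    using V fin by (simp add: d_def)
  finally have cA: "card A = (\<Sum>ys\<in>nlists q V. d ys)" .
  \<comment> \<open>Double counting of pairs (xs, ys): given \<open>ys\<close>, each of the m
    entries of \<open>xs\<close> ranges freely over the \<open>d ys\<close> possible first
    coordinates.\<close>
  have "(\<Sum>xs\<in>nlists m V. card (As xs)) = card (SIGMA xs:nlists m V. As xs)"
    using fin by (subst card_SigmaI) (auto simp: As_def)
  also have "\<dots> = card (prod.swap ` (SIGMA xs:nlists m V. As xs))"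
    by (simp add: card_image)
  also have "prod.swap ` (SIGMA xs:nlists m V. As xs)
     = (SIGMA ys:nlists q V. nlists m {x\<in>V. x # ys \<in> A})"
    by (auto simp: image_iff As_def nlists_def)
  also have "card \<dots> = (\<Sum>ys\<in>nlists q V. d ys ^ m)"
    using V fin by (subst card_SigmaI) (auto simp: card_nlists finite_nlists d_def)
  finally have sAs: "(\<Sum>xs\<in>nlists m V. card (As xs)) = (\<Sum>ys\<in>nlists q V. d ys ^ m)" .
  have ne: "nlists k V \<noteq> {}" for k
    using V N by (metis card_nlists card.empty card_gt_0_iff zero_less_power less_numeral_extra(3))
  have 1: "real (\<Sum>xs\<in>nlists m V. card (As xs)) \<ge> N ^ q * (c * N) ^ m"
  proof -
    have "real (card (nlists q V)) * (c * N) ^ m \<le> (\<Sum>ys\<in>nlists q V. real (d ys) ^ m)"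
    proof (rule power_mean)
      have "real (card A) \<ge> c * N ^ Suc q" using Suc.prems by (simp add: N_def)
      then show "real (card (nlists q V)) * (c * N) \<le> (\<Sum>ys\<in>nlists q V. real (d ys))"
        using V by (simp add: cA card_nlists N_def algebra_simps)
    qed (use fin ne N Suc.prems in auto)
    then show ?thesis unfolding sAs using V by (simp add: card_nlists N_def)
  qed
  have 2: "{xss \<in> nlists (Suc q) (nlists m V). listset (map set xss) \<subseteq> A}
     = (\<lambda>(x, xs). x # xs) ` (SIGMA xs:nlists m V.
           {xss \<in> nlists q (nlists m V). listset (map set xss) \<subseteq> As xs})"
  proof -
    have ls: "listset (map set xss) \<subseteq> nlists q V" if "xss \<in> nlists q (nlists m V)" for xss
      using that
    proof (induction q arbitrary: xss)
      case 0
      then show ?case by (auto simp: nlists_def)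
    next
      case (Suc q)
      then show ?case by (auto simp: nlists_Suc set_Cons_def) (auto simp: nlists_def)
    qed
    have iff: "listset (map set (xs # xss)) \<subseteq> A \<longleftrightarrow> listset (map set xss) \<subseteq> As xs"
      if "xss \<in> nlists q (nlists m V)" for xs xss
      using ls[OF that] unfolding As_def by (auto simp: set_Cons_def)
    show ?thesis
    proof (intro equalityI subsetI)
      fix ys assume "ys \<in> {xss \<in> nlists (Suc q) (nlists m V). listset (map set xss) \<subseteq> A}"
      then obtain xs xss where "ys = xs # xss" "xs \<in> nlists m V" "xss \<in> nlists q (nlists m V)"
        "listset (map set (xs # xss)) \<subseteq> A" unfolding nlists_Suc by auto
      then show "ys \<in> (\<lambda>(x, xs). x # xs) ` (SIGMA xs:nlists m V.
           {xss \<in> nlists q (nlists m V). listset (map set xss) \<subseteq> As xs})"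
        using iff[of xss xs] by (intro image_eqI[of _ _ "(xs, xss)"]) simp_all
    next
      fix ys assume "ys \<in> (\<lambda>(x, xs). x # xs) ` (SIGMA xs:nlists m V.
           {xss \<in> nlists q (nlists m V). listset (map set xss) \<subseteq> As xs})"
      then obtain xs xss where *: "ys = xs # xss" "xs \<in> nlists m V" "xss \<in> nlists q (nlists m V)"
        "listset (map set xss) \<subseteq> As xs" by auto
      then have "listset (map set (xs # xss)) \<subseteq> A" using iff[of xss xs] by blast
      then show "ys \<in> {xss \<in> nlists (Suc q) (nlists m V). listset (map set xss) \<subseteq> A}"
        using * unfolding nlists_Suc by blast
    qed
  qed
  define g where "g xs = card {xss \<in> nlists q (nlists m V). listset (map set xss) \<subseteq> As xs}" for xs
  have 3: "card {xss \<in> nlists (Suc q) (nlists m V). listset (map set xss) \<subseteq> A}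
      = (\<Sum>xs\<in>nlists m V. g xs)"
    unfolding 2 using fin finite_nlists[OF fin]
    by (subst card_image[OF inj_Cons], subst card_SigmaI) (auto simp: g_def)
  have 4: "real (g xs) \<ge> (card (As xs) / N ^ q) ^ (m ^ q) * N ^ (q * m)" for xs
    unfolding g_def N_def
    by (rule Suc.IH) (use V N in \<open>auto simp: As_def N_def\<close>)
  have "(\<Sum>xs\<in>nlists m V. real (g xs)) \<ge>
      (\<Sum>xs\<in>nlists m V. (card (As xs) / N ^ q) ^ (m ^ q) * N ^ (q * m))"
    by (intro sum_mono 4)
  \<comment> \<open>Second use of convexity: by the first, the links have average density at least
    \<open>c ^ m\<close>.\<close>
  moreover have "(\<Sum>xs\<in>nlists m V. (card (As xs) / N ^ q) ^ (m ^ q)) \<ge>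
     card (nlists m V) * (c ^ m) ^ (m ^ q)"
  proof (rule power_mean)
    have "N ^ m * c ^ m \<le> real (\<Sum>xs\<in>nlists m V. card (As xs)) / N ^ q"
      using 1 N by (simp add: field_simps power_mult_distrib)
    then show "real (card (nlists m V)) * c ^ m \<le> (\<Sum>xs\<in>nlists m V. real (card (As xs)) / N ^ q)"
      using V by (simp add: card_nlists N_def sum_divide_distrib)
  qed (use fin ne N Suc.prems in auto)
  then have "(\<Sum>xs\<in>nlists m V. (card (As xs) / N ^ q) ^ (m ^ q) * N ^ (q * m)) \<ge>
     card (nlists m V) * (c ^ m) ^ (m ^ q) * N ^ (q * m)"
    unfolding sum_distrib_right[symmetric] using N by (intro mult_right_mono) auto
  moreover have "card (nlists m V) * (c ^ m) ^ (m ^ q) * N ^ (q * m) = c ^ (m ^ Suc q) * N ^ (Suc q * m)"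
    using V by (simp add: card_nlists N_def power_mult power_add mult.commute)
  ultimately show ?case unfolding 3 N_def[symmetric] by simp
qed

section \<open>Counting maps from a grid into the vertex set\<close>

lemma inj_on_restrict_pair:
  "inj_on (\<lambda>\<psi>. (restrict \<psi> J, restrict \<psi> K)) ((J \<union> K) \<rightarrow>\<^sub>E V)"
proof (rule inj_onI)
  fix x y assume xy: "x \<in> (J \<union> K) \<rightarrow>\<^sub>E V" "y \<in> (J \<union> K) \<rightarrow>\<^sub>E V"
    and e: "(restrict x J, restrict x K) = (restrict y J, restrict y K)"
  show "x = y"
  proof (rule PiE_ext[OF xy])
    fix i assume "i \<in> J \<union> K"
    then show "x i = y i" using e by (metis Pair_inject restrict_apply Un_iff)
  qed
qed

lemma card_PiE_restrict_le:
  assumes "finite I" "J \<subseteq> I" "finite V" "S \<subseteq> J \<rightarrow>\<^sub>E V"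
  shows "card {\<psi> \<in> I \<rightarrow>\<^sub>E V. restrict \<psi> J \<in> S} \<le> card S * card V ^ (card I - card J)"
proof -
  have fin: "finite J" "finite S" "finite ((I - J) \<rightarrow>\<^sub>E V)"
    using assms by (auto intro: finite_subset finite_PiE intro!: finite_subset[OF assms(4)])
  have "card {\<psi> \<in> I \<rightarrow>\<^sub>E V. restrict \<psi> J \<in> S} \<le> card (S \<times> ((I - J) \<rightarrow>\<^sub>E V))"
  proof (rule card_inj_on_le[where f = "\<lambda>\<psi>. (restrict \<psi> J, restrict \<psi> (I - J))"])
    show "inj_on (\<lambda>\<psi>. (restrict \<psi> J, restrict \<psi> (I - J))) {\<psi> \<in> I \<rightarrow>\<^sub>E V. restrict \<psi> J \<in> S}"
      by (rule inj_on_subset[OF inj_on_restrict_pair[of J "I - J" V]]) (use assms(2) in \<open>auto simp: Un_absorb1\<close>)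
  qed (use fin assms in auto)
  also have "\<dots> = card S * card V ^ (card I - card J)"
    using assms fin by (simp add: card_cartesian_product card_PiE card_Diff_subset)
  finally show ?thesis .
qed

text \<open>Confining the value at \<open>p\<close> to boundedly many options fixed by the other
  values costs a factor of order \<open>card V\<close>. This makes coincidences of a vertex with
  others negligible.\<close>

lemma card_PiE_determined_le:
  assumes "finite I" "p \<in> I" "finite V"
    and T: "\<And>\<chi>. finite (T \<chi>)" "\<And>\<chi>. card (T \<chi>) \<le> K"
  shows "card {\<psi> \<in> I \<rightarrow>\<^sub>E V. \<psi> p \<in> T (restrict \<psi> (I - {p}))} \<le> K * card V ^ (card I - 1)"
proof -
  have fin: "finite ((I - {p}) \<rightarrow>\<^sub>E V)" using assms by (auto intro: finite_PiE)
  have "card {\<psi> \<in> I \<rightarrow>\<^sub>E V. \<psi> p \<in> T (restrict \<psi> (I - {p}))}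
     \<le> card (SIGMA \<chi>:(I - {p}) \<rightarrow>\<^sub>E V. T \<chi>)"
  proof (rule card_inj_on_le[where f = "\<lambda>\<psi>. (restrict \<psi> (I - {p}), \<psi> p)"])
    show "inj_on (\<lambda>\<psi>. (restrict \<psi> (I - {p}), \<psi> p)) {\<psi> \<in> I \<rightarrow>\<^sub>E V. \<psi> p \<in> T (restrict \<psi> (I - {p}))}"
    proof (rule inj_onI)
      fix x y
      assume a: "x \<in> {\<psi> \<in> I \<rightarrow>\<^sub>E V. \<psi> p \<in> T (restrict \<psi> (I - {p}))}"
          "y \<in> {\<psi> \<in> I \<rightarrow>\<^sub>E V. \<psi> p \<in> T (restrict \<psi> (I - {p}))}"
        and e: "(restrict x (I - {p}), x p) = (restrict y (I - {p}), y p)"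
      show "x = y"
      proof (rule PiE_ext[of x I "\<lambda>_. V" y])
        fix i assume "i \<in> I"
        then show "x i = y i" using e
          by (cases "i = p") (simp, metis Pair_inject restrict_apply DiffI singletonD)
      qed (use a in auto)
    qed
  qed (use fin T in \<open>auto split: if_splits\<close>)
  also have "\<dots> \<le> (\<Sum>\<chi>\<in>(I - {p}) \<rightarrow>\<^sub>E V. K)"
    using fin T by (subst card_SigmaI) (auto simp del: sum_constant intro!: sum_mono)
  also have "\<dots> = K * card V ^ (card I - 1)"
    using assms by (simp add: card_PiE)
  finally show ?thesis .
qed

lemma listset_nthI:
  "length ys = length As \<Longrightarrow> (\<And>i. i < length As \<Longrightarrow> ys ! i \<in> As ! i) \<Longrightarrow> ys \<in> listset As"
proof (induction As arbitrary: ys)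
  case Nil
  then show ?case by simp
next
  case (Cons A As)
  then obtain z zs where ys: "ys = z # zs" by (cases ys) auto
  have "z \<in> A" using Cons.prems(2)[of 0] ys by simp
  moreover have "zs \<in> listset As"
    using Cons.prems(1) Cons.prems(2)[of "Suc i" for i] ys by (intro Cons.IH) auto
  ultimately show ?case by (auto simp: ys set_Cons_def)
qed

text \<open>A set of grid positions rather than a choice function, so that shared vertices of
  blow-up edges are intersections of such sets.\<close>

definition sel :: "nat \<Rightarrow> (nat \<Rightarrow> nat) \<Rightarrow> (nat \<times> nat) set" where
  "sel q \<alpha> = (\<lambda>i. (i, \<alpha> i)) ` {..<q}"

definition sels :: "nat \<Rightarrow> nat \<Rightarrow> (nat \<times> nat) set set" where
  "sels q m = {sel q \<alpha> | \<alpha>. \<forall>i<q. \<alpha> i < m}"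

lemma sels_subset: "J \<in> sels q m \<Longrightarrow> J \<subseteq> {..<q} \<times> {..<m}"
  by (auto simp: sels_def sel_def)

lemma card_sels: "J \<in> sels q m \<Longrightarrow> card J = q"
  by (auto simp: sels_def sel_def card_image inj_on_def)

lemma finite_sels: "finite (sels q m)"
  by (rule finite_subset[of _ "Pow ({..<q} \<times> {..<m})"]) (use sels_subset in auto)

lemma card_sels_le: "card (sels q m) \<le> 2 ^ (q * m)"
proof -
  have "card (sels q m) \<le> card (Pow ({..<q} \<times> {..<m}))"
    by (rule card_mono) (use sels_subset in auto)
  then show ?thesis by (simp add: card_Pow)
qed

text \<open>Transfers the count from lists to maps on the grid. One ordering per member of
  \<open>A\<close> already gives \<open>card A \<le> card A'\<close>; all orderings would only
  improve the constant. The maps need not be injective yet.\<close>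

lemma card_blowups_ge:
  fixes V :: "'a set"
  assumes V: "finite V" "V \<noteq> {}" and c: "c \<ge> 0" and A: "A \<subseteq> {f. f \<subseteq> V \<and> card f = q}"
    and cA: "real (card A) \<ge> c * real (card V) ^ q"
  shows "real (card {\<psi> \<in> {..<q} \<times> {..<m} \<rightarrow>\<^sub>E V. \<forall>J\<in>sels q m. \<psi> ` J \<in> A})
     \<ge> c ^ (m ^ q) * real (card V) ^ (q * m)"
proof -
  let ?I = "{..<q} \<times> {..<m}"
  define A' where "A' = {ys \<in> nlists q V. set ys \<in> A}"
  have finA': "finite A'" using finite_nlists[OF V(1), of q] by (simp add: A'_def)
  have "A \<subseteq> set ` A'"
  proof
    fix f assume f: "f \<in> A"
    then have "finite f" using A V finite_subset by blast
    then obtain ys where "set ys = f" "distinct ys" using finite_distinct_list by blast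
    moreover from this have "length ys = q" using f A distinct_card by fastforce
    ultimately show "f \<in> set ` A'" using f A by (force simp: A'_def nlists_def)
  qed
  then have "card A \<le> card A'" by (rule surj_card_le[OF finA'])
  then have "real (card A') \<ge> c * real (card V) ^ q" using cA by linarith
  then have "real (card {xss \<in> nlists q (nlists m V). listset (map set xss) \<subseteq> A'})
     \<ge> c ^ (m ^ q) * real (card V) ^ (q * m)"
    by (intro supersaturation V c) (auto simp: A'_def)
  moreover have "card {xss \<in> nlists q (nlists m V). listset (map set xss) \<subseteq> A'} \<le>
     card {\<psi> \<in> ?I \<rightarrow>\<^sub>E V. \<forall>J\<in>sels q m. \<psi> ` J \<in> A}"
  proof (rule card_inj_on_le[where f = "\<lambda>xss. \<lambda>(i, a)\<in>?I. xss ! i ! a"])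
    show "inj_on (\<lambda>xss. \<lambda>(i, a)\<in>?I. xss ! i ! a) {xss \<in> nlists q (nlists m V). listset (map set xss) \<subseteq> A'}"
    proof (rule inj_onI)
      fix x y :: "'a list list"
      assume x: "x \<in> {xss \<in> nlists q (nlists m V). listset (map set xss) \<subseteq> A'}"
        and y: "y \<in> {xss \<in> nlists q (nlists m V). listset (map set xss) \<subseteq> A'}"
        and e: "(\<lambda>(i, a)\<in>?I. x ! i ! a) = (\<lambda>(i, a)\<in>?I. y ! i ! a)"
      have e': "x ! i ! a = y ! i ! a" if "i < q" "a < m" for i a
        using fun_cong[OF e, of "(i, a)"] that by simp
      have len: "length x = q" "length y = q" "\<And>i. i < q \<Longrightarrow> length (x ! i) = m"
        "\<And>i. i < q \<Longrightarrow> length (y ! i) = m"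
        using x y by (auto simp: nlists_def subset_iff)
      show "x = y"
        by (rule nth_equalityI) (auto simp: len e' intro!: nth_equalityI)
    qed
    show "(\<lambda>xss. \<lambda>(i, a)\<in>?I. xss ! i ! a) ` {xss \<in> nlists q (nlists m V). listset (map set xss) \<subseteq> A'}
      \<subseteq> {\<psi> \<in> ?I \<rightarrow>\<^sub>E V. \<forall>J\<in>sels q m. \<psi> ` J \<in> A}"
    proof (rule image_subsetI)
      fix x assume x: "x \<in> {xss \<in> nlists q (nlists m V). listset (map set xss) \<subseteq> A'}"
      have len: "length x = q" "\<And>i. i < q \<Longrightarrow> length (x ! i) = m"
        "\<And>i. i < q \<Longrightarrow> set (x ! i) \<subseteq> V"
        using x nth_mem by (fastforce simp: nlists_def)+
      let ?\<psi> = "\<lambda>(i, a)\<in>?I. x ! i ! a"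
      have "?\<psi> ` J \<in> A" if J: "J \<in> sels q m" for J
      proof -
        from J obtain \<alpha> where \<alpha>: "J = sel q \<alpha>" "\<And>i. i < q \<Longrightarrow> \<alpha> i < m" by (auto simp: sels_def)
        let ?ys = "map (\<lambda>i. x ! i ! \<alpha> i) [0..<q]"
        have "?ys \<in> listset (map set x)" by (rule listset_nthI) (auto simp: len \<alpha>)
        then have "set ?ys \<in> A" using x by (auto simp: A'_def)
        moreover have "?\<psi> ` J = set ?ys"
          by (auto simp: \<alpha> sel_def image_iff)
        ultimately show ?thesis by simp
      qed
      moreover have "?\<psi> \<in> ?I \<rightarrow>\<^sub>E V"
        using len by (auto simp: subset_iff intro!: restrict_PiE_iff[THEN iffD2])
      ultimately show "?\<psi> \<in> {\<psi> \<in> ?I \<rightarrow>\<^sub>E V. \<forall>J\<in>sels q m. \<psi> ` J \<in> A}" by blast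
    qed
    show "finite {\<psi> \<in> ?I \<rightarrow>\<^sub>E V. \<forall>J\<in>sels q m. \<psi> ` J \<in> A}"
      using V by (simp add: finite_PiE)
  qed
  ultimately show ?thesis by linarith
qed

section \<open>Generic blow-ups\<close>

text \<open>
  \<open>\<phi> (i, a)\<close> is the \<open>a\<close>-th vertex of the \<open>i\<close>-th part of a complete \<open>q\<close>-partite subgraph of \<open>A\<close>,
  whose edges are the sets \<open>\<phi> ` J\<close> with \<open>J\<close> a graph of a function (\<open>J \<in> sels q m\<close>). \<open>\<Lambda> f\<close> is a
  bounded set of labels of \<open>f\<close>, and the labels in \<open>C\<close> are those shared by all \<open>f\<close>.
\<close>

definition generic :: "nat \<Rightarrow> nat \<Rightarrow> 'a set set \<Rightarrow> ('a set \<Rightarrow> 'a set) \<Rightarrow> 'a set \<Rightarrow> 'a set \<Rightarrow>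
    (nat \<times> nat \<Rightarrow> 'a) \<Rightarrow> bool" where
  "generic q m A \<Lambda> C B \<phi> \<longleftrightarrow> inj_on \<phi> ({..<q} \<times> {..<m}) \<and> \<phi> ` ({..<q} \<times> {..<m}) \<inter> B = {} \<and>
     (\<forall>J\<in>sels q m. \<phi> ` J \<in> A \<and> (\<Lambda> (\<phi> ` J) - C) \<inter> B = {} \<and>
        (\<forall>p\<in>{..<q} \<times> {..<m} - J. \<phi> p \<notin> \<Lambda> (\<phi> ` J))) \<and>
     (\<forall>J\<in>sels q m. \<forall>J'\<in>sels q m. J \<inter> J' = {} \<longrightarrow> \<Lambda> (\<phi> ` J) \<inter> \<Lambda> (\<phi> ` J') \<subseteq> C)"

lemma genericD:
  assumes "generic q m A \<Lambda> C B \<phi>"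
  shows "inj_on \<phi> ({..<q} \<times> {..<m})" "\<phi> ` ({..<q} \<times> {..<m}) \<inter> B = {}"
    "\<And>J. J \<in> sels q m \<Longrightarrow> \<phi> ` J \<in> A" "\<And>J. J \<in> sels q m \<Longrightarrow> (\<Lambda> (\<phi> ` J) - C) \<inter> B = {}"
    "\<And>J p. J \<in> sels q m \<Longrightarrow> p \<in> {..<q} \<times> {..<m} - J \<Longrightarrow> \<phi> p \<notin> \<Lambda> (\<phi> ` J)"
    "\<And>J J'. J \<in> sels q m \<Longrightarrow> J' \<in> sels q m \<Longrightarrow> J \<inter> J' = {} \<Longrightarrow> \<Lambda> (\<phi> ` J) \<inter> \<Lambda> (\<phi> ` J') \<subseteq> C"
  using assms unfolding generic_def by blast+

lemma card_UN_le_const: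
  assumes "finite I" "\<And>i. i \<in> I \<Longrightarrow> real (card (F i)) \<le> k" "card I \<le> M" "k \<ge> 0"
  shows "real (card (\<Union>i\<in>I. F i)) \<le> real M * k"
proof -
  have "real (card (\<Union>i\<in>I. F i)) \<le> real (\<Sum>i\<in>I. card (F i))"
    using card_UN_le[OF assms(1)] by (simp only: of_nat_le_iff)
  also have "\<dots> = (\<Sum>i\<in>I. real (card (F i)))" by simp
  also have "\<dots> \<le> real (card I) * k" by (rule sum_bounded_above) (rule assms)
  also have "\<dots> \<le> real M * k" using assms by (intro mult_right_mono) auto
  finally show ?thesis .
qed

lemma card_orderings_le:
  assumes V: "finite V" and A: "A \<subseteq> {f. f \<subseteq> V \<and> card f = q}" and J: "finite J" "card J = q"
  shows "card {\<chi> \<in> J \<rightarrow>\<^sub>E V. \<chi> ` J \<in> A \<and> v \<in> \<Lambda> (\<chi> ` J)} \<le> q ^ q * card {f \<in> A. v \<in> \<Lambda> f}"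
proof -
  let ?F = "{f \<in> A. v \<in> \<Lambda> f}"
  have finA: "finite A" using A V by (rule_tac finite_subset[of _ "Pow V"]) auto
  have ff: "finite f" "card f = q" if "f \<in> A" for f using that A V finite_subset by blast+
  have "{\<chi> \<in> J \<rightarrow>\<^sub>E V. \<chi> ` J \<in> A \<and> v \<in> \<Lambda> (\<chi> ` J)} \<subseteq> (\<Union>f\<in>?F. J \<rightarrow>\<^sub>E f)"
    by (fastforce simp: PiE_iff)
  then have "card {\<chi> \<in> J \<rightarrow>\<^sub>E V. \<chi> ` J \<in> A \<and> v \<in> \<Lambda> (\<chi> ` J)} \<le> card (\<Union>f\<in>?F. J \<rightarrow>\<^sub>E f)"
    using finA ff J by (intro card_mono) (auto intro!: finite_PiE)
  also have "\<dots> \<le> (\<Sum>f\<in>?F. card (J \<rightarrow>\<^sub>E f))" using finA by (intro card_UN_le) auto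
  also have "\<dots> = (\<Sum>f\<in>?F. q ^ q)" using ff J by (intro sum.cong) (auto simp: card_PiE)
  finally show ?thesis by (simp add: mult.commute)
qed

lemma card_bad_label_le:
  assumes V: "finite V" and A: "A \<subseteq> {f. f \<subseteq> V \<and> card f = q}"
    and pop: "\<And>v. v \<notin> C \<Longrightarrow> real (card {f \<in> A. v \<in> \<Lambda> f}) \<le> \<eta> * real (card V) ^ q"
    and B: "finite B" "card B \<le> \<beta>" and J: "finite J" "card J = q" and \<eta>: "\<eta> \<ge> 0"
  shows "real (card {\<chi> \<in> J \<rightarrow>\<^sub>E V. \<chi> ` J \<in> A \<and> (\<Lambda> (\<chi> ` J) - C) \<inter> B \<noteq> {}})
     \<le> real \<beta> * (real (q ^ q) * (\<eta> * real (card V) ^ q))"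
proof -
  have eq: "{\<chi> \<in> J \<rightarrow>\<^sub>E V. \<chi> ` J \<in> A \<and> (\<Lambda> (\<chi> ` J) - C) \<inter> B \<noteq> {}}
     = (\<Union>v\<in>B - C. {\<chi> \<in> J \<rightarrow>\<^sub>E V. \<chi> ` J \<in> A \<and> v \<in> \<Lambda> (\<chi> ` J)})" by blast
  show ?thesis unfolding eq
  proof (rule card_UN_le_const)
    fix v assume v: "v \<in> B - C"
    have "real (card {\<chi> \<in> J \<rightarrow>\<^sub>E V. \<chi> ` J \<in> A \<and> v \<in> \<Lambda> (\<chi> ` J)}) \<le> real (q ^ q * card {f \<in> A. v \<in> \<Lambda> f})"
      using card_orderings_le[OF V A J] by (simp only: of_nat_le_iff)
    also have "\<dots> \<le> real (q ^ q) * (\<eta> * real (card V) ^ q)"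
      unfolding of_nat_mult using pop v by (intro mult_left_mono) auto
    finally show "real (card {\<chi> \<in> J \<rightarrow>\<^sub>E V. \<chi> ` J \<in> A \<and> v \<in> \<Lambda> (\<chi> ` J)})
       \<le> real (q ^ q) * (\<eta> * real (card V) ^ q)" .
  next
    show "card (B - C) \<le> \<beta>" using B by (meson card_mono Diff_subset le_trans)
  qed (use B \<eta> in auto)
qed

text \<open>A union bound over maps of the grid, a positive proportion of which have all
  transversals in \<open>A\<close>. Coincidences of a vertex with \<open>B\<close>, another vertex
  or a label of a transversal missing it are of lower order. Unwanted coincidences of labels outside
  \<open>C\<close> have density proportional to \<eta>, since no such label is popular.\<close>

lemma generic_blowup:
  fixes q m b \<beta> :: nat and c :: real
  assumes q: "q \<ge> 1" and m: "m \<ge> 1" and c: "c > 0"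
  shows "\<exists>\<eta>>0. \<exists>n0. \<forall>(V :: 'a set) A \<Lambda> B C. finite V \<longrightarrow> n0 \<le> card V \<longrightarrow>
     A \<subseteq> {f. f \<subseteq> V \<and> card f = q} \<longrightarrow> c * real (card V) ^ q \<le> real (card A) \<longrightarrow>
     (\<forall>f\<in>A. finite (\<Lambda> f) \<and> card (\<Lambda> f) \<le> b) \<longrightarrow> finite B \<longrightarrow> card B \<le> \<beta> \<longrightarrow>
     (\<forall>v. v \<notin> C \<longrightarrow> real (card {f \<in> A. v \<in> \<Lambda> f}) \<le> \<eta> * real (card V) ^ q) \<longrightarrow>
     (\<exists>\<phi>. generic q m A \<Lambda> C B \<phi>)"
proof -
  define K :: nat where "K = 2 ^ (q * m)"
  \<comment> \<open>\<open>X\<close> and \<open>Y\<close> are the coefficients of the failures of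
    order \<open>N ^ (q * m - 1)\<close> and \<open>\<eta> * N ^ (q * m)\<close>; \<open>n0\<close>
    and \<eta> keep each within half of the good maps.\<close>
  define X where "X = q * m * (\<beta> + q * m + K * b)"
  define Y where "Y = K * (\<beta> * q ^ q) + K * (K * (b * q ^ q))"
  define cc where "cc = c ^ (m ^ q)"
  have cc: "cc > 0" using c by (simp add: cc_def)
  define \<eta> where "\<eta> = cc / (2 * (real Y + 1))"
  have \<eta>: "\<eta> > 0" using cc by (simp add: \<eta>_def)
  define n0 where "n0 = nat \<lceil>2 * real X / cc\<rceil> + 1"
  show ?thesis
  proof (intro exI[of _ \<eta>] conjI \<eta> exI[of _ n0] allI impI)
    fix V B C :: "'a set" and A :: "'a set set" and \<Lambda> :: "'a set \<Rightarrow> 'a set"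
    assume V: "finite V" and n0: "n0 \<le> card V" and A: "A \<subseteq> {f. f \<subseteq> V \<and> card f = q}"
      and cA: "c * real (card V) ^ q \<le> real (card A)"
      and \<Lambda>: "\<forall>f\<in>A. finite (\<Lambda> f) \<and> card (\<Lambda> f) \<le> b" and B: "finite B" "card B \<le> \<beta>"
      and pop: "\<forall>v. v \<notin> C \<longrightarrow> real (card {f \<in> A. v \<in> \<Lambda> f}) \<le> \<eta> * real (card V) ^ q"
    let ?I = "{..<q} \<times> {..<m}"
    define N where "N = card V"
    have N: "N > 0" using n0 by (simp add: n0_def N_def)
    have Vne: "V \<noteq> {}" using N by (auto simp: N_def)
    have cI: "card ?I = q * m" "finite ?I" by auto
    define P where "P = (?I \<rightarrow>\<^sub>E V)"
    have finP: "finite P" using V by (auto simp: P_def intro: finite_PiE)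
    \<comment> \<open>Labels are bounded only on \<open>A\<close>; the empty set elsewhere makes the
      bound hold for the image of any map.\<close>
    define \<Lambda>' where "\<Lambda>' f = (if f \<in> A then \<Lambda> f else {})" for f
    have \<Lambda>': "finite (\<Lambda>' f)" "card (\<Lambda>' f) \<le> b" for f using \<Lambda> by (auto simp: \<Lambda>'_def)
    define T where "T p \<chi> = B \<union> (\<chi> ` (?I - {p}) \<union> (\<Union>J\<in>{J\<in>sels q m. p \<notin> J}. \<Lambda>' (\<chi> ` J)))" for p and \<chi> :: "nat \<times> nat \<Rightarrow> 'a"
    define Bad1 where "Bad1 p = {\<psi> \<in> P. \<psi> p \<in> T p (restrict \<psi> (?I - {p}))}" for p
    define Bad2 where "Bad2 J = {\<psi> \<in> P. \<psi> ` J \<in> A \<and> (\<Lambda> (\<psi> ` J) - C) \<inter> B \<noteq> {}}" for J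
    define Bad3 where "Bad3 J J' = {\<psi> \<in> P. \<psi> ` J \<in> A \<and> \<psi> ` J' \<in> A \<and> (\<Lambda> (\<psi> ` J') - C) \<inter> \<Lambda> (\<psi> ` J) \<noteq> {}}" for J J'
    define Good where "Good = {\<psi> \<in> ?I \<rightarrow>\<^sub>E V. \<forall>J\<in>sels q m. \<psi> ` J \<in> A}"
    define Bad where "Bad = (\<Union>p\<in>?I. Bad1 p) \<union> ((\<Union>J\<in>sels q m. Bad2 J) \<union>
       (\<Union>J\<in>sels q m. \<Union>J'\<in>{J'\<in>sels q m. J \<inter> J' = {}}. Bad3 J J'))"
    have Good: "real (card Good) \<ge> cc * real N ^ (q * m)"
      unfolding Good_def cc_def N_def using c by (intro card_blowups_ge V Vne A cA) auto
    have J: "J \<subseteq> ?I" "card J = q" "finite J" if "J \<in> sels q m" for J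
      using sels_subset[OF that] card_sels[OF that] by (auto intro: finite_subset)
    have b1: "real (card (\<Union>p\<in>?I. Bad1 p)) \<le> real (q * m) * real ((\<beta> + q * m + K * b) * N ^ (q * m - 1))"
    proof (rule card_UN_le_const)
      fix p assume p: "p \<in> ?I"
      have T: "finite (T p \<chi>)" "card (T p \<chi>) \<le> \<beta> + q * m + K * b" for \<chi>
      proof -
        show "finite (T p \<chi>)" using B \<Lambda>' finite_sels by (auto simp: T_def)
        have "card (\<Union>J\<in>{J\<in>sels q m. p \<notin> J}. \<Lambda>' (\<chi> ` J)) \<le> (\<Sum>J\<in>{J\<in>sels q m. p \<notin> J}. card (\<Lambda>' (\<chi> ` J)))"
          using finite_sels by (intro card_UN_le) auto
        also have "\<dots> \<le> (\<Sum>J\<in>{J\<in>sels q m. p \<notin> J}. b)" by (intro sum_mono \<Lambda>')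
        also have "\<dots> = card {J\<in>sels q m. p \<notin> J} * b" by simp
        also have "\<dots> \<le> K * b" unfolding K_def
          by (intro mult_right_mono le_trans[OF card_mono card_sels_le] finite_sels) auto
        finally have 1: "card (\<Union>J\<in>{J\<in>sels q m. p \<notin> J}. \<Lambda>' (\<chi> ` J)) \<le> K * b" .
        have 2: "card (\<chi> ` (?I - {p})) \<le> q * m"
          using card_image_le[of "?I - {p}" \<chi>] card_mono[of ?I "?I - {p}"] by auto
        show "card (T p \<chi>) \<le> \<beta> + q * m + K * b"
          unfolding T_def using 1 2 B(2)
            card_Un_le[of B "\<chi> ` (?I - {p}) \<union> (\<Union>J\<in>{J\<in>sels q m. p \<notin> J}. \<Lambda>' (\<chi> ` J))"]
            card_Un_le[of "\<chi> ` (?I - {p})" "(\<Union>J\<in>{J\<in>sels q m. p \<notin> J}. \<Lambda>' (\<chi> ` J))"] by linarith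
      qed
      have "card (Bad1 p) \<le> (\<beta> + q * m + K * b) * N ^ (q * m - 1)"
        unfolding Bad1_def P_def N_def using card_PiE_determined_le[OF cI(2) p V T] cI by simp
      then show "real (card (Bad1 p)) \<le> real ((\<beta> + q * m + K * b) * N ^ (q * m - 1))"
        by (simp only: of_nat_le_iff)
    qed auto
    have ge: "real N ^ (q * m) = real N ^ q * real N ^ (q * m - q)"
      using m by (simp add: power_add[symmetric])
    have S2: "real (card {\<chi> \<in> J \<rightarrow>\<^sub>E V. \<chi> ` J \<in> A \<and> (\<Lambda> (\<chi> ` J) - C) \<inter> B' \<noteq> {}})
       \<le> real \<beta>' * (real (q ^ q) * (\<eta> * real N ^ q))"
      if "J \<in> sels q m" "finite B'" "card B' \<le> \<beta>'" for J B' \<beta>'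
      unfolding N_def using pop \<eta> J that by (intro card_bad_label_le V A) auto
    have b2: "real (card (\<Union>J\<in>sels q m. Bad2 J)) \<le> real K * (real \<beta> * (real (q ^ q) * (\<eta> * real N ^ (q * m))))"
    proof (rule card_UN_le_const[OF finite_sels _ card_sels_le[of q m, folded K_def]])
      fix J assume JJ: "J \<in> sels q m"
      let ?S = "{\<chi> \<in> J \<rightarrow>\<^sub>E V. \<chi> ` J \<in> A \<and> (\<Lambda> (\<chi> ` J) - C) \<inter> B \<noteq> {}}"
      have "Bad2 J \<subseteq> {\<psi> \<in> ?I \<rightarrow>\<^sub>E V. restrict \<psi> J \<in> ?S}"
        using J(1)[OF JJ] by (auto simp: Bad2_def P_def)
      then have "card (Bad2 J) \<le> card {\<psi> \<in> ?I \<rightarrow>\<^sub>E V. restrict \<psi> J \<in> ?S}"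
        using finP by (intro card_mono) (auto simp: P_def)
      also have "\<dots> \<le> card ?S * N ^ (q * m - q)"
        using card_PiE_restrict_le[OF cI(2) J(1)[OF JJ] V, of ?S] cI J[OF JJ] by (simp add: N_def)
      finally have "real (card (Bad2 J)) \<le> real (card ?S * N ^ (q * m - q))" by (simp only: of_nat_le_iff)
      also have "\<dots> \<le> real \<beta> * (real (q ^ q) * (\<eta> * real N ^ q)) * real N ^ (q * m - q)"
        unfolding of_nat_mult of_nat_power by (intro mult_right_mono S2[OF JJ B, simplified]) auto
      finally show "real (card (Bad2 J)) \<le> real \<beta> * (real (q ^ q) * (\<eta> * real N ^ (q * m)))"
        by (simp add: ge mult.assoc)
    qed (use \<eta> in auto)
    have b3: "real (card (\<Union>J\<in>sels q m. \<Union>J'\<in>{J'\<in>sels q m. J \<inter> J' = {}}. Bad3 J J'))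
        \<le> real K * (real K * (real b * (real (q ^ q) * (\<eta> * real N ^ (q * m)))))"
    proof (rule card_UN_le_const[OF finite_sels _ card_sels_le[of q m, folded K_def]],
           rule card_UN_le_const)
      fix J J' assume JJ: "J \<in> sels q m" and JJ': "J' \<in> {J'\<in>sels q m. J \<inter> J' = {}}"
      let ?S = "{\<chi> \<in> J \<union> J' \<rightarrow>\<^sub>E V. \<chi> ` J \<in> A \<and> \<chi> ` J' \<in> A \<and> (\<Lambda> (\<chi> ` J') - C) \<inter> \<Lambda> (\<chi> ` J) \<noteq> {}}"
      let ?S' = "SIGMA \<chi>:J \<rightarrow>\<^sub>E V. {\<chi>' \<in> J' \<rightarrow>\<^sub>E V. \<chi>' ` J' \<in> A \<and> (\<Lambda> (\<chi>' ` J') - C) \<inter> \<Lambda>' (\<chi> ` J) \<noteq> {}}"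
      have J': "J' \<subseteq> ?I" "card J' = q" "finite J'" "J' \<in> sels q m" "J \<inter> J' = {}" using JJ' J by auto
      have cJ: "card (J \<union> J') = q + q" using J[OF JJ] J' by (simp add: card_Un_disjoint)
      have "q + q \<le> q * m" using cJ cI card_mono[OF cI(2), of "J \<union> J'"] J[OF JJ] J' by auto
      then have ge2: "real N ^ (q * m) = real N ^ q * real N ^ q * real N ^ (q * m - (q + q))"
        by (simp add: power_add[symmetric])
      \<comment> \<open>Since \<open>J\<close> and \<open>J'\<close> are disjoint, values on them
        are chosen independently. Those on \<open>J\<close> fix at most b labels, which take the
        role of \<open>B\<close> when the values on \<open>J'\<close> are counted.\<close>
      have "card ?S \<le> card ?S'"
      proof (rule card_inj_on_le[where f = "\<lambda>\<psi>. (restrict \<psi> J, restrict \<psi> J')"])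
        show "inj_on (\<lambda>\<psi>. (restrict \<psi> J, restrict \<psi> J')) ?S"
          by (rule inj_on_subset[OF inj_on_restrict_pair[of J J' V]]) auto
        show "(\<lambda>\<psi>. (restrict \<psi> J, restrict \<psi> J')) ` ?S \<subseteq> ?S'" by (auto simp: \<Lambda>'_def)
        show "finite ?S'" using V J[OF JJ] J' by (auto intro!: finite_SigmaI finite_PiE)
      qed
      then have "real (card ?S) \<le> real (card ?S')" by simp
      also have "\<dots> = (\<Sum>\<chi>\<in>J \<rightarrow>\<^sub>E V. real (card {\<chi>' \<in> J' \<rightarrow>\<^sub>E V. \<chi>' ` J' \<in> A \<and> (\<Lambda> (\<chi>' ` J') - C) \<inter> \<Lambda>' (\<chi> ` J) \<noteq> {}}))"
        using V J[OF JJ] J' by (subst card_SigmaI) (auto intro!: finite_PiE)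
      also have "\<dots> \<le> (\<Sum>\<chi>\<in>J \<rightarrow>\<^sub>E V. real b * (real (q ^ q) * (\<eta> * real N ^ q)))"
        by (intro sum_mono S2 J' \<Lambda>')
      also have "\<dots> = real N ^ q * (real b * (real (q ^ q) * (\<eta> * real N ^ q)))"
        using V J[OF JJ] by (simp add: card_PiE N_def)
      finally have cS: "real (card ?S) \<le> real N ^ q * (real b * (real (q ^ q) * (\<eta> * real N ^ q)))" .
      have "Bad3 J J' \<subseteq> {\<psi> \<in> ?I \<rightarrow>\<^sub>E V. restrict \<psi> (J \<union> J') \<in> ?S}"
        using J(1)[OF JJ] J' by (auto simp: Bad3_def P_def image_restrict_eq Int_absorb1 Int_absorb2)
      then have "card (Bad3 J J') \<le> card {\<psi> \<in> ?I \<rightarrow>\<^sub>E V. restrict \<psi> (J \<union> J') \<in> ?S}"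
        using finP by (intro card_mono) (auto simp: P_def)
      also have "\<dots> \<le> card ?S * N ^ (q * m - (q + q))"
        using card_PiE_restrict_le[OF cI(2) _ V, of "J \<union> J'" ?S] cI cJ J[OF JJ] J' by (simp add: N_def)
      finally have "real (card (Bad3 J J')) \<le> real (card ?S * N ^ (q * m - (q + q)))" by (simp only: of_nat_le_iff)
      also have "\<dots> \<le> real N ^ q * (real b * (real (q ^ q) * (\<eta> * real N ^ q))) * real N ^ (q * m - (q + q))"
        unfolding of_nat_mult of_nat_power by (intro mult_right_mono cS[simplified]) auto
      finally show "real (card (Bad3 J J')) \<le> real b * (real (q ^ q) * (\<eta> * real N ^ (q * m)))"
        unfolding ge2 by (simp only: mult_ac)
    next
      fix J
      show "card {J'\<in>sels q m. J \<inter> J' = {}} \<le> K" unfolding K_def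
        by (intro le_trans[OF card_mono card_sels_le] finite_sels) auto
    qed (use \<eta> finite_sels in auto)
    have "real (card Bad) \<le> real (card (\<Union>p\<in>?I. Bad1 p)) + (real (card (\<Union>J\<in>sels q m. Bad2 J)) +
        real (card (\<Union>J\<in>sels q m. \<Union>J'\<in>{J'\<in>sels q m. J \<inter> J' = {}}. Bad3 J J')))"
      unfolding Bad_def of_nat_add[symmetric] of_nat_le_iff
      by (rule le_trans[OF card_Un_le]) (intro add_left_mono card_Un_le)
    also have "\<dots> \<le> real (q * m) * real ((\<beta> + q * m + K * b) * N ^ (q * m - 1)) +
       (real K * (real \<beta> * (real (q ^ q) * (\<eta> * real N ^ (q * m)))) +
        real K * (real K * (real b * (real (q ^ q) * (\<eta> * real N ^ (q * m))))))"
      by (intro add_mono b1 b2 b3)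
    also have "\<dots> = real X * real N ^ (q * m - 1) + real Y * \<eta> * real N ^ (q * m)"
      by (simp add: X_def Y_def algebra_simps)
    also have "\<dots> = (real X / real N + real Y * \<eta>) * real N ^ (q * m)"
    proof -
      have "real N ^ (q * m) = real N * real N ^ (q * m - 1)"
        using q m by (metis One_nat_def Suc_pred' mult_pos_pos power_Suc less_le_trans zero_less_one)
      then show ?thesis using N by (simp add: field_simps)
    qed
    also have "\<dots> < cc * real N ^ (q * m)"
    proof (rule mult_strict_right_mono)
      have "2 * real X / cc < real N" using n0 unfolding n0_def N_def by linarith
      then have "real X / real N < cc / 2" using cc N by (simp add: field_simps)
      moreover have "real Y * \<eta> \<le> cc / 2" using cc by (simp add: \<eta>_def field_simps)
      ultimately show "real X / real N + real Y * \<eta> < cc" by linarith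
    qed (use N in simp)
    finally have "card Bad < card Good" using Good by linarith
    moreover have "finite Bad"
      by (rule finite_subset[OF _ finP]) (auto simp: Bad_def Bad1_def Bad2_def Bad3_def)
    ultimately have "\<not> Good \<subseteq> Bad" using card_mono leD by blast
    then obtain \<psi> where \<psi>: "\<psi> \<in> Good" "\<psi> \<notin> Bad" by blast
    have \<psi>A: "\<psi> ` J' \<in> A" if "J' \<in> sels q m" for J' using \<psi> that by (simp add: Good_def)
    have \<psi>P: "\<psi> \<in> P" using \<psi> by (simp add: Good_def P_def)
    have n1: "\<psi> p \<notin> T p (restrict \<psi> (?I - {p}))" if "p \<in> ?I" for p
      using that \<psi>(2) \<psi>P by (auto simp: Bad_def Bad1_def)
    have "inj_on \<psi> ?I"
    proof (rule inj_onI, rule ccontr)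
      fix p p' assume "p \<in> ?I" "p' \<in> ?I" "\<psi> p = \<psi> p'" "p \<noteq> p'"
      then have "\<psi> p \<in> restrict \<psi> (?I - {p}) ` (?I - {p})"
        by (intro image_eqI[of _ _ p']) auto
      then show False using n1[OF \<open>p \<in> ?I\<close>] by (simp add: T_def)
    qed
    moreover have "\<psi> ` ?I \<inter> B = {}" using n1 by (fastforce simp: T_def)
    moreover have "\<psi> p \<notin> \<Lambda> (\<psi> ` J')" if "J' \<in> sels q m" "p \<in> ?I - J'" for p J'
    proof -
      have "restrict \<psi> (?I - {p}) ` J' = \<psi> ` J'" using that J(1)[of J'] by (intro image_cong) auto
      moreover have "\<Lambda>' (restrict \<psi> (?I - {p}) ` J') \<subseteq> T p (restrict \<psi> (?I - {p}))"
        unfolding T_def using that by blast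
      ultimately show ?thesis using n1[of p] that \<psi>A[OF that(1)] by (auto simp: \<Lambda>'_def)
    qed
    moreover have "(\<Lambda> (\<psi> ` J') - C) \<inter> B = {}" if "J' \<in> sels q m" for J'
      using \<psi>(2) \<psi>P \<psi>A that unfolding Bad_def Bad2_def by blast
    moreover have "\<Lambda> (\<psi> ` J') \<inter> \<Lambda> (\<psi> ` J'') \<subseteq> C" if "J' \<in> sels q m" "J'' \<in> sels q m" "J' \<inter> J'' = {}" for J' J''
      using \<psi>(2) \<psi>P \<psi>A that unfolding Bad_def Bad3_def by blast
    ultimately have "generic q m A \<Lambda> C B \<psi>" using \<psi>A by (simp add: generic_def)
    then show "\<exists>\<phi>. generic q m A \<Lambda> C B \<phi>" by (rule exI[of _ \<psi>])
  qed
qed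

text \<open>As long as some further label is popular, restrict to the sets that have it. The threshold may
  depend on the current density, since labels are added at most \<open>b\<close> times.\<close>

lemma popular_extraction:
  fixes \<eta> :: "real \<Rightarrow> real" and c :: real and V :: "'a set"
  assumes V: "finite V" and \<eta>: "\<And>x. x > 0 \<Longrightarrow> \<eta> x > 0" and c: "c > 0"
    and A: "A \<subseteq> Pow V" and cA: "(\<eta> ^^ card C) c * real (card V) ^ q \<le> real (card A)"
    and \<Lambda>: "\<forall>f\<in>A. finite (\<Lambda> f) \<and> card (\<Lambda> f) \<le> b"
    and C: "finite C" "\<forall>f\<in>A. C \<subseteq> \<Lambda> f" "card C \<le> b"
  shows "\<exists>i\<le>b. \<exists>A'\<subseteq>A. \<exists>C'. finite C' \<and> (\<forall>f\<in>A'. C' \<subseteq> \<Lambda> f) \<and>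
     (\<eta> ^^ i) c * real (card V) ^ q \<le> real (card A') \<and>
     (\<forall>v. v \<notin> C' \<longrightarrow> real (card {f \<in> A'. v \<in> \<Lambda> f}) \<le> \<eta> ((\<eta> ^^ i) c) * real (card V) ^ q)"
  using A cA \<Lambda> C
proof (induction "b - card C" arbitrary: A C rule: less_induct)
  case less
  have pos: "(\<eta> ^^ i) c > 0" for i by (induction i) (use c \<eta> in auto)
  show ?case
  proof (cases "\<forall>v. v \<notin> C \<longrightarrow> real (card {f \<in> A. v \<in> \<Lambda> f}) \<le> \<eta> ((\<eta> ^^ card C) c) * real (card V) ^ q")
    case True
    then show ?thesis using less.prems by (intro exI[of _ "card C"] conjI exI[of _ A] exI[of _ C]) auto
  next
    case False
    then obtain v where v: "v \<notin> C" "real (card {f \<in> A. v \<in> \<Lambda> f}) > \<eta> ((\<eta> ^^ card C) c) * real (card V) ^ q"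
      by (auto simp: not_le)
    let ?A = "{f \<in> A. v \<in> \<Lambda> f}"
    have "\<eta> ((\<eta> ^^ card C) c) * real (card V) ^ q \<ge> 0" using less_imp_le[OF \<eta>[OF pos]] by simp
    then have "card ?A \<noteq> 0" using v(2) by linarith
    then obtain f where f: "f \<in> ?A" by (metis card.empty ex_in_conv)
    have cC: "card (insert v C) = Suc (card C)" using v less.prems by simp
    \<comment> \<open>The new label belongs to every member of \<open>?A\<close>, so the enlarged
      set still fits into a label set of at most b elements; this bounds the number of
      rounds.\<close>
    have "card (insert v C) \<le> card (\<Lambda> f)" using f less.prems by (intro card_mono) auto
    then have lt: "card (insert v C) \<le> b" using f less.prems by fastforce
    have "\<exists>i\<le>b. \<exists>A'\<subseteq>?A. \<exists>C'. finite C' \<and> (\<forall>f\<in>A'. C' \<subseteq> \<Lambda> f) \<and>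
     (\<eta> ^^ i) c * real (card V) ^ q \<le> real (card A') \<and>
     (\<forall>v. v \<notin> C' \<longrightarrow> real (card {f \<in> A'. v \<in> \<Lambda> f}) \<le> \<eta> ((\<eta> ^^ i) c) * real (card V) ^ q)"
      by (rule less.hyps[of "insert v C"]) (use less.prems lt v cC in auto)
    then show ?thesis
      by (elim exE conjE) (rule exI, rule conjI, assumption, rule exI, rule conjI, erule order_trans, auto)
  qed
qed

text \<open>Both quantifiers anticipate later use: up to half of \<open>A\<close> is deleted once
  \<open>C\<close> is known, and \<open>B\<close> holds the components embedded so far. The blow-up
  avoids \<open>C\<close> as well, whose vertices are reserved as labels.\<close>

definition robustly_generic :: "nat \<Rightarrow> nat \<Rightarrow> nat \<Rightarrow> 'a set set \<Rightarrow> ('a set \<Rightarrow> 'a set) \<Rightarrow> 'a set \<Rightarrow> bool" where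
  "robustly_generic q m \<beta> A \<Lambda> C \<longleftrightarrow> (\<forall>A'. A' \<subseteq> A \<longrightarrow> card A \<le> 2 * card A' \<longrightarrow>
     (\<forall>B. finite B \<longrightarrow> card B \<le> \<beta> \<longrightarrow> (\<exists>\<phi>. generic q m A' \<Lambda> C (B \<union> C) \<phi>)))"

lemma generic_structure:
  fixes q m b \<beta> :: nat and c :: real
  assumes q: "q \<ge> 1" and m: "m \<ge> 1" and c: "c > 0"
  shows "\<exists>c0>0. \<exists>n0. \<forall>(V :: 'a set) A \<Lambda>. finite V \<longrightarrow> n0 \<le> card V \<longrightarrow>
     A \<subseteq> {f. f \<subseteq> V \<and> card f = q} \<longrightarrow> c * real (card V) ^ q \<le> real (card A) \<longrightarrow>
     (\<forall>f\<in>A. finite (\<Lambda> f) \<and> card (\<Lambda> f) \<le> b) \<longrightarrow>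
     (\<exists>A' C. A' \<subseteq> A \<and> finite C \<and> card C \<le> b \<and> (\<forall>f\<in>A'. C \<subseteq> \<Lambda> f) \<and> c0 * real (card V) ^ q \<le> real (card A') \<and>
       robustly_generic q m \<beta> A' \<Lambda> C)"
proof -
  \<comment> \<open>The factor 1/2 allows for a deleted half of the family, and
    \<open>\<beta> + b\<close> for avoiding \<open>C\<close> together with \<open>B\<close>.\<close>
  define P where "P x \<eta> n0 \<longleftrightarrow> (\<forall>(V :: 'a set) A \<Lambda> B C. finite V \<longrightarrow> n0 \<le> card V \<longrightarrow>
     A \<subseteq> {f. f \<subseteq> V \<and> card f = q} \<longrightarrow> x / 2 * real (card V) ^ q \<le> real (card A) \<longrightarrow>
     (\<forall>f\<in>A. finite (\<Lambda> f) \<and> card (\<Lambda> f) \<le> b) \<longrightarrow> finite B \<longrightarrow> card B \<le> \<beta> + b \<longrightarrow>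
     (\<forall>v. v \<notin> C \<longrightarrow> real (card {f \<in> A. v \<in> \<Lambda> f}) \<le> \<eta> * real (card V) ^ q) \<longrightarrow>
     (\<exists>\<phi>. generic q m A \<Lambda> C B \<phi>))" for x \<eta> :: real and n0 :: nat
  have "\<exists>\<eta> n0. \<eta> > 0 \<and> P x \<eta> n0" if "x > 0" for x
  proof -
    have "x / 2 > 0" using that by simp
    from generic_blowup[OF q m this, of b "\<beta> + b", where 'a = 'a, folded P_def]
    show ?thesis by (simp only: ex_simps)
  qed
  then obtain \<eta> n1 where \<eta>: "\<And>x. x > 0 \<Longrightarrow> \<eta> x > 0" and P: "\<And>x. x > 0 \<Longrightarrow> P x (\<eta> x) (n1 x)"
    by metis
  define cs where "cs i = (\<eta> ^^ i) c" for i
  have pos: "cs i > 0" for i unfolding cs_def by (induction i) (use c \<eta> in auto)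
  \<comment> \<open>The number of labels that will be extracted is unknown, so density and size
    threshold are the worst over all \<open>i \<le> b\<close>.\<close>
  define c0 where "c0 = Min (cs ` {..b})"
  have c0: "c0 > 0" "\<And>i. i \<le> b \<Longrightarrow> c0 \<le> cs i" using pos by (auto simp: c0_def)
  define n0 where "n0 = Suc (Max ((\<lambda>i. n1 (cs i)) ` {..b}))"
  have n0: "n1 (cs i) \<le> n0" if "i \<le> b" for i
    using that by (auto simp: n0_def intro!: le_SucI Max_ge)
  show ?thesis unfolding robustly_generic_def
  proof (intro exI[of _ c0] conjI c0(1) exI[of _ n0] allI impI)
    fix V :: "'a set" and A :: "'a set set" and \<Lambda> :: "'a set \<Rightarrow> 'a set"
    assume V: "finite V" and n: "n0 \<le> card V" and A: "A \<subseteq> {f. f \<subseteq> V \<and> card f = q}"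
      and cA: "c * real (card V) ^ q \<le> real (card A)"
      and \<Lambda>: "\<forall>f\<in>A. finite (\<Lambda> f) \<and> card (\<Lambda> f) \<le> b"
    have N: "card V > 0" using n by (simp add: n0_def)
    obtain i A' C where i: "i \<le> b" and A': "A' \<subseteq> A" and C: "finite C" "\<forall>f\<in>A'. C \<subseteq> \<Lambda> f"
      and cA': "cs i * real (card V) ^ q \<le> real (card A')"
      and pop: "\<forall>v. v \<notin> C \<longrightarrow> real (card {f \<in> A'. v \<in> \<Lambda> f}) \<le> \<eta> (cs i) * real (card V) ^ q"
    proof -
      have "\<exists>i\<le>b. \<exists>A'\<subseteq>A. \<exists>C'. finite C' \<and> (\<forall>f\<in>A'. C' \<subseteq> \<Lambda> f) \<and>
         (\<eta> ^^ i) c * real (card V) ^ q \<le> real (card A') \<and>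
         (\<forall>v. v \<notin> C' \<longrightarrow> real (card {f \<in> A'. v \<in> \<Lambda> f}) \<le> \<eta> ((\<eta> ^^ i) c) * real (card V) ^ q)"
        by (rule popular_extraction[where C = "{}"]) (use V \<eta> c A cA \<Lambda> in auto)
      then show ?thesis
        by (elim exE conjE) (rule that, simp_all only: cs_def)
    qed
    have "0 < cs i * real (card V) ^ q" using N pos by simp
    then have "card A' \<noteq> 0" using cA' by linarith
    then obtain f where f: "f \<in> A'" by (metis card.empty ex_in_conv)
    have "finite (\<Lambda> f)" "card (\<Lambda> f) \<le> b" "C \<subseteq> \<Lambda> f" using f C(2) \<Lambda> A' by auto
    then have cC: "card C \<le> b" using card_mono le_trans by blast
    have finA': "finite A'" using \<open>card A' \<noteq> 0\<close> by (intro card_ge_0_finite) simp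
    show "\<exists>A' C. A' \<subseteq> A \<and> finite C \<and> card C \<le> b \<and> (\<forall>f\<in>A'. C \<subseteq> \<Lambda> f) \<and> c0 * real (card V) ^ q \<le> real (card A') \<and>
       (\<forall>A''. A'' \<subseteq> A' \<longrightarrow> card A' \<le> 2 * card A'' \<longrightarrow>
          (\<forall>B. finite B \<longrightarrow> card B \<le> \<beta> \<longrightarrow> (\<exists>\<phi>. generic q m A'' \<Lambda> C (B \<union> C) \<phi>)))"
    proof (rule exI[of _ A'], rule exI[of _ C], intro conjI allI impI)
      have "c0 * real (card V) ^ q \<le> cs i * real (card V) ^ q"
        using c0 i by (intro mult_right_mono) auto
      then show "c0 * real (card V) ^ q \<le> real (card A')" using cA' by linarith
      show "A' \<subseteq> A" "finite C" "card C \<le> b" "\<forall>f\<in>A'. C \<subseteq> \<Lambda> f" by (fact A' C cC)+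
    next
      fix A'' and B :: "'a set" assume A'': "A'' \<subseteq> A'" "card A' \<le> 2 * card A''" and B: "finite B" "card B \<le> \<beta>"
      have "card (B \<union> C) \<le> \<beta> + b" using card_Un_le[of B C] cC B by linarith
      moreover have "cs i / 2 * real (card V) ^ q \<le> real (card A'')" using cA' A''(2) by linarith
      moreover have "real (card {f \<in> A''. v \<in> \<Lambda> f}) \<le> \<eta> (cs i) * real (card V) ^ q" if "v \<notin> C" for v
      proof -
        have "card {f \<in> A''. v \<in> \<Lambda> f} \<le> card {f \<in> A'. v \<in> \<Lambda> f}"
          using A'' finA' by (intro card_mono) auto
        then show ?thesis using pop that by force
      qed
      moreover have "n1 (cs i) \<le> card V" using n n0[OF i] by linarith
      moreover have "A'' \<subseteq> {f. f \<subseteq> V \<and> card f = q}" using A A' A'' by blast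
      moreover have "\<forall>f\<in>A''. finite (\<Lambda> f) \<and> card (\<Lambda> f) \<le> b" using \<Lambda> A' A'' by blast
      moreover have "finite (B \<union> C)" using B C by simp
      ultimately show "\<exists>\<phi>. generic q m A'' \<Lambda> C (B \<union> C) \<phi>" 
        by (intro P[OF pos[of i], unfolded P_def, rule_format, of V A'' \<Lambda> "B \<union> C" C] V) blast+
    qed
  qed
qed

section \<open>Full hypergraphs\<close>

definition nbrs :: "'a set set \<Rightarrow> 'a set \<Rightarrow> 'a set" where
  "nbrs H f = {v. v \<notin> f \<and> insert v f \<in> H}"

definition shadow :: "'a set set \<Rightarrow> 'a set set" where
  "shadow H = {e - {v} | e v. e \<in> H \<and> v \<in> e}"

definition uniform :: "nat \<Rightarrow> 'a set \<Rightarrow> 'a set set \<Rightarrow> bool" where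
  "uniform r V H \<longleftrightarrow> finite V \<and> (\<forall>e\<in>H. e \<subseteq> V \<and> card e = r)"

definition full :: "nat \<Rightarrow> 'a set set \<Rightarrow> bool" where
  "full d H \<longleftrightarrow> (\<forall>f\<in>shadow H. d \<le> card (nbrs H f))"

definition cliques :: "'a set \<Rightarrow> nat \<Rightarrow> nat \<Rightarrow> 'a set set \<Rightarrow> 'a set set" where
  "cliques V r s H = {S. S \<subseteq> V \<and> card S = s \<and> (\<forall>e. e \<subseteq> S \<longrightarrow> card e = r \<longrightarrow> e \<in> H)}"

text \<open>Only sizes of intersections are prescribed. That the joints of a cycle are distinct
  follows for \<open>l \<ge> 4\<close>, where the edges before and after a given one are
  disjoint.\<close>

definition loose :: "bool \<Rightarrow> nat \<Rightarrow> (nat \<Rightarrow> 'a set) \<Rightarrow> bool" where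
  "loose cyc l E \<longleftrightarrow> (\<forall>j<l. \<forall>i<j. if j = Suc i \<or> cyc \<and> i = 0 \<and> Suc j = l
     then card (E i \<inter> E j) = 1 else E i \<inter> E j = {})"

text \<open>Keeps edges only; the vertex map from the expansions is rebuilt in
  \<open>copies_of_has_system\<close>.\<close>

definition has_system :: "bool \<Rightarrow> 'i set \<Rightarrow> ('i \<Rightarrow> nat) \<Rightarrow> 'a set set \<Rightarrow> bool" where
  "has_system cyc I l H \<longleftrightarrow> (\<exists>E. (\<forall>i\<in>I. loose cyc (l i) (E i) \<and> (\<forall>j<l i. E i j \<in> H)) \<and>
     (\<forall>i\<in>I. \<forall>i'\<in>I. i \<noteq> i' \<longrightarrow> (\<forall>j<l i. \<forall>j'<l i'. E i j \<inter> E i' j' = {})))"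

lemma has_system_mono: "has_system cyc I l H \<Longrightarrow> H \<subseteq> H' \<Longrightarrow> has_system cyc I l H'"
  unfolding has_system_def by blast

text \<open>Allows a path to be cut from a cycle with one more edge, so that several embeddings
  treat cycles only.\<close>

lemma loose_path_of_cycle: "loose True (Suc l) E \<Longrightarrow> loose False l E"
  unfolding loose_def by auto

lemma uniform_subset: "uniform r V H \<Longrightarrow> H' \<subseteq> H \<Longrightarrow> uniform r V H'"
  unfolding uniform_def by blast

lemma uniform_finite: "uniform r V H \<Longrightarrow> finite H"
  unfolding uniform_def by (rule finite_subset[of _ "Pow V"]) auto

lemma uniform_edge: "uniform r V H \<Longrightarrow> e \<in> H \<Longrightarrow> finite e \<and> card e = r \<and> e \<subseteq> V"
  unfolding uniform_def using finite_subset by blast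

lemma nbrs_subset: "uniform r V H \<Longrightarrow> nbrs H f \<subseteq> V"
  unfolding uniform_def nbrs_def by auto

lemma finite_nbrs: "uniform r V H \<Longrightarrow> finite (nbrs H f)"
  using nbrs_subset finite_subset unfolding uniform_def by metis

lemma shadowE:
  assumes "f \<in> shadow H"
  obtains e v where "e \<in> H" "v \<in> e" "f = e - {v}"
  using assms unfolding shadow_def by blast

lemma shadow_edge:
  assumes "uniform r V H" "f \<in> shadow H"
  shows "f \<subseteq> V" "card f = r - 1" "finite f"
proof -
  obtain e v where e: "e \<in> H" "v \<in> e" "f = e - {v}" using assms(2) by (rule shadowE)
  then show "f \<subseteq> V" "card f = r - 1" "finite f" using uniform_edge[OF assms(1) e(1)] by auto
qed

lemma shadow_mono: "H \<subseteq> H' \<Longrightarrow> shadow H \<subseteq> shadow H'"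
  unfolding shadow_def by blast

lemma finite_shadow: "uniform r V H \<Longrightarrow> finite (shadow H)"
  by (rule finite_subset[of _ "Pow V"]) (auto dest: shadow_edge(1), simp add: uniform_def)

lemma shadowI: "v \<in> nbrs H f \<Longrightarrow> f \<in> shadow H"
  unfolding nbrs_def shadow_def by (auto intro!: exI[of _ "insert v f"] exI[of _ v])

text \<open>Delete repeatedly the edges through an \<open>(r-1)\<close>-set \<open>f\<close> of codegree at most \<open>d\<close>: a clique destroyed in
  this step consists of \<open>f\<close> and \<open>s - r + 1\<close> neighbours of \<open>f\<close>.\<close>

lemma peeling:
  assumes "uniform r V H" "1 \<le> r" "r \<le> s"
  shows "\<exists>H'\<subseteq>H. full (Suc d) H' \<and>
     card (cliques V r s H) \<le> card (cliques V r s H') + (d choose (s - r + 1)) * card (shadow H)"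
  using assms(1)
proof (induction "card H" arbitrary: H rule: less_induct)
  case less
  note unif = less.prems
  have finV: "finite V" using unif by (simp add: uniform_def)
  have fincl: "finite (cliques V r s G)" for G
    by (rule finite_subset[of _ "Pow V"]) (use finV in \<open>auto simp: cliques_def\<close>)
  show ?case
  proof (cases "full (Suc d) H")
    case True
    then show ?thesis by (intro exI[of _ H]) auto
  next
    case False
    then obtain f where f: "f \<in> shadow H" "card (nbrs H f) \<le> d"
      by (auto simp: full_def not_le less_Suc_eq_le)
    define H1 where "H1 = {e \<in> H. \<not> f \<subseteq> e}"
    have H1: "H1 \<subseteq> H" by (auto simp: H1_def)
    obtain e v where e: "e \<in> H" "v \<in> e" "f = e - {v}" using f(1) by (rule shadowE)
    then have "H1 \<subset> H" using H1 by (auto simp: H1_def)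
    then have "card H1 < card H" using uniform_finite[OF unif] by (rule psubset_card_mono[rotated])
    from less.hyps[OF this uniform_subset[OF unif H1]] obtain H' where H': "H' \<subseteq> H1" "full (Suc d) H'"
      "card (cliques V r s H1) \<le> card (cliques V r s H') + (d choose (s - r + 1)) * card (shadow H1)"
      by blast
    \<comment> \<open>Each step removes \<open>f\<close> itself from the shadow, so no set is
      charged twice.\<close>
    have "f \<notin> shadow H1" by (auto simp: H1_def elim!: shadowE)
    then have "shadow H1 \<subset> shadow H" using f(1) shadow_mono[OF H1] by blast
    then have sh: "card (shadow H1) < card (shadow H)" using finite_shadow[OF unif] by (rule psubset_card_mono[rotated])
    let ?T = "{T. T \<subseteq> nbrs H f \<and> card T = s - r + 1}"
    have "card (cliques V r s H - cliques V r s H1) \<le> card ?T"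
    proof (rule card_inj_on_le[where f = "\<lambda>S. S - f"])
      have fS: "f \<subseteq> S" if S: "S \<in> cliques V r s H - cliques V r s H1" for S
      proof -
        obtain e where "e \<subseteq> S" "card e = r" "e \<in> H" "e \<notin> H1" using S by (auto simp: cliques_def)
        then show ?thesis by (auto simp: H1_def)
      qed
      show "inj_on (\<lambda>S. S - f) (cliques V r s H - cliques V r s H1)"
        by (rule inj_onI) (use fS in blast)
      show "(\<lambda>S. S - f) ` (cliques V r s H - cliques V r s H1) \<subseteq> ?T"
      proof (rule image_subsetI)
        fix S assume S: "S \<in> cliques V r s H - cliques V r s H1"
        have cf: "card f = r - 1" "finite f" using shadow_edge[OF unif f(1)] by auto
        have "S - f \<subseteq> nbrs H f"
        proof
          fix v assume v: "v \<in> S - f"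
          have "card (insert v f) = r" using cf v assms(2) by simp
          then show "v \<in> nbrs H f" using S fS[OF S] v by (auto simp: cliques_def nbrs_def)
        qed
        moreover have "card (S - f) = s - r + 1"
          using S fS[OF S] cf assms by (subst card_Diff_subset) (auto simp: cliques_def)
        ultimately show "S - f \<in> ?T" by blast
      qed
      show "finite ?T" using finite_nbrs[OF unif, of f]
        by (rule_tac finite_subset[of _ "Pow (nbrs H f)"]) auto
    qed
    also have "card ?T = card (nbrs H f) choose (s - r + 1)"
      by (rule n_subsets) (rule finite_nbrs[OF unif])
    also have "\<dots> \<le> d choose (s - r + 1)" by (rule binomial_right_mono[OF f(2)])
    finally have "card (cliques V r s H - cliques V r s H1) \<le> d choose (s - r + 1)" .
    moreover have "card (cliques V r s H) \<le> card (cliques V r s H1) + card (cliques V r s H - cliques V r s H1)"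
      using card_Un_le[of "cliques V r s H1" "cliques V r s H - cliques V r s H1"]
        card_mono[of "cliques V r s H1 \<union> (cliques V r s H - cliques V r s H1)" "cliques V r s H"] fincl by force
    ultimately have "card (cliques V r s H) \<le> card (cliques V r s H') +
        ((d choose (s - r + 1)) * card (shadow H1) + (d choose (s - r + 1)))"
      using H'(3) by linarith
    also have "(d choose (s - r + 1)) * card (shadow H1) + (d choose (s - r + 1)) =
       (d choose (s - r + 1)) * Suc (card (shadow H1))" by simp
    also have "\<dots> \<le> (d choose (s - r + 1)) * card (shadow H)"
      using sh by (intro mult_le_mono2) simp
    finally show ?thesis using H' H1 by (intro exI[of _ H']) auto
  qed
qed

text \<open>The components are embedded one after the other; \<open>D i\<close> is the part of \<open>C\<close> reserved for component \<open>i\<close>.\<close>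

lemma has_systemI:
  assumes fI: "finite I" and H: "\<And>e. e \<in> H \<Longrightarrow> finite e \<and> card e = r"
    and D: "\<And>i. i \<in> I \<Longrightarrow> D i \<subseteq> C" "\<And>i j. i \<in> I \<Longrightarrow> j \<in> I \<Longrightarrow> i \<noteq> j \<Longrightarrow> D i \<inter> D j = {}"
    and b: "r * sum l I \<le> b"
    and step: "\<And>i B. i \<in> I \<Longrightarrow> finite B \<Longrightarrow> card B \<le> b \<Longrightarrow>
       \<exists>E. loose cyc (l i) E \<and> (\<forall>j<l i. E j \<in> H \<and> E j \<inter> (B \<union> C) \<subseteq> D i)"
  shows "has_system cyc I l H"
proof -
  have "\<exists>E. (\<forall>i\<in>I'. loose cyc (l i) (E i) \<and> (\<forall>j<l i. E i j \<in> H \<and> E i j \<inter> C \<subseteq> D i)) \<and>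
     (\<forall>i\<in>I'. \<forall>i'\<in>I'. i \<noteq> i' \<longrightarrow> (\<forall>j<l i. \<forall>j'<l i'. E i j \<inter> E i' j' = {}))"
    if "finite I'" "I' \<subseteq> I" for I'
    using that
  proof (induction I')
    case empty
    then show ?case by simp
  next
    case (insert k I')
    then obtain E where E0: "\<forall>i\<in>I'. loose cyc (l i) (E i) \<and> (\<forall>j<l i. E i j \<in> H \<and> E i j \<inter> C \<subseteq> D i)"
      "\<forall>i\<in>I'. \<forall>i'\<in>I'. i \<noteq> i' \<longrightarrow> (\<forall>j<l i. \<forall>j'<l i'. E i j \<inter> E i' j' = {})"
      by auto
    have E: "\<And>i. i \<in> I' \<Longrightarrow> loose cyc (l i) (E i)"
      "\<And>i j. i \<in> I' \<Longrightarrow> j < l i \<Longrightarrow> E i j \<in> H \<and> E i j \<inter> C \<subseteq> D i"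
      "\<And>i i' j j'. i \<in> I' \<Longrightarrow> i' \<in> I' \<Longrightarrow> i \<noteq> i' \<Longrightarrow> j < l i \<Longrightarrow> j' < l i' \<Longrightarrow> E i j \<inter> E i' j' = {}"
      using E0 by simp_all
    define B where "B = (\<Union>i\<in>I'. \<Union>j<l i. E i j)"
    have finB: "finite B" using insert.hyps E H by (auto simp: B_def)
    have "card B \<le> (\<Sum>i\<in>I'. card (\<Union>j<l i. E i j))"
      unfolding B_def using insert.hyps by (intro card_UN_le) auto
    also have "\<dots> \<le> (\<Sum>i\<in>I'. r * l i)"
    proof (rule sum_mono)
      fix i assume "i \<in> I'"
      have "card (\<Union>j<l i. E i j) \<le> (\<Sum>j<l i. card (E i j))" by (intro card_UN_le) auto
      also have "\<dots> = (\<Sum>j<l i. r)" using \<open>i \<in> I'\<close> E H by (intro sum.cong) auto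
      finally show "card (\<Union>j<l i. E i j) \<le> r * l i" by (simp add: mult.commute)
    qed
    also have "\<dots> \<le> (\<Sum>i\<in>I. r * l i)" using insert.prems fI by (intro sum_mono2) auto
    also have "\<dots> = r * sum l I" by (simp add: sum_distrib_left)
    finally have "card B \<le> b" using b by linarith
    with step[of k B] finB insert.prems obtain E' where E': "loose cyc (l k) E'"
      "\<And>j. j < l k \<Longrightarrow> E' j \<in> H \<and> E' j \<inter> (B \<union> C) \<subseteq> D k" by auto
    \<comment> \<open>A common vertex lies in \<open>B\<close>, hence in \<open>D k\<close> and so
      in \<open>C\<close>, where the earlier component is confined to its own disjoint piece
      \<open>D i\<close>.\<close>
    have dis: "E' j \<inter> E i j' = {}" if "j < l k" "i \<in> I'" "j' < l i" for i j j'
    proof (rule equals0I)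
      fix x assume x: "x \<in> E' j \<inter> E i j'"
      then have "x \<in> B" using that by (auto simp: B_def)
      then have "x \<in> D k" using x E'(2)[OF that(1)] by blast
      moreover have "x \<in> C" using \<open>x \<in> D k\<close> D(1) insert.prems by blast
      then have "x \<in> D i" using x E(2)[OF that(2,3)] by blast
      moreover have "i \<noteq> k" "i \<in> I" "k \<in> I" using insert that by auto
      ultimately show False using D(2) by blast
    qed
    show ?case
    proof (intro exI[of _ "E(k := E')"] conjI ballI impI allI)
      fix i i' j j' assume "i \<in> insert k I'" "i' \<in> insert k I'" "i \<noteq> i'" "j < l i" "j' < l i'"
      then show "(E(k := E')) i j \<inter> (E(k := E')) i' j' = {}"
        using E(3)[of i i' j j'] dis[of j i' j'] dis[of j' i j] by auto
    next
      fix i assume "i \<in> insert k I'"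
      then show "loose cyc (l i) ((E(k := E')) i)" using E(1) E'(1) by auto
    next
      fix i j assume i: "i \<in> insert k I'" "j < l i"
      show "(E(k := E')) i j \<in> H" using E(2)[of i j] E'(2)[of j] i by auto
      show "(E(k := E')) i j \<inter> C \<subseteq> D i" using E(2)[of i j] E'(2)[of j] i by auto
    qed
  qed
  from this[OF fI order_refl] show ?thesis unfolding has_system_def by blast
qed

section \<open>Greedy embedding when all codegrees are large\<close>

text \<open>Offending vertices are exchanged one at a time: removing one leaves a set of the shadow,
  which has more neighbours than \<open>B\<close> has elements.\<close>

lemma full_exchange:
  assumes unif: "uniform r V H" and full: "full d H" and B: "finite B" "card B < d"
    and "e \<in> H" "S \<subseteq> e"
  shows "\<exists>e'\<in>H. S \<subseteq> e' \<and> (e' - S) \<inter> B = {}"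
  using assms(5-)
proof (induction "card ((e - S) \<inter> B)" arbitrary: e rule: less_induct)
  case less
  show ?case
  proof (cases "(e - S) \<inter> B = {}")
    case True
    then show ?thesis using less.prems by blast
  next
    case False
    then obtain v where v: "v \<in> e" "v \<notin> S" "v \<in> B" by blast
    have "e - {v} \<in> shadow H" using v less.prems unfolding shadow_def by blast
    then have "d \<le> card (nbrs H (e - {v}))" using full unfolding full_def by blast
    then have "\<not> nbrs H (e - {v}) \<subseteq> B" using B(2) card_mono[OF B(1), of "nbrs H (e - {v})"] by auto
    then obtain u where u: "u \<in> nbrs H (e - {v})" "u \<notin> B" by blast
    let ?e = "insert u (e - {v})"
    have "?e \<in> H" "S \<subseteq> ?e" using u v less.prems by (auto simp: nbrs_def)
    moreover have "card ((?e - S) \<inter> B) < card ((e - S) \<inter> B)"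
    proof -
      have "card ((?e - S) \<inter> B) \<le> card ((e - S) \<inter> B - {v})"
        by (rule card_mono) (use B(1) u(2) in auto)
      also have "\<dots> < card ((e - S) \<inter> B)"
        by (rule card_Diff1_less) (use B(1) v in auto)
      finally show ?thesis .
    qed
    ultimately show ?thesis using less.hyps[of ?e] by blast
  qed
qed

text \<open>Exchange against \<open>U\<close> and the earlier edges, which have at most
  \<open>r * l\<close> vertices. If \<open>U\<close> contains every \<open>S i\<close>, the
  resulting edges meet exactly where the sets \<open>S i\<close> do.\<close>

lemma full_fill:
  assumes unif: "uniform r V H" and full: "full d H" and U: "finite U" "card U + r * l < d"
    and S: "\<And>i. i < l \<Longrightarrow> \<exists>e\<in>H. S i \<subseteq> e"
  shows "\<exists>E. (\<forall>i<l. E i \<in> H \<and> S i \<subseteq> E i \<and> (E i - S i) \<inter> U = {}) \<and>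
     (\<forall>j<l. \<forall>i<j. (E j - S j) \<inter> E i = {})"
  using U(2) S
proof (induction l)
  case 0
  then show ?case by simp
next
  case (Suc l)
  then obtain E where E0: "\<forall>i<l. E i \<in> H \<and> S i \<subseteq> E i \<and> (E i - S i) \<inter> U = {}"
    "\<forall>j<l. \<forall>i<j. (E j - S j) \<inter> E i = {}" by auto
  have E: "\<And>i. i < l \<Longrightarrow> E i \<in> H \<and> S i \<subseteq> E i \<and> (E i - S i) \<inter> U = {}"
    "\<And>i j. j < l \<Longrightarrow> i < j \<Longrightarrow> (E j - S j) \<inter> E i = {}" using E0 by simp_all
  define B where "B = U \<union> (\<Union>i<l. E i)"
  have finB: "finite B" using U E uniform_edge[OF unif] by (auto simp: B_def)
  have "card (\<Union>i<l. E i) \<le> (\<Sum>i<l. card (E i))" by (intro card_UN_le) auto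
  also have "\<dots> = (\<Sum>i<l. r)" using E uniform_edge[OF unif] by (intro sum.cong) auto
  finally have "card (\<Union>i<l. E i) \<le> r * l" by (simp add: mult.commute)
  then have "card B < d" using card_Un_le[of U "\<Union>i<l. E i"] Suc.prems(1) by (simp add: B_def)
  moreover obtain e where "e \<in> H" "S l \<subseteq> e" using Suc.prems(2)[of l] by auto
  ultimately obtain e' where e': "e' \<in> H" "S l \<subseteq> e'" "(e' - S l) \<inter> B = {}"
    using full_exchange[OF unif full finB] by blast
  show ?case
  proof (intro exI[of _ "E(l := e')"] conjI allI impI)
    fix i assume "i < Suc l"
    then show "(E(l := e')) i \<in> H" "S i \<subseteq> (E(l := e')) i" "((E(l := e')) i - S i) \<inter> U = {}"
      using E(1)[of i] e' by (auto simp: B_def less_Suc_eq)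
  next
    fix i j assume "j < Suc l" "i < j"
    then show "((E(l := e')) j - S j) \<inter> (E(l := e')) i = {}"
      using E(2)[of j i] e' by (auto simp: B_def less_Suc_eq)
  qed
qed

text \<open>\<open>a, u 0, \<dots>, u (k + 1)\<close> is a cycle in the 2-shadow, to be expanded by \<open>full_fill\<close>.\<close>

lemma full_fan:
  assumes unif: "uniform r V H" and full: "full d H" and "H \<noteq> {}" and B: "finite B"
    and r: "3 \<le> r" and d: "card B + k + 2 < d"
  shows "\<exists>R a u. a \<notin> B \<and> inj_on u {..Suc k} \<and> u ` {..Suc k} \<inter> insert a B = {} \<and>
    (\<forall>i\<le>k. R \<union> {a, u i, u (Suc i)} \<in> H) \<and> R \<inter> insert a (u ` {..Suc k}) = {}"
  using d
proof (induction k)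
  case 0
  obtain e0 where "e0 \<in> H" using \<open>H \<noteq> {}\<close> by blast
  then obtain e where e: "e \<in> H" "e \<inter> B = {}"
    using full_exchange[OF unif full B, of e0 "{}"] 0 by auto
  have "card e = r" using uniform_edge[OF unif e(1)] by simp
  then obtain T where T: "T \<subseteq> e" "card T = 3" using r obtain_subset_with_card_n[of 3 e] by blast
  then obtain a x y where axy: "T = {a, x, y}" "a \<noteq> x" "a \<noteq> y" "x \<noteq> y" by (auto simp: card_3_iff)
  have eqT: "insert a (insert x (insert y (e - T))) = e" using T(1) axy(1) by blast
  show ?case
  proof (intro exI[of _ "e - T"] exI[of _ a] exI[of _ "\<lambda>i. if i = 0 then x else y"] conjI allI impI)
    fix i :: nat assume "i \<le> 0"
    then show "e - T \<union> {a, if i = 0 then x else y, if Suc i = 0 then x else y} \<in> H"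
      using e(1) eqT by simp
  qed (use T axy e in \<open>auto simp: inj_on_def\<close>)
next
  case (Suc k)
  then obtain R a u where IH: "a \<notin> B" "inj_on u {..Suc k}" "u ` {..Suc k} \<inter> insert a B = {}"
    "\<And>i. i \<le> k \<Longrightarrow> R \<union> {a, u i, u (Suc i)} \<in> H" "R \<inter> insert a (u ` {..Suc k}) = {}" by auto
  let ?e = "R \<union> {a, u k, u (Suc k)}"
  have "u k \<noteq> u (Suc k)" using inj_onD[OF IH(2), of k "Suc k"] by auto
  then have eq: "?e - {u k} = R \<union> {a, u (Suc k)}" using IH(3,5) by auto
  have "?e \<in> H" using IH(4) by blast
  \<comment> \<open>Exchanging the second last rim vertex for a new one keeps the hub
    \<open>a\<close> and the rest \<open>R\<close>, so the rim grows by one.\<close>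
  then have "R \<union> {a, u (Suc k)} \<in> shadow H" unfolding shadow_def eq[symmetric] by blast
  then have "d \<le> card (nbrs H (R \<union> {a, u (Suc k)}))" using full unfolding full_def by blast
  moreover have "card (B \<union> u ` {..Suc k}) < d"
    using card_Un_le[of B "u ` {..Suc k}"] card_image_le[of "{..Suc k}" u] Suc.prems by simp
  ultimately have "\<not> nbrs H (R \<union> {a, u (Suc k)}) \<subseteq> B \<union> u ` {..Suc k}"
    using card_mono[of "B \<union> u ` {..Suc k}" "nbrs H (R \<union> {a, u (Suc k)})"] B by auto
  then obtain v where v: "v \<in> nbrs H (R \<union> {a, u (Suc k)})" "v \<notin> B" "v \<notin> u ` {..Suc k}" by blast
  have vv: "v \<notin> R" "v \<noteq> a" "R \<union> {a, u (Suc k), v} \<in> H"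
    using v by (auto simp: nbrs_def insert_commute)
  let ?u = "u(Suc (Suc k) := v)"
  have im: "?u ` {..Suc (Suc k)} = insert v (u ` {..Suc k})"
    by (auto simp: atMost_Suc image_iff)
  show ?case
  proof (intro exI[of _ R] exI[of _ a] exI[of _ ?u] conjI allI impI)
    show "inj_on ?u {..Suc (Suc k)}"
      using IH(2) v(3) by (auto simp: inj_on_def le_Suc_eq image_iff)
    show "R \<union> {a, ?u i, ?u (Suc i)} \<in> H" if "i \<le> Suc k" for i
      using IH(4)[of i] vv that by (cases "i = Suc k") auto
  qed (use IH v vv im in auto)
qed

lemma full_loose_cycle:
  assumes unif: "uniform r V H" and full: "full d H" and "H \<noteq> {}" and B: "finite B"
    and r: "3 \<le> r" and l: "4 \<le> l" and d: "card B + l + r * l < d"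
  shows "\<exists>E. loose True l E \<and> (\<forall>j<l. E j \<in> H \<and> E j \<inter> B = {})"
proof -
  have "card B + (l - 3) + 2 < d" using d l by linarith
  from full_fan[OF unif full \<open>H \<noteq> {}\<close> B r this] obtain R a u where
    u: "a \<notin> B" "inj_on u {..Suc (l - 3)}" "u ` {..Suc (l - 3)} \<inter> insert a B = {}"
    "\<And>i. i \<le> l - 3 \<Longrightarrow> R \<union> {a, u i, u (Suc i)} \<in> H" by blast
  have l3: "Suc (l - 3) = l - 2" using l by simp
  \<comment> \<open>Hub and rim \<open>u 0, ..., u (l - 2)\<close> of the fan form l vertices, and
    each cyclically consecutive pair lies in an edge.\<close>
  define w where "w i = (if i = 0 then a else u (i - 1))" for i
  have ua: "u i \<noteq> a" if "i \<le> l - 2" for i using that u(3) unfolding l3 by auto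
  have inj: "w i = w j \<longleftrightarrow> i = j" if "i < l" "j < l" for i j
  proof -
    have "i - 1 \<le> l - 2" "j - 1 \<le> l - 2" using that by auto
    then show ?thesis
      using inj_onD[OF u(2)[unfolded l3], of "i - 1" "j - 1"] ua[of "i - 1"] ua[of "j - 1"]
      by (cases i; cases j) (auto simp: w_def)
  qed
  have wB: "w i \<notin> B" if "i < l" for i
  proof (cases "i = 0")
    case False
    then have "u (i - 1) \<in> u ` {..l - 2}" using that by (intro imageI) auto
    then show ?thesis using u(3) False unfolding l3 by (auto simp: w_def)
  qed (simp add: w_def u(1))
  define S where "S i = {w i, w (Suc i mod l)}" for i
  define U where "U = B \<union> w ` {..<l}"
  have cU: "card U \<le> card B + l"
    using card_Un_le[of B "w ` {..<l}"] card_image_le[of "{..<l}" w] by (simp add: U_def)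
  have S: "\<exists>e\<in>H. S i \<subseteq> e" if i: "i < l" for i
  proof -
    consider "i = 0" | "0 < i" "Suc i < l" | "Suc i = l" using i by linarith
    then show ?thesis
    proof cases
      case 1
      then show ?thesis using u(4)[of 0] l
        by (intro bexI[of _ "R \<union> {a, u 0, u (Suc 0)}"]) (auto simp: S_def w_def)
    next
      case 2
      then have "i - 1 \<le> l - 3" by linarith
      then show ?thesis using u(4)[of "i - 1"] 2
        by (intro bexI[of _ "R \<union> {a, u (i - 1), u (Suc (i - 1))}"]) (auto simp: S_def w_def)
    next
      case 3
      then have "S i = {u (Suc (l - 3)), a}" using l unfolding l3 S_def w_def by (auto simp: numeral_2_eq_2)
      then show ?thesis using u(4)[of "l - 3"]
        by (intro bexI[of _ "R \<union> {a, u (l - 3), u (Suc (l - 3))}"]) auto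
    qed
  qed
  have "finite U" using B by (simp add: U_def)
  moreover have "card U + r * l < d" using cU d by linarith
  ultimately obtain E where E0: "\<forall>i<l. E i \<in> H \<and> S i \<subseteq> E i \<and> (E i - S i) \<inter> U = {}"
    "\<forall>j<l. \<forall>i<j. (E j - S j) \<inter> E i = {}"
    using full_fill[OF unif full, of U l S] S by blast
  have E: "\<And>i. i < l \<Longrightarrow> E i \<in> H \<and> S i \<subseteq> E i \<and> (E i - S i) \<inter> U = {}"
    "\<And>i j. j < l \<Longrightarrow> i < j \<Longrightarrow> (E j - S j) \<inter> E i = {}" using E0 by simp_all
  have SU: "S i \<subseteq> U" if "i < l" for i using that by (auto simp: S_def U_def)
  have EE: "E i \<inter> E j = S i \<inter> S j" if "j < l" "i < j" for i j
    using E(1)[of i] E(1)[of j] E(2)[OF that] SU[of i] SU[of j] that by auto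
  have "loose True l E" unfolding loose_def
  proof (intro allI impI)
    fix j i assume ij: "j < l" "i < j"
    consider "j = Suc i" | "i = 0" "Suc j = l" | "j \<noteq> Suc i" "\<not> (i = 0 \<and> Suc j = l)" by blast
    then show "if j = Suc i \<or> True \<and> i = 0 \<and> Suc j = l then card (E i \<inter> E j) = 1 else E i \<inter> E j = {}"
    proof cases
      case 1
      then have "S i \<inter> S j = {w j}" using ij l inj by (cases "Suc j = l") (auto simp: S_def)
      then show ?thesis using 1 EE[OF ij] by simp
    next
      case 2
      then have "S i \<inter> S j = {w i}" using ij l inj by (auto simp: S_def)
      then show ?thesis using 2 EE[OF ij] by simp
    next
      case 3
      then have "S i \<inter> S j = {}" using ij l inj by (cases "Suc j = l") (auto simp: S_def)
      then show ?thesis using 3 EE[OF ij] by auto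
    qed
  qed
  moreover have "E j \<inter> B = {}" if "j < l" for j
  proof -
    have "S j \<inter> B = {}" using wB[OF that] wB[of "Suc j mod l"] l by (auto simp: S_def)
    then show ?thesis using E(1)[OF that] by (auto simp: U_def)
  qed
  ultimately show ?thesis using E(1) by blast
qed

text \<open>The three quantities that \<open>full_loose_cycle\<close> adds up, for a cycle of up to
  \<open>l i + 1\<close> edges, are each at most \<open>r * (sum l I + 1)\<close>; this explains the
  bound on \<open>d\<close>.\<close>

lemma full_has_system:
  assumes unif: "uniform r V H" and full: "full d H" and "H \<noteq> {}" and r: "3 \<le> r"
    and I: "finite I" "\<And>i. i \<in> I \<Longrightarrow> 4 \<le> l i"
    and d: "4 * r * (sum l I + 1) < d"
  shows "has_system cyc I l H"
proof (rule has_systemI[where C = "{}" and D = "\<lambda>_. {}" and r = r and b = "r * sum l I"])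
  fix i and B :: "'a set" assume i: "i \<in> I" and B: "finite B" "card B \<le> r * sum l I"
  have "l i \<le> sum l I" using i I by (intro member_le_sum) auto
  then have "r * l i \<le> r * sum l I" "Suc (l i) \<le> r * (sum l I + 1)"
    using r mult_le_mono[of 1 r "Suc (l i)" "sum l I + 1"] by auto
  then have "card B + Suc (l i) + r * Suc (l i) < d"
    using B(2) d r unfolding mult_Suc_right add_mult_distrib2 mult.assoc mult_1_right by linarith
  from full_loose_cycle[OF unif full \<open>H \<noteq> {}\<close> B(1) r _ this] I(2)[OF i] obtain E where
    E: "loose True (Suc (l i)) E" "\<forall>j<Suc (l i). E j \<in> H \<and> E j \<inter> B = {}" by auto
  have "card B + l i + r * l i < d" using \<open>card B + Suc (l i) + r * Suc (l i) < d\<close> by simp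
  from full_loose_cycle[OF unif full \<open>H \<noteq> {}\<close> B(1) r _ this] I(2)[OF i] obtain E' where
    E': "loose True (l i) E'" "\<forall>j<l i. E' j \<in> H \<and> E' j \<inter> B = {}" by auto
  show "\<exists>E. loose cyc (l i) E \<and> (\<forall>j<l i. E j \<in> H \<and> E j \<inter> (B \<union> {}) \<subseteq> {})"
  proof (cases cyc)
    case True
    then show ?thesis using E' by (intro exI[of _ E']) auto
  next
    case False
    then show ?thesis using E loose_path_of_cycle by (intro exI[of _ E]) auto
  qed
qed (use I uniform_edge[OF unif] in auto)

section \<open>Assembling loose paths and cycles\<close>

text \<open>
  A loose path or cycle \<open>E\<^sub>0, \<dots>, E\<^sub>l\<^sub>-\<^sub>1\<close> is described by its joints: \<open>\<kappa> i = Some p\<close> means that \<open>E\<^sub>i\<close> and the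
  cyclically next edge meet in a vertex of part \<open>p\<close>, and \<open>\<kappa> i = None\<close> that they share no vertex of
  the blow-up (but perhaps a label). The edge \<open>E\<^sub>i\<close> uses the vertex numbered \<open>i\<close> in every part, except in
  the part of its first joint, where it uses the one numbered by its predecessor.
\<close>

definition cprev :: "nat \<Rightarrow> nat \<Rightarrow> nat" where
  "cprev l i = (if i = 0 then l - 1 else i - 1)"

text \<open>The shift \<sigma> moves a whole configuration along the parts, so that edges of two
  configurations can be compared inside one blow-up.\<close>

definition selector :: "(nat \<Rightarrow> nat option) \<Rightarrow> nat \<Rightarrow> nat \<Rightarrow> nat \<Rightarrow> nat \<Rightarrow> nat" where
  "selector \<kappa> l \<sigma> i p = (if \<kappa> (cprev l i) = Some p then cprev l i else i) + \<sigma>"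

text \<open>An edge has a single vertex in each part, so its two joints must lie in different parts.
  For q = 2 this excludes odd cycles all of whose joints are blow-up vertices.\<close>

definition proper_joints :: "nat \<Rightarrow> nat \<Rightarrow> (nat \<Rightarrow> nat option) \<Rightarrow> bool" where
  "proper_joints q l \<kappa> \<longleftrightarrow> (\<forall>i<l. \<forall>p. \<kappa> i = Some p \<longrightarrow> p < q \<and> \<kappa> (cprev l i) \<noteq> Some p)"

lemma selector_in_sels: "i < l \<Longrightarrow> l + \<sigma> \<le> m \<Longrightarrow> sel q (selector \<kappa> l \<sigma> i) \<in> sels q m"
  unfolding sels_def by (auto simp: selector_def cprev_def intro!: exI[of _ "selector \<kappa> l \<sigma> i"])

lemma sel_Int: "sel q \<alpha> \<inter> sel q \<beta> = {(p, \<alpha> p) | p. p < q \<and> \<alpha> p = \<beta> p}"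
  by (auto simp: sel_def)

lemma sel_selector_Int:
  assumes \<kappa>: "proper_joints q l \<kappa>" and l: "3 \<le> l" and ij: "i < j" "j < l"
  shows "sel q (selector \<kappa> l \<sigma> i) \<inter> sel q (selector \<kappa> l \<sigma> j) =
    (if j = Suc i then {(p, i + \<sigma>) | p. \<kappa> i = Some p}
     else if i = 0 \<and> Suc j = l then {(p, j + \<sigma>) | p. \<kappa> j = Some p} else {})"
proof -
  have P: "p < q \<and> \<kappa> (cprev l i) \<noteq> Some p" if "i < l" "\<kappa> i = Some p" for i p
    using \<kappa> that unfolding proper_joints_def by blast
  consider "j = Suc i" | "i = 0" "Suc j = l" "j \<noteq> Suc i" | "j \<noteq> Suc i" "\<not> (i = 0 \<and> Suc j = l)" by blast
  then show ?thesis
  proof cases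
    case 1
    then have "selector \<kappa> l \<sigma> i p = selector \<kappa> l \<sigma> j p \<longleftrightarrow> \<kappa> i = Some p" for p
      using P[of i p] ij l by (auto simp: selector_def cprev_def)
    moreover have "selector \<kappa> l \<sigma> i p = i + \<sigma>" if "\<kappa> i = Some p" for p
      using P[of i p] that ij by (auto simp: selector_def)
    ultimately show ?thesis unfolding sel_Int using 1 P[of i] ij by auto
  next
    case 2
    then have "selector \<kappa> l \<sigma> i p = selector \<kappa> l \<sigma> j p \<longleftrightarrow> \<kappa> j = Some p" for p
      using P[of j p] ij l by (auto simp: selector_def cprev_def)
    moreover have "selector \<kappa> l \<sigma> i p = j + \<sigma>" if "\<kappa> j = Some p" for p
      using that 2 by (auto simp: selector_def cprev_def)
    ultimately show ?thesis unfolding sel_Int using 2 P[of j] ij by auto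
  next
    case 3
    then have "selector \<kappa> l \<sigma> i p \<noteq> selector \<kappa> l \<sigma> j p" for p
      using ij l by (auto simp: selector_def cprev_def)
    then show ?thesis unfolding sel_Int using 3 by auto
  qed
qed

text \<open>Consecutive edges meet either in the blow-up vertex named by \<kappa> or, where \<kappa>
  is \<open>None\<close>, in a common label, never in both. Labels lie outside the blow-up, so the
  two kinds of intersection do not interfere. \<open>None\<close> at \<open>l - 1\<close> leaves the
  cycle open, since the first and last labels differ.\<close>

lemma loose_assembly:
  assumes inj: "inj_on \<phi> ({..<q} \<times> {..<m})" and m: "l + \<sigma> \<le> m" and l: "3 \<le> l"
    and \<kappa>: "proper_joints q l \<kappa>" and cyc: "cyc \<longleftrightarrow> \<kappa> (l - 1) \<noteq> None"
    and lab: "\<And>i. i < l \<Longrightarrow> c i \<notin> \<phi> ` ({..<q} \<times> {..<m})"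
    and labeq: "\<And>i j. i < j \<Longrightarrow> j < l \<Longrightarrow> c i = c j \<longleftrightarrow> j = Suc i \<and> \<kappa> i = None"
  shows "loose cyc l (\<lambda>i. insert (c i) (\<phi> ` sel q (selector \<kappa> l \<sigma> i)))"
  unfolding loose_def
proof (intro allI impI)
  let ?J = "\<lambda>i. sel q (selector \<kappa> l \<sigma> i)"
  fix j i assume ij: "j < l" "i < j"
  have sub: "?J i \<subseteq> {..<q} \<times> {..<m}" "?J j \<subseteq> {..<q} \<times> {..<m}"
    using ij m by (intro sels_subset selector_in_sels; simp)+
  have im: "\<phi> ` ?J i \<inter> \<phi> ` ?J j = \<phi> ` (?J i \<inter> ?J j)"
    using inj_on_image_Int[OF inj sub] by simp
  have ni: "c i \<notin> \<phi> ` ?J j" "c j \<notin> \<phi> ` ?J i" using lab[of i] lab[of j] ij sub by auto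
  have eq: "insert (c i) (\<phi> ` ?J i) \<inter> insert (c j) (\<phi> ` ?J j)
      = \<phi> ` (?J i \<inter> ?J j) \<union> (if c i = c j then {c i} else {})"
    unfolding im[symmetric] using ni by auto
  note J = sel_selector_Int[OF \<kappa> l ij(2,1), of \<sigma>]
  consider "j = Suc i" "\<kappa> i = None" | p where "j = Suc i" "\<kappa> i = Some p"
    | "i = 0" "Suc j = l" "j \<noteq> Suc i" | "j \<noteq> Suc i" "\<not> (i = 0 \<and> Suc j = l)" by fastforce
  then show "if j = Suc i \<or> cyc \<and> i = 0 \<and> Suc j = l
       then card (insert (c i) (\<phi> ` ?J i) \<inter> insert (c j) (\<phi> ` ?J j)) = 1
       else insert (c i) (\<phi> ` ?J i) \<inter> insert (c j) (\<phi> ` ?J j) = {}" (is ?goal)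
  proof cases
    case 1
    then show ?goal unfolding eq J using labeq[OF ij(2,1)] by simp
  next
    case (2 p)
    then show ?goal unfolding eq J using labeq[OF ij(2,1)] by simp
  next
    case 3
    then have "l - 1 = j" by simp
    then show ?goal unfolding eq J using labeq[OF ij(2,1)] 3 cyc by (cases "\<kappa> j") simp_all
  next
    case 4
    then show ?goal unfolding eq J using labeq[OF ij(2,1)] by auto
  qed
qed

text \<open>Greedy along the path; only the first list may be a singleton, as it has no
  predecessor.\<close>

lemma path_list_colouring:
  fixes L :: "nat \<Rightarrow> 'a set"
  assumes "0 < n \<Longrightarrow> L 0 \<noteq> {}" "\<And>i. 0 < i \<Longrightarrow> i < n \<Longrightarrow> 2 \<le> card (L i)"
  shows "\<exists>c. (\<forall>i<n. c i \<in> L i) \<and> (\<forall>i. Suc i < n \<longrightarrow> c i \<noteq> c (Suc i))"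
  using assms
proof (induction n)
  case 0
  then show ?case by simp
next
  case (Suc n)
  then obtain c where c: "\<forall>i<n. c i \<in> L i" "\<forall>i. Suc i < n \<longrightarrow> c i \<noteq> c (Suc i)" by auto
  have "\<exists>x. x \<in> L n \<and> (0 < n \<longrightarrow> x \<noteq> c (n - 1))"
  proof (cases "n = 0")
    case True
    then show ?thesis using Suc.prems by auto
  next
    case False
    then have "2 \<le> card (L n)" using Suc.prems by simp
    then have "\<not> L n \<subseteq> {c (n - 1)}" using card_mono[of "{c (n - 1)}" "L n"] by auto
    then show ?thesis by blast
  qed
  then obtain x where x: "x \<in> L n" "0 < n \<longrightarrow> x \<noteq> c (n - 1)" by blast
  show ?case
  proof (intro exI[of _ "c(n := x)"] conjI allI impI)
    fix i assume "i < Suc n"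
    then show "(c(n := x)) i \<in> L i" using c(1) x(1) by (auto simp: less_Suc_eq)
  next
    fix i assume "Suc i < Suc n"
    then show "(c(n := x)) i \<noteq> (c(n := x)) (Suc i)" using c(2) x(2) by (cases "Suc i = n") auto
  qed
qed

text \<open>
  Among the \<open>\<lceil>l/2\<rceil>\<close> vertices that are to cover the edges in pairs, all but \<open>j\<close> are taken from \<open>C\<close>; the
  last \<open>2 j\<close> or \<open>2 j - 1\<close> edges instead get distinct labels outside \<open>C\<close>. If \<open>j = 1\<close> and \<open>l\<close> is even, the last
  two edges may have one and the same label outside \<open>C\<close>. Then the second of them, together with an edge
  disjoint from the first, serves as the last pair once the roles of parts 0 and 1 are exchanged.
\<close>

lemma few_component:
  assumes gen: "generic q m A (nbrs H) C (B \<union> C) \<phi>" and q: "2 \<le> q" and l: "5 \<le> l" and m: "Suc l \<le> m"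
    and A: "\<And>f. f \<in> A \<Longrightarrow> C \<subseteq> nbrs H f \<and> j \<le> card (nbrs H f - C)"
    and j: "j \<le> 2" and D: "D \<subseteq> C" "finite D" "card D = (l + 1) div 2 - j"
  shows "\<exists>E. loose cyc l E \<and> (\<forall>i<l. E i \<in> H \<and> E i \<inter> (B \<union> C) \<subseteq> D)"
proof -
  \<comment> \<open>Two edges per vertex of \<open>D\<close>. For odd l and j = 0 this is l + 1, and
    the last vertex of \<open>D\<close> covers a single edge.\<close>
  define i0 where "i0 = 2 * ((l + 1) div 2 - j)"
  have i0: "2 \<le> i0" using l j by (auto simp: i0_def)
  obtain c0 where c0: "bij_betw c0 {0..<card D} D" using ex_bij_betw_nat_finite[OF D(2)] by blast
  have c0D: "c0 (i div 2) \<in> D" if "i < i0" for i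
    using bij_betw_apply[OF c0, of "i div 2"] that D(3) by (auto simp: i0_def)
  have c0eq: "c0 (i div 2) = c0 (i' div 2) \<longleftrightarrow> i div 2 = i' div 2" if "i < i0" "i' < i0" for i i'
    using bij_betw_imp_inj_on[OF c0] that D(3) by (auto simp: i0_def inj_on_eq_iff)
  \<comment> \<open>The two edges of a pair below \<open>i0\<close> meet in a label, and consecutive
    pairs meet in part \<open>p0\<close>. Part \<open>p1\<close> holds the joints inside the pairs
    from \<open>i0\<close> on and the closing joint of an odd cycle. The latter is proper because
    \<open>\<kappa> p0 p1 0 = None\<close>.\<close>
  define \<kappa> where "\<kappa> p0 p1 i = (if \<not> cyc \<and> Suc i = l then None else if odd i then Some p0
      else if i < i0 \<and> Suc i < l then None else Some p1)" for p0 p1 i :: nat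
  define J where "J p0 p1 \<sigma> i = sel q (selector (\<kappa> p0 p1) l \<sigma> i)" for p0 p1 \<sigma> i
  note inj = genericD(1)[OF gen] and avoid = genericD(2)[OF gen] and pick = genericD(3)[OF gen]
    and lab = genericD(4)[OF gen] and lab' = genericD(5)[OF gen] and dis = genericD(6)[OF gen]
  have Jsel: "J p0 p1 \<sigma> i \<in> sels q m" if "i < l" "\<sigma> \<le> 1" for p0 p1 \<sigma> i
    unfolding J_def using that m by (intro selector_in_sels) auto
  have proper: "proper_joints q l (\<kappa> p0 p1)" if "p0 < q" "p1 < q" "p0 \<noteq> p1" for p0 p1
    unfolding proper_joints_def
  proof (intro allI impI)
    fix i p assume i: "i < l" "\<kappa> p0 p1 i = Some p"
    have "i \<noteq> 0" using i i0 l by (intro notI) (auto simp: \<kappa>_def split: if_splits)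
    then obtain i' where "i = Suc i'" by (cases i) auto
    then show "p < q \<and> \<kappa> p0 p1 (cprev l i) \<noteq> Some p"
      using i that by (auto simp: \<kappa>_def cprev_def split: if_splits)
  qed
  have main: ?thesis if p: "p0 < q" "p1 < q" "p0 \<noteq> p1" "\<sigma> \<le> 1"
    and \<rho>: "\<And>i. i0 \<le> i \<Longrightarrow> i < l \<Longrightarrow> \<rho> i \<in> nbrs H (\<phi> ` J p0 p1 \<sigma> i) - C"
    and \<rho>': "\<And>i. i0 \<le> i \<Longrightarrow> Suc i < l \<Longrightarrow> \<rho> i \<noteq> \<rho> (Suc i)" for p0 p1 \<sigma> \<rho>
  proof -
    define c where "c i = (if i < i0 then c0 (i div 2) else \<rho> i)" for i
    let ?E = "\<lambda>i. insert (c i) (\<phi> ` J p0 p1 \<sigma> i)"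
    have cn: "c i \<in> nbrs H (\<phi> ` J p0 p1 \<sigma> i)" if "i < l" for i
      using \<rho>[of i] c0D[of i] A[OF pick[OF Jsel[OF that p(4)]]] that D(1) by (auto simp: c_def)
    have "loose cyc l ?E" unfolding J_def
    proof (rule loose_assembly[OF inj _ _ proper[OF p(1-3)]])
      show "l + \<sigma> \<le> m" "3 \<le> l" using m p(4) l by auto
      show "cyc \<longleftrightarrow> \<kappa> p0 p1 (l - 1) \<noteq> None" using l by (auto simp: \<kappa>_def)
      fix i assume i: "i < l"
      show "c i \<notin> \<phi> ` ({..<q} \<times> {..<m})"
      proof (cases "i < i0")
        case True
        then show ?thesis using c0D[OF True] D(1) avoid by (auto simp: c_def)
      next
        case False
        have "c i \<notin> \<phi> ` J p0 p1 \<sigma> i" using cn[OF i] by (auto simp: nbrs_def)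
        moreover have "c i \<notin> \<phi> ` ({..<q} \<times> {..<m} - J p0 p1 \<sigma> i)"
          using cn[OF i] lab'[OF Jsel[OF i p(4)]] by (auto simp del: DiffE)
        ultimately show ?thesis by blast
      qed
    next
      fix i i' assume i: "i < i'" "i' < l"
      consider "i' < i0" | "i < i0" "i0 \<le> i'" | "i0 \<le> i" by linarith
      then show "c i = c i' \<longleftrightarrow> i' = Suc i \<and> \<kappa> p0 p1 i = None"
      proof cases
        case 1
        then have "c i = c i' \<longleftrightarrow> i div 2 = i' div 2" using i c0eq by (simp add: c_def)
        also have "\<dots> \<longleftrightarrow> i' = Suc i \<and> even i" using i(1) by presburger
        also have "\<dots> \<longleftrightarrow> i' = Suc i \<and> \<kappa> p0 p1 i = None" using 1 i by (auto simp: \<kappa>_def)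
        finally show ?thesis .
      next
        case 2
        then have "c i \<in> C" "c i' \<notin> C" using c0D[of i] D(1) \<rho>[of i'] i by (auto simp: c_def)
        moreover have "\<kappa> p0 p1 i \<noteq> None" if "i' = Suc i"
        proof -
          have "Suc i = i0" using that 2 by simp
          then have "odd i" unfolding i0_def by presburger
          then show ?thesis using that i by (auto simp: \<kappa>_def)
        qed
        ultimately show ?thesis by auto
      next
        case 3
        have "c i \<noteq> c i'"
        proof (cases "i' = Suc i")
          case True
          then show ?thesis using \<rho>'[of i] 3 i by (simp add: c_def)
        next
          case False
          have "J p0 p1 \<sigma> i \<inter> J p0 p1 \<sigma> i' = {}"
            unfolding J_def using sel_selector_Int[OF proper[OF p(1-3)] _ i, of \<sigma>] l False 3 i0 by auto
          then have "nbrs H (\<phi> ` J p0 p1 \<sigma> i) \<inter> nbrs H (\<phi> ` J p0 p1 \<sigma> i') \<subseteq> C"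
            using i p(4) by (intro dis Jsel) auto
          then show ?thesis using \<rho>[of i] \<rho>[of i'] 3 i by (auto simp: c_def)
        qed
        moreover have "\<kappa> p0 p1 i \<noteq> None" using 3 i by (auto simp: \<kappa>_def)
        ultimately show ?thesis by simp
      qed
    qed
    moreover have "?E i \<in> H" if "i < l" for i using cn[OF that] by (simp add: nbrs_def)
    moreover have "?E i \<inter> (B \<union> C) \<subseteq> D" if "i < l" for i
    proof -
      have 1: "\<phi> ` J p0 p1 \<sigma> i \<inter> (B \<union> C) = {}"
        using avoid sels_subset[OF Jsel[OF that p(4), of p0 p1]] by blast
      have 2: "c i \<in> D \<or> c i \<notin> B \<union> C"
        using c0D[of i] \<rho>[of i] lab[OF Jsel[OF that p(4), of p0 p1]] that by (auto simp: c_def)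
      show ?thesis using 1 2 by blast
    qed
    ultimately show ?thesis by (intro exI[of _ ?E]) auto
  qed
  have j0: "j \<noteq> 0" if "i0 < l"
    using that unfolding i0_def by presburger
  have L: "j \<le> card (nbrs H (\<phi> ` J p0 p1 \<sigma> i) - C)" if "i < l" "\<sigma> \<le> 1" for p0 p1 \<sigma> i
    using A[OF pick[OF Jsel[OF that]]] by blast
  show ?thesis
  proof (cases "j = 1 \<and> even l")
    case False
    let ?L = "\<lambda>k. nbrs H (\<phi> ` J 0 1 0 (i0 + k)) - C"
    \<comment> \<open>If j = 1, then l is odd and a single edge is left; if j = 2, all lists have
      two elements. Non-consecutive edges are disjoint in the blow-up, so their labels outside
      \<open>C\<close> differ anyway.\<close>
    have "\<exists>\<rho>. (\<forall>k<l - i0. \<rho> k \<in> ?L k) \<and> (\<forall>k. Suc k < l - i0 \<longrightarrow> \<rho> k \<noteq> \<rho> (Suc k))"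
    proof (rule path_list_colouring)
      assume "0 < l - i0"
      then have "j \<noteq> 0" using j0 by simp
      then have "card (?L 0) \<noteq> 0" using L[of i0 0 0 1] \<open>0 < l - i0\<close> by simp
      then show "?L 0 \<noteq> {}" by (metis card.empty)
    next
      fix k assume k: "0 < k" "k < l - i0"
      then have "j \<noteq> 0" using j0 by simp
      moreover have "j \<noteq> 1"
      proof
        assume "j = 1"
        then have "odd l" using False by simp
        then show False using k l \<open>j = 1\<close> unfolding i0_def by presburger
      qed
      moreover have "j \<le> card (?L k)" using L[of "i0 + k" 0 0 1] k by (simp add: less_diff_conv add.commute)
      ultimately show "2 \<le> card (?L k)" by linarith
    qed
    then obtain \<rho> where \<rho>: "\<forall>k<l - i0. \<rho> k \<in> ?L k" "\<forall>k. Suc k < l - i0 \<longrightarrow> \<rho> k \<noteq> \<rho> (Suc k)" by blast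
    show ?thesis
    proof (rule main[of 0 1 0 "\<lambda>i. \<rho> (i - i0)"])
      fix i assume "i0 \<le> i" "i < l"
      then show "\<rho> (i - i0) \<in> nbrs H (\<phi> ` J 0 1 0 i) - C" using \<rho>(1)[rule_format, of "i - i0"] by simp
    next
      fix i assume "i0 \<le> i" "Suc i < l"
      then show "\<rho> (i - i0) \<noteq> \<rho> (Suc i - i0)" using \<rho>(2)[rule_format, of "i - i0"] by (simp add: Suc_diff_le)
    qed (use q in auto)
  next
    case True
    then have il: "i0 = l - 2" using l unfolding i0_def by presburger
    let ?N = "\<lambda>p0 p1 \<sigma> i. nbrs H (\<phi> ` J p0 p1 \<sigma> i) - C"
    have ne: "?N p0 p1 \<sigma> i \<noteq> {}" if "i < l" "\<sigma> \<le> 1" for p0 p1 \<sigma> i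
      using L[OF that, of p0 p1] True by (metis card.empty not_one_le_zero)
    have two: ?thesis if p: "p0 < q" "p1 < q" "p0 \<noteq> p1" "\<sigma> \<le> 1" and xy: "x \<in> ?N p0 p1 \<sigma> (l - 2)"
      "y \<in> ?N p0 p1 \<sigma> (l - 1)" "x \<noteq> y" for p0 p1 \<sigma> x y
    proof (rule main[OF p, of "\<lambda>i. if i = l - 2 then x else y"])
      fix i assume "i0 \<le> i" "i < l"
      then have "i = l - 2 \<or> i = l - 1" using il by linarith
      then show "(if i = l - 2 then x else y) \<in> ?N p0 p1 \<sigma> i" using xy l by auto
    next
      fix i assume "i0 \<le> i" "Suc i < l"
      then have "i = l - 2" using il by linarith
      then show "(if i = l - 2 then x else y) \<noteq> (if Suc i = l - 2 then x else y)" using xy by simp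
    qed
    have el: "odd (l - 3)" "odd (l - 1)" "even (l - 2)" "l - 3 < l" using True l by auto
    \<comment> \<open>After exchanging parts 0 and 1 and shifting by one, the old last edge is the
      second last and can keep the label x. By \<open>J2\<close> the new last edge is disjoint from
      the old second last, which also has the label x, so x is not among its labels.\<close>
    have J1: "J 1 0 1 (l - 2) = J 0 1 0 (l - 1)"
      unfolding J_def sel_def using l el il
      by (intro image_cong) (auto simp: selector_def cprev_def \<kappa>_def numeral_3_eq_3 numeral_2_eq_2 Suc_diff_Suc)
    have J2: "J 0 1 0 (l - 2) \<inter> J 1 0 1 (l - 1) = {}"
      unfolding J_def sel_Int using l el il
      by (auto simp: selector_def cprev_def \<kappa>_def numeral_3_eq_3 numeral_2_eq_2 split: if_splits)
    show ?thesis
    proof (cases "\<exists>x\<in>?N 0 1 0 (l - 2). \<exists>y\<in>?N 0 1 0 (l - 1). x \<noteq> y")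
      case True
      then obtain x y where "x \<in> ?N 0 1 0 (l - 2)" "y \<in> ?N 0 1 0 (l - 1)" "x \<noteq> y" by blast
      then show ?thesis using two[of 0 1 0 x y] q by simp
    next
      case False
      obtain x where x: "x \<in> ?N 0 1 0 (l - 2)" using ne[of "l - 2" 0 0 1] l by fastforce
      obtain x' where x': "x' \<in> ?N 0 1 0 (l - 1)" using ne[of "l - 1" 0 0 1] l by fastforce
      have "x = x'" using False x x' by blast
      then have x1: "x \<in> ?N 1 0 1 (l - 2)" using x' unfolding J1 by simp
      obtain y where y: "y \<in> ?N 1 0 1 (l - 1)" using ne[of "l - 1" 1 1 0] l by fastforce
      have "nbrs H (\<phi> ` J 0 1 0 (l - 2)) \<inter> nbrs H (\<phi> ` J 1 0 1 (l - 1)) \<subseteq> C"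
        using l by (intro dis Jsel J2) auto
      then have "x \<noteq> y" using x y by blast
      then show ?thesis using two[of 1 0 1 x y] q x1 y by simp
    qed
  qed
qed

section \<open>Cycles with all labels outside the common set\<close>

text \<open>For odd l the joints before and after the closing one lie in parts 0 and 1, which forces
  a third part.\<close>

definition cyc_joints :: "nat \<Rightarrow> nat \<Rightarrow> nat option" where
  "cyc_joints l i = (if Suc i = l \<and> odd l then Some 2 else if odd i then Some 0 else Some 1)"

abbreviation cyc_sel :: "nat \<Rightarrow> nat \<Rightarrow> nat \<Rightarrow> (nat \<times> nat) set" where
  "cyc_sel q l i \<equiv> sel q (selector (cyc_joints l) l 0 i)"

lemma proper_cyc_joints:
  assumes "2 \<le> q" "even l \<or> 3 \<le> q" "4 \<le> l"
  shows "proper_joints q l (cyc_joints l)"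
  unfolding proper_joints_def
proof (intro allI impI)
  fix i p assume i: "i < l" "cyc_joints l i = Some p"
  then show "p < q \<and> cyc_joints l (cprev l i) \<noteq> Some p"
    using assms by (cases i) (auto simp: cyc_joints_def cprev_def split: if_splits)
qed

text \<open>Non-consecutive edges have disjoint selections, so genericity separates their labels
  outside \<open>C\<close>. Only cyclically consecutive labels have to be kept apart by
  hand.\<close>

lemma generic_cycle:
  assumes gen: "generic q m A \<Lambda> C (B \<union> C) \<phi>" and q: "2 \<le> q" "even l \<or> 3 \<le> q" and l: "4 \<le> l" "l \<le> m"
    and A: "\<And>f. f \<in> A \<Longrightarrow> nbrs H f \<subseteq> \<Lambda> f"
    and c: "\<And>i. i < l \<Longrightarrow> c i \<in> nbrs H (\<phi> ` cyc_sel q l i) - C"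
    and adj: "\<And>i. Suc i < l \<Longrightarrow> c i \<noteq> c (Suc i)" "c 0 \<noteq> c (l - 1)"
  shows "loose True l (\<lambda>i. insert (c i) (\<phi> ` cyc_sel q l i))"
    and "i < l \<Longrightarrow> insert (c i) (\<phi> ` cyc_sel q l i) \<in> H"
    and "i < l \<Longrightarrow> insert (c i) (\<phi> ` cyc_sel q l i) \<inter> B = {}"
proof -
  note inj = genericD(1)[OF gen] and avoid = genericD(2)[OF gen] and pick = genericD(3)[OF gen]
    and lab = genericD(4)[OF gen] and lab' = genericD(5)[OF gen] and dis = genericD(6)[OF gen]
  have J: "cyc_sel q l i \<in> sels q m" if "i < l" for i using that l by (intro selector_in_sels) auto
  have cL: "c i \<in> \<Lambda> (\<phi> ` cyc_sel q l i) - C" if "i < l" for i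
    using c[OF that] A[OF pick[OF J[OF that]]] by blast
  note pr = proper_cyc_joints[OF q l(1)]
  show "loose True l (\<lambda>i. insert (c i) (\<phi> ` cyc_sel q l i))"
  proof (rule loose_assembly[OF inj _ _ pr])
    fix i assume i: "i < l"
    have "c i \<notin> \<phi> ` cyc_sel q l i" using c[OF i] by (auto simp: nbrs_def)
    moreover have "c i \<notin> \<phi> ` ({..<q} \<times> {..<m} - cyc_sel q l i)"
      using cL[OF i] lab'[OF J[OF i]] by (auto simp del: DiffE)
    ultimately show "c i \<notin> \<phi> ` ({..<q} \<times> {..<m})" by blast
  next
    fix i j assume ij: "i < j" "j < l"
    have "c i \<noteq> c j"
    proof (cases "j = Suc i \<or> i = 0 \<and> Suc j = l")
      case True
      then show ?thesis using adj ij by auto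
    next
      case False
      then have "cyc_sel q l i \<inter> cyc_sel q l j = {}"
        using sel_selector_Int[OF pr _ ij, of 0] l by auto
      then have "\<Lambda> (\<phi> ` cyc_sel q l i) \<inter> \<Lambda> (\<phi> ` cyc_sel q l j) \<subseteq> C"
        using ij by (intro dis J) auto
      then show ?thesis using cL[of i] cL[of j] ij by auto
    qed
    then show "c i = c j \<longleftrightarrow> j = Suc i \<and> cyc_joints l i = None" by (simp add: cyc_joints_def)
  qed (use l in \<open>auto simp: cyc_joints_def\<close>)
  show "insert (c i) (\<phi> ` cyc_sel q l i) \<in> H" if "i < l" for i
    using c[OF that] by (simp add: nbrs_def)
  show "insert (c i) (\<phi> ` cyc_sel q l i) \<inter> B = {}" if "i < l" for i
    using cL[OF that] lab[OF J[OF that]] avoid sels_subset[OF J[OF that]] by blast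
qed

text \<open>Three labels suffice for every cycle: a label fixed for edge 0 is banned from all other
  lists, which keep two elements each and are coloured along a path.\<close>

lemma many_cycle:
  assumes gen: "generic q m A \<Lambda> C (B \<union> C) \<phi>" and q: "2 \<le> q" "even l \<or> 3 \<le> q" and l: "4 \<le> l" "l \<le> m"
    and A: "\<And>f. f \<in> A \<Longrightarrow> nbrs H f \<subseteq> \<Lambda> f \<and> 3 \<le> card (nbrs H f - C)"
  shows "\<exists>E. loose True l E \<and> (\<forall>i<l. E i \<in> H \<and> E i \<inter> B = {})"
proof -
  have J: "cyc_sel q l i \<in> sels q m" if "i < l" for i using that l by (intro selector_in_sels) auto
  have pick: "\<phi> ` cyc_sel q l i \<in> A" if "i < l" for i
    using gen J[OF that] unfolding generic_def by blast
  let ?L = "\<lambda>i. nbrs H (\<phi> ` cyc_sel q l i) - C"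
  have L: "3 \<le> card (?L i)" if "i < l" for i using A[OF pick[OF that]] by blast
  have "card (?L 0) \<noteq> 0" using L[of 0] l by simp
  then obtain x where x: "x \<in> ?L 0" by (metis card.empty ex_in_conv)
  have L': "2 \<le> card (?L (Suc k) - {x})" if "k < l - 1" for k
  proof -
    have 3: "3 \<le> card (?L (Suc k))" using L[of "Suc k"] that by linarith
    then have "finite (?L (Suc k))" by (intro card_ge_0_finite) linarith
    then show ?thesis using 3 card_Diff1_le[of "?L (Suc k)" x] by (auto simp: card_Diff_singleton_if)
  qed
  have L0: "?L (Suc 0) - {x} \<noteq> {}"
  proof
    assume e: "?L (Suc 0) - {x} = {}"
    have "2 \<le> card (?L (Suc 0) - {x})" by (rule L') (use l in simp)
    then show False unfolding e by simp
  qed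
  have "\<exists>c. (\<forall>k<l - 1. c k \<in> ?L (Suc k) - {x}) \<and> (\<forall>k. Suc k < l - 1 \<longrightarrow> c k \<noteq> c (Suc k))"
    by (rule path_list_colouring) (use L0 L' in auto)
  then obtain c where c: "\<And>k. k < l - 1 \<Longrightarrow> c k \<in> ?L (Suc k) - {x}"
    "\<And>k. Suc k < l - 1 \<Longrightarrow> c k \<noteq> c (Suc k)" by blast
  define c' where "c' i = (if i = 0 then x else c (i - 1))" for i
  have 1: "c' i \<in> ?L i" if "i < l" for i
    using x c(1)[of "i - 1"] that by (auto simp: c'_def)
  have 2: "c' i \<noteq> c' (Suc i)" if "Suc i < l" for i
    using c(1)[of 0] c(2)[of "i - 1"] that by (cases i) (auto simp: c'_def)
  have 3: "c' 0 \<noteq> c' (l - 1)" 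
  proof -
    have "l - 2 < l - 1" "l - 1 - 1 = l - 2" "l - 1 \<noteq> 0" using l by auto
    then show ?thesis using c(1)[of "l - 2"] by (auto simp: c'_def simp del: diff_diff_left)
  qed
  note * = generic_cycle[OF gen q l _ 1 2 3]
  show ?thesis by (intro exI[of _ "\<lambda>i. insert (c' i) (\<phi> ` cyc_sel q l i)"] conjI allI impI *) (use A in auto)
qed

text \<open>\<open>y\<close> and \<open>x\<close> remain the joints with the old neighbours, and
  \<open>z\<close> becomes the joint of the two new edges. This turns an even 3-uniform cycle into
  an odd one.\<close>

lemma loose_split:
  assumes E: "loose True l E" and l: "4 \<le> l" and last: "E (l - 1) = {x, y, z}" "x \<noteq> y" "x \<noteq> z" "y \<noteq> z"
    and xy: "x \<in> E 0" "y \<in> E (l - 2)" and w: "\<And>i. i < l \<Longrightarrow> w1 \<notin> E i \<and> w2 \<notin> E i" "w1 \<noteq> w2"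
  shows "loose True (Suc l) (\<lambda>i. if i < l - 1 then E i else if i = l - 1 then {w1, y, z} else {w2, x, z})"
    (is "loose True (Suc l) ?E")
proof -
  have E1: "card (E i \<inter> E j) = 1" if "i < j" "j < l" "j = Suc i \<or> i = 0 \<and> Suc j = l" for i j
    using E that unfolding loose_def by auto
  have E2: "E i \<inter> E j = {}" if "i < j" "j < l" "j \<noteq> Suc i" "\<not> (i = 0 \<and> Suc j = l)" for i j
    using E that unfolding loose_def by auto
  have "card (E 0 \<inter> E (l - 1)) = 1" "x \<in> E 0 \<inter> E (l - 1)" using E1[of 0 "l - 1"] l xy last by auto
  then have X: "E 0 \<inter> {x, y, z} = {x}" unfolding last(1) by (metis card_1_singletonE singletonD)
  have "card (E (l - 2) \<inter> E (l - 1)) = 1" "y \<in> E (l - 2) \<inter> E (l - 1)"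
    using E1[of "l - 2" "l - 1"] l xy last by (simp_all add: Suc_diff_Suc numeral_2_eq_2)
  then have Y: "E (l - 2) \<inter> {x, y, z} = {y}" unfolding last(1) by (metis card_1_singletonE singletonD)
  have Z: "E i \<inter> {x, y, z} = {}" if "0 < i" "i < l - 2" for i
    using E2[of i "l - 1"] that unfolding last(1) by auto
  have W: "w1 \<notin> {x, y, z}" "w2 \<notin> {x, y, z}" using w(1)[of "l - 1"] l last(1) by auto
  have X': "y \<notin> E 0" "z \<notin> E 0" using X last(2,3) by (metis Int_iff insertCI singletonD)+
  have Y': "x \<notin> E (l - 2)" "z \<notin> E (l - 2)" using Y last(2,4) by (metis Int_iff insertCI singletonD)+
  have W1: "w1 \<notin> E 0" "w2 \<notin> E 0" "w1 \<notin> E (l - 2)" "w2 \<notin> E (l - 2)" using w(1)[of 0] w(1)[of "l - 2"] l by auto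
  show ?thesis unfolding loose_def
  proof (intro allI impI)
    fix j i assume ij: "j < Suc l" "i < j"
    have "j < l - 1 \<or> j = l - 1 \<or> j = l" using ij by linarith
    moreover have "i = 0 \<or> i = l - 2 \<or> (0 < i \<and> i < l - 2) \<or> (i = l - 1 \<and> j = l)" using ij by linarith
    moreover have "l - 1 \<noteq> l" using l by simp
    ultimately consider "j < l - 1" | "j = l - 1" "i = 0" | "j = l - 1" "i = l - 2" | "j = l - 1" "0 < i" "i < l - 2"
      | "j = l" "i = 0" | "j = l" "i = l - 2" | "j = l" "0 < i" "i < l - 2" | "j = l" "i = l - 1"
      by blast
    then show "if j = Suc i \<or> True \<and> i = 0 \<and> Suc j = Suc l then card (?E i \<inter> ?E j) = 1 else ?E i \<inter> ?E j = {}"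
      (is ?goal)
    proof cases
      case 1
      then have "j < l" "Suc j \<noteq> l" "i < l - 1" "j \<noteq> l" using ij by auto
      then show ?goal using 1 E1[of i j] E2[of i j] ij by auto
    next
      case 2
      then have "?E i = E (0)" "?E j = {w1, y, z}" using l by auto
      then have "?E i \<inter> ?E j = {}" using X' W1 xy(1) by auto
      then show ?goal using 2 l by auto
    next
      case 3
      then have "?E i = E (l - 2)" "?E j = {w1, y, z}" using l by auto
      then have "?E i \<inter> ?E j = {y}" using Y' W1 xy(2) by auto
      then show ?goal using 3 l by auto
    next
      case 4
      then have "?E i = E (i)" "?E j = {w1, y, z}" using l by auto
      then have "?E i \<inter> ?E j = {}" using Z[of i] w(1)[of i] 4 by auto
      then show ?goal using 4 l by auto
    next
      case 5
      then have "?E i = E (0)" "?E j = {w2, x, z}" using l by auto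
      then have "?E i \<inter> ?E j = {x}" using X' W1 xy(1) by auto
      then show ?goal using 5 l by auto
    next
      case 6
      then have "?E i = E (l - 2)" "?E j = {w2, x, z}" using l by auto
      then have "?E i \<inter> ?E j = {}" using Y' W1 xy(2) by auto
      then show ?goal using 6 l by auto
    next
      case 7
      then have "?E i = E (i)" "?E j = {w2, x, z}" using l by auto
      then have "?E i \<inter> ?E j = {}" using Z[of i] w(1)[of i] 7 by auto
      then show ?goal using 7 l by auto
    next
      case 8
      then have "?E i = {w1, y, z}" "?E j = {w2, x, z}" using l by auto
      then have "?E i \<inter> ?E j = {z}" using W w(2) last(2) by auto
      then show ?goal using 8 l by auto
    qed
  qed
qed

lemma fresh_element:
  assumes "finite W" "card W < card N"
  shows "\<exists>w\<in>N. w \<notin> W"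
proof (rule ccontr)
  assume "\<not> ?thesis"
  then have "N \<subseteq> W" by blast
  from card_mono[OF assms(1) this] show False using assms(2) by simp
qed

text \<open>
  A complete bipartite graph has no odd cycles. Instead, take a cycle of even length \<open>l - 1\<close> and replace
  its last edge \<open>{x, y, z}\<close> by \<open>{y, z, v1}\<close> and \<open>{x, z, v2}\<close>, which exist since the pairs \<open>{y, z}\<close> and
  \<open>{x, z}\<close> have many neighbours. Poor pairs have their neighbours among the labels of \<open>{x, y}\<close>, so these
  are chosen before the labels of the cycle; the neighbours of rich pairs are chosen last.
\<close>

lemma many_odd_cycle:
  assumes gen: "generic 2 m A \<Lambda> C (B \<union> C) \<phi>" and l: "5 \<le> l" "odd l" "l \<le> m" and unif: "uniform 3 V H"
    and A: "\<And>f. f \<in> A \<Longrightarrow> nbrs H f \<subseteq> \<Lambda> f \<and> 3 \<le> card (nbrs H f - C)"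
    and poor: "\<And>f x z. f \<in> A \<Longrightarrow> x \<in> f \<Longrightarrow> z \<in> nbrs H f \<Longrightarrow> card (nbrs H (insert z (f - {x}))) < d \<Longrightarrow>
       nbrs H (insert z (f - {x})) \<subseteq> \<Lambda> f \<and> 3 \<le> card (nbrs H (insert z (f - {x})) - C)"
    and B: "finite B" "card B + 3 * l + 2 \<le> d"
  shows "\<exists>E. loose True l E \<and> (\<forall>i<l. E i \<in> H \<and> E i \<inter> B = {})"
proof -
  define k where "k = l - 1"
  have k: "4 \<le> k" "even k" "k \<le> m" "l = Suc k" using l by (auto simp: k_def)
  note inj = genericD(1)[OF gen] and avoid = genericD(2)[OF gen] and pick = genericD(3)[OF gen]
    and lab = genericD(4)[OF gen] and lab' = genericD(5)[OF gen] and dis = genericD(6)[OF gen]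
  let ?J = "cyc_sel 2 k"
  let ?f = "\<lambda>i. \<phi> ` ?J i"
  have J: "?J i \<in> sels 2 m" if "i < k" for i using that k by (intro selector_in_sels) auto
  note pr = proper_cyc_joints[of 2 k, OF order_refl disjI1[OF k(2)] k(1)]
  have lt2: "{..<2::nat} = {0, 1}" by auto
  have odds: "odd (k - 1)" "even (k - 2)" "odd (k - 3)" using k by auto
  have sucs: "Suc (k - 1) = k" "Suc (k - 2) = k - 1" "Suc (k - 3) = k - 2" "k - 1 - 1 = k - 2" "k - 2 - 1 = k - 3"
    using k by auto
  have Jlast: "?J (k - 1) = {(0, k - 1), (1, k - 2)}"
    using k odds sucs unfolding sel_def lt2 by (simp add: selector_def cprev_def cyc_joints_def del: diff_diff_left)
  have J0: "?J 0 = {(0, k - 1), (1, 0)}"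
    using k odds sucs unfolding sel_def lt2 by (simp add: selector_def cprev_def cyc_joints_def del: diff_diff_left)
  have J2: "?J (k - 2) = {(0, k - 3), (1, k - 2)}"
    using k odds sucs unfolding sel_def lt2 by (simp add: selector_def cprev_def cyc_joints_def del: diff_diff_left)
  define x where "x = \<phi> (0, k - 1)"
  define y where "y = \<phi> (1, k - 2)"
  define \<gamma> where "\<gamma> = ?f (k - 1)"
  have \<gamma>: "\<gamma> = {x, y}" unfolding \<gamma>_def Jlast x_def y_def by simp
  have Jl: "?J (k - 1) \<in> sels 2 m" using J k by simp
  have \<gamma>A: "\<gamma> \<in> A" unfolding \<gamma>_def by (rule pick[OF Jl])
  have neq: "\<phi> (0, a) \<noteq> \<phi> (1, b)" if "a < m" "b < m" for a b
    using inj_onD[OF inj, of "(0, a)" "(1, b)"] that by auto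
  have xy: "x \<noteq> y" unfolding x_def y_def using k by (intro neq) auto
  let ?L = "\<lambda>i. nbrs H (?f i) - C"
  have L: "3 \<le> card (?L i)" "?L i \<subseteq> \<Lambda> (?f i) - C" if "i < k" for i
    using A[OF pick[OF J[OF that]]] by auto
  have finN: "finite (nbrs H f)" for f by (rule finite_nbrs[OF unif])
  have "card (?L (k - 1)) \<noteq> 0" using L(1)[of "k - 1"] k by simp
  \<comment> \<open>\<open>z\<close> becomes the label of the last edge \<open>{x, y, z}\<close> of
    the even cycle.\<close>
  then obtain z where z: "z \<in> nbrs H \<gamma> - C" unfolding \<gamma>_def by (metis card.empty ex_in_conv)
  have z\<gamma>: "z \<noteq> x" "z \<noteq> y" using z by (auto simp: nbrs_def \<gamma>)
  define g1 where "g1 = {z, y}"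
  define g2 where "g2 = {z, x}"
  have g: "insert z (\<gamma> - {x}) = g1" "insert z (\<gamma> - {y}) = g2" using xy by (auto simp: \<gamma> g1_def g2_def)
  have p1: "nbrs H g1 \<subseteq> \<Lambda> \<gamma> \<and> 3 \<le> card (nbrs H g1 - C)" if "card (nbrs H g1) < d"
    using poor[OF \<gamma>A, of x z, unfolded g] z that \<gamma> by blast
  have p2: "nbrs H g2 \<subseteq> \<Lambda> \<gamma> \<and> 3 \<le> card (nbrs H g2 - C)" if "card (nbrs H g2) < d"
    using poor[OF \<gamma>A, of y z, unfolded g] z that \<gamma> by blast
  have zL: "z \<in> \<Lambda> \<gamma> - C" using z A[OF \<gamma>A] by blast
  \<comment> \<open>For a rich pair the new vertex is chosen at the very end; the dummy value
    \<open>z\<close> then keeps \<open>F\<close> small.\<close>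
  obtain w1 where w1: "w1 \<in> \<Lambda> \<gamma> - C" "card (nbrs H g1) < d \<longrightarrow> w1 \<in> nbrs H g1 - {x}"
    "\<not> card (nbrs H g1) < d \<longrightarrow> w1 = z"
  proof (cases "card (nbrs H g1) < d")
    case True
    obtain w where "w \<in> nbrs H g1 - C" "w \<notin> {x}" using fresh_element[of "{x}" "nbrs H g1 - C"] p1[OF True] by auto
    then show ?thesis using True p1 that[of w] by blast
  next
    case False
    then show ?thesis using that[of z] zL by blast
  qed
  obtain w2 where w2: "w2 \<in> \<Lambda> \<gamma> - C" "card (nbrs H g2) < d \<longrightarrow> w2 \<in> nbrs H g2 - {y, w1}"
    "\<not> card (nbrs H g2) < d \<longrightarrow> w2 = z"
  proof (cases "card (nbrs H g2) < d")
    case True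
    have "card {y, w1} < 3" by (simp add: card_insert_if)
    then obtain w where "w \<in> nbrs H g2 - C" "w \<notin> {y, w1}"
      using fresh_element[of "{y, w1}" "nbrs H g2 - C"] p2[OF True] by auto
    then show ?thesis using True p2 that[of w] by blast
  next
    case False
    then show ?thesis using that[of z] zL by blast
  qed
  define F where "F = {z, w1, w2}"
  have F: "F \<subseteq> \<Lambda> \<gamma> - C" using zL w1 w2 by (auto simp: F_def)
  have notL: "\<phi> p \<notin> \<Lambda> \<gamma>" if "p \<in> {..<2} \<times> {..<m}" "p \<notin> ?J (k - 1)" for p
    using lab'[OF Jl, of p] that by (simp add: \<gamma>_def)
  \<comment> \<open>If \<open>z\<close> were a neighbour of pair 0 and \<open>{z, x}\<close> is
    poor, then \<open>\<phi> (1, 0)\<close> would be a neighbour of \<open>{z, x}\<close> and hence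
    a label of \<gamma>, against genericity. So at most two elements of \<open>F\<close> matter for
    edge 0: either \<open>z\<close> is absent from its list or \<open>w2 = z\<close>.\<close>
  have z0: "z \<notin> nbrs H (?f 0)" if "card (nbrs H g2) < d"
  proof
    assume "z \<in> nbrs H (?f 0)"
    then have "insert (\<phi> (1, 0)) g2 \<in> H" "z \<noteq> \<phi> (1, 0)"
      by (auto simp: nbrs_def J0 x_def g2_def insert_commute)
    moreover have "\<phi> (1, 0) \<noteq> x" unfolding x_def using k by (intro neq[symmetric]) auto
    ultimately have "\<phi> (1, 0) \<in> \<Lambda> \<gamma>" using p2[OF that] by (auto simp: nbrs_def g2_def)
    then show False using notL[of "(1, 0)", unfolded Jlast] k by simp
  qed
  have z2: "z \<notin> nbrs H (?f (k - 2))" if "card (nbrs H g1) < d"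
  proof
    assume "z \<in> nbrs H (?f (k - 2))"
    then have "insert (\<phi> (0, k - 3)) g1 \<in> H" "z \<noteq> \<phi> (0, k - 3)"
      by (auto simp: nbrs_def J2 y_def g1_def insert_commute)
    moreover have "\<phi> (0, k - 3) \<noteq> y" unfolding y_def using k by (intro neq) auto
    ultimately have "\<phi> (0, k - 3) \<in> \<Lambda> \<gamma>" using p1[OF that] by (auto simp: nbrs_def g1_def)
    then show False using notL[of "(0, k - 3)", unfolded Jlast] k by simp
  qed
  have ne0: "?L 0 - F \<noteq> {}"
  proof -
    have "\<exists>w\<in>?L 0. w \<notin> (if card (nbrs H g2) < d then {w1, w2} else {z, w1})"
      by (rule fresh_element) (use L(1)[of 0] k in \<open>auto simp: card_insert_if\<close>)
    then show ?thesis using z0 w2 by (auto simp: F_def split: if_splits)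
  qed
  have ne2: "?L (k - 2) - F \<noteq> {}"
  proof -
    have "\<exists>w\<in>?L (k - 2). w \<notin> (if card (nbrs H g1) < d then {w1, w2} else {z, w2})"
      by (rule fresh_element) (use L(1)[of "k - 2"] k in \<open>auto simp: card_insert_if\<close>)
    then show ?thesis using z2 w1 by (auto simp: F_def split: if_splits)
  qed
  \<comment> \<open>Apart from the last edge, only its neighbours 0 and k - 2 can have labels in
    \<open>F\<close>. Edge k - 2 is labelled first; the others form a path starting at edge 0, where
    one available label is enough.\<close>
  then obtain cE where cE: "cE \<in> ?L (k - 2)" "cE \<notin> F" by blast
  have Jdis: "?J i \<inter> ?J j = {}" if "i < j" "j < k" "j \<noteq> Suc i" "\<not> (i = 0 \<and> Suc j = k)" for i j
    using sel_selector_Int[OF pr _ that(1,2), of 0] that k by auto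
  have Ldis: "\<Lambda> (?f i) \<inter> \<Lambda> (?f j) \<subseteq> C" if "i < j" "j < k" "j \<noteq> Suc i" "\<not> (i = 0 \<and> Suc j = k)" for i j
    using that by (intro dis J Jdis) auto
  let ?M = "\<lambda>i. ?L i - F - {cE}"
  have "\<exists>c. (\<forall>i<k - 2. c i \<in> ?M i) \<and> (\<forall>i. Suc i < k - 2 \<longrightarrow> c i \<noteq> c (Suc i))"
  proof (rule path_list_colouring)
    have "\<Lambda> (?f 0) \<inter> \<Lambda> (?f (k - 2)) \<subseteq> C" using k by (intro Ldis) auto
    then have "cE \<notin> ?L 0" using cE(1) L(2)[of 0] L(2)[of "k - 2"] k by auto
    then show "?M 0 \<noteq> {}" using ne0 by blast
  next
    fix i assume i: "0 < i" "i < k - 2"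
    have "\<Lambda> (?f i) \<inter> \<Lambda> \<gamma> \<subseteq> C" unfolding \<gamma>_def using i k by (intro Ldis) auto
    then have "?L i \<inter> F = {}" using F L(2)[of i] i by fastforce
    then have M: "?M i = ?L i - {cE}" by blast
    have "i < k" using i by linarith
    then have "3 \<le> card (?L i)" by (rule L(1))
    then show "2 \<le> card (?M i)" unfolding M using finN[of "?f i"] by (auto simp: card_Diff_singleton_if)
  qed
  then obtain c0 where c0: "\<And>i. i < k - 2 \<Longrightarrow> c0 i \<in> ?M i" "\<And>i. Suc i < k - 2 \<Longrightarrow> c0 i \<noteq> c0 (Suc i)" by blast
  define c where "c i = (if i < k - 2 then c0 i else if i = k - 2 then cE else z)" for i
  have ck: "c (k - 1) = z" "c (k - 2) = cE" using k by (auto simp: c_def)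
  have cL: "c i \<in> ?L i" if "i < k" for i
  proof -
    consider "i < k - 2" | "i = k - 2" | "i = k - 1" using \<open>i < k\<close> by linarith
    then show ?thesis
    proof cases
      case 1
      then show ?thesis using c0(1)[of i] by (simp add: c_def)
    next
      case 2
      then show ?thesis using cE(1) ck by simp
    next
      case 3
      then show ?thesis using z ck by (simp add: \<gamma>_def)
    qed
  qed
  have cF: "c i \<notin> F" if "i < k - 1" for i
  proof (cases "i < k - 2")
    case True
    then show ?thesis using c0(1)[of i] by (simp add: c_def)
  next
    case False
    then have "i = k - 2" using that by linarith
    then show ?thesis using cE(2) ck by simp
  qed
  have zF: "z \<in> F" by (simp add: F_def)
  have adj: "c i \<noteq> c (Suc i)" if "Suc i < k" for i
  proof -
    consider "Suc i < k - 2" | "Suc i = k - 2" | "Suc i = k - 1" using \<open>Suc i < k\<close> by linarith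
    then show ?thesis
    proof cases
      case 1
      then show ?thesis using c0(2)[of i] by (simp add: c_def)
    next
      case 2
      then show ?thesis using c0(1)[of i] ck by (auto simp: c_def)
    next
      case 3
      then show ?thesis using cF[of i] zF ck by auto
    qed
  qed
  have "c 0 \<notin> F" by (rule cF) (use k in simp)
  then have adj0: "c 0 \<noteq> c (k - 1)" unfolding ck(1) using zF by blast
  define E where "E i = insert (c i) (?f i)" for i
  have AL: "nbrs H f \<subseteq> \<Lambda> f" if "f \<in> A" for f using A[OF that] by blast
  note gc0 = generic_cycle[OF gen order_refl disjI1[OF k(2)] k(1,3) AL cL adj adj0]
  have gc: "loose True k (\<lambda>i. E i)" "\<And>i. i < k \<Longrightarrow> E i \<in> H" "\<And>i. i < k \<Longrightarrow> E i \<inter> B = {}"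
    unfolding E_def by (rule gc0; assumption)+
  define W where "W = (\<Union>i<k. E i)"
  have cW: "finite W" "card W \<le> 3 * k"
  proof -
    have "finite (E i)" "card (E i) = 3" if "i < k" for i using uniform_edge[OF unif gc(2)[OF that]] by auto
    then show "finite W" unfolding W_def by blast
    have "card W \<le> (\<Sum>i<k. card (E i))" unfolding W_def by (intro card_UN_le) auto
    also have "\<dots> = (\<Sum>i<k. 3)" by (intro sum.cong) (use \<open>\<And>i. i < k \<Longrightarrow> card (E i) = 3\<close> in auto)
    finally show "card W \<le> 3 * k" by simp
  qed
  have FW: "w \<notin> W \<union> B" if "w \<in> F" "w \<noteq> x" "w \<noteq> y" "w \<noteq> z" for w
  proof -
    have "w \<noteq> \<phi> p" if p: "p \<in> {..<2} \<times> {..<m}" for p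
    proof (cases "p \<in> ?J (k - 1)")
      case True
      then show ?thesis using \<open>w \<noteq> x\<close> \<open>w \<noteq> y\<close> unfolding Jlast by (auto simp: x_def y_def)
    next
      case False
      then show ?thesis using notL[OF p] F \<open>w \<in> F\<close> by blast
    qed
    then have "w \<notin> ?f i" if "i < k" for i using sels_subset[OF J[OF that]] by blast
    moreover have "w \<noteq> c i" if "i < k" for i
    proof (cases "i = k - 1")
      case True
      then show ?thesis using \<open>w \<noteq> z\<close> ck by simp
    next
      case False
      then have "i < k - 1" using \<open>i < k\<close> by linarith
      then show ?thesis using cF[of i] \<open>w \<in> F\<close> by blast
    qed
    ultimately have "w \<notin> W" by (auto simp: W_def E_def)
    moreover have "w \<notin> B" using F \<open>w \<in> F\<close> lab[OF Jl] by (auto simp: \<gamma>_def)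
    ultimately show ?thesis by blast
  qed
  \<comment> \<open>A rich pair has more neighbours than \<open>B\<close>, the even cycle and one
    further vertex together.\<close>
  have cBW: "card (insert w (B \<union> W)) < d" "finite (insert w (B \<union> W))" for w
  proof -
    have "card (insert w (B \<union> W)) \<le> Suc (card (B \<union> W))" by (rule card_insert_le_m1) auto
    also have "\<dots> \<le> Suc (card B + card W)" using card_Un_le by simp
    also have "\<dots> < d" using B(2) cW(2) k(4) by simp
    finally show "card (insert w (B \<union> W)) < d" .
    show "finite (insert w (B \<union> W))" using B(1) cW(1) by simp
  qed
  obtain v1 where v1: "v1 \<in> nbrs H g1" "v1 \<notin> B \<union> W" "card (nbrs H g1) < d \<longrightarrow> v1 = w1"
    "\<not> card (nbrs H g1) < d \<longrightarrow> v1 \<noteq> w2"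
  proof (cases "card (nbrs H g1) < d")
    case True
    then have "w1 \<in> nbrs H g1" "w1 \<noteq> x" "w1 \<noteq> y" "w1 \<noteq> z" using w1 by (auto simp: nbrs_def g1_def)
    then show ?thesis using FW[of w1] that[of w1] True by (auto simp: F_def)
  next
    case False
    then obtain w where "w \<in> nbrs H g1" "w \<notin> insert w2 (B \<union> W)"
      using fresh_element[OF cBW(2)[of w2], of "nbrs H g1"] cBW(1)[of w2] by auto
    then show ?thesis using that[of w] False by blast
  qed
  obtain v2 where v2: "v2 \<in> nbrs H g2" "v2 \<notin> B \<union> W" "v2 \<noteq> v1"
  proof (cases "card (nbrs H g2) < d")
    case True
    then have "w2 \<in> nbrs H g2" "w2 \<noteq> x" "w2 \<noteq> y" "w2 \<noteq> z" "w2 \<noteq> w1" using w2 by (auto simp: nbrs_def g2_def)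
    moreover have "w2 \<noteq> v1" using v1 \<open>w2 \<noteq> w1\<close> by blast
    ultimately show ?thesis using FW[of w2] that[of w2] by (auto simp: F_def)
  next
    case False
    then obtain w where "w \<in> nbrs H g2" "w \<notin> insert v1 (B \<union> W)"
      using fresh_element[OF cBW(2)[of v1], of "nbrs H g2"] cBW(1)[of v1] by auto
    then show ?thesis using that[of w] by blast
  qed
  let ?E = "\<lambda>i. if i < k - 1 then E i else if i = k - 1 then {v1, y, z} else {v2, x, z}"
  have "loose True (Suc k) ?E"
  proof (rule loose_split[OF gc(1) k(1)])
    show "E (k - 1) = {x, y, z}" using ck \<gamma> by (auto simp: E_def \<gamma>_def)
    show "x \<in> E 0" unfolding E_def J0 x_def by simp
    show "y \<in> E (k - 2)" unfolding E_def J2 y_def by simp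
    show "v1 \<notin> E i \<and> v2 \<notin> E i" if "i < k" for i using v1(2) v2(2) that by (auto simp: W_def)
  qed (use xy z\<gamma> v2 in auto)
  moreover have "{v1, y, z} \<in> H" "{v2, x, z} \<in> H" using v1(1) v2(1)
    by (auto simp: nbrs_def g1_def g2_def insert_commute)
  moreover have "{x, y, z} \<inter> B = {}"
    using gc(3)[of "k - 1"] k ck \<gamma> by (auto simp: E_def \<gamma>_def)
  ultimately have "?E i \<in> H \<and> ?E i \<inter> B = {}" if "i < l" for i
    using gc(2)[of i] gc(3)[of i] v1(2) v2(2) by auto
  with \<open>loose True (Suc k) ?E\<close> show ?thesis unfolding k(4) by (intro exI[of _ ?E]) auto
qed

section \<open>Sets of bounded codegree\<close>

lemma disjoint_pieces:
  assumes "finite I" "finite C" "sum sz I \<le> card C"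
  shows "\<exists>D. (\<forall>i\<in>I. D i \<subseteq> C \<and> card (D i) = sz i) \<and> (\<forall>i\<in>I. \<forall>j\<in>I. i \<noteq> j \<longrightarrow> D i \<inter> D j = {})"
  using assms
proof (induction I arbitrary: C rule: finite_induct)
  case empty
  then show ?case by simp
next
  case (insert k I)
  have "sz k \<le> card C" using insert by simp
  then obtain K where K: "K \<subseteq> C" "card K = sz k" using obtain_subset_with_card_n by blast
  have "card (C - K) = card C - sz k" using K insert.prems by (metis card_Diff_subset finite_subset)
  then have "sum sz I \<le> card (C - K)" using insert by simp
  from insert.IH[OF _ this] insert.prems obtain D where
    D: "\<forall>i\<in>I. D i \<subseteq> C - K \<and> card (D i) = sz i" "\<forall>i\<in>I. \<forall>j\<in>I. i \<noteq> j \<longrightarrow> D i \<inter> D j = {}" by auto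
  show ?case
  proof (intro exI[of _ "D(k := K)"] conjI ballI impI)
    fix i j assume "i \<in> insert k I" "j \<in> insert k I" "i \<noteq> j"
    then show "(D(k := K)) i \<inter> (D(k := K)) j = {}"
      using D(1)[rule_format, of i] D(1)[rule_format, of j] D(2) by (cases "i = k"; cases "j = k") auto
  next
    fix i assume "i \<in> insert k I"
    then show "(D(k := K)) i \<subseteq> C" "card ((D(k := K)) i) = sz i"
      using D(1)[rule_format, of i] K by (cases "i = k"; auto)+
  qed
qed

text \<open>The case of many common neighbours. The deficit \<open>t + 1 - card C\<close> is at most
  two and is borne by the single component \<open>i1\<close>; all others take their covering
  vertices from \<open>C\<close>. \<open>C0\<close> is arbitrary because \<open>few_poor\<close>
  applies this to all large subsets of its own common set.\<close>

lemma few_poor_with_common_nbrs: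
  fixes I :: "'i set" and l :: "'i \<Rightarrow> nat" and \<delta> :: real
  assumes I: "finite I" "I \<noteq> {}" and l: "\<forall>i\<in>I. 5 \<le> l i" and r: "3 \<le> r"
    and t: "Suc t = (\<Sum>i\<in>I. (l i + 1) div 2)" and \<delta>: "\<delta> > 0"
  shows "\<exists>n0. \<forall>(V :: 'a set) H C0. uniform r V H \<longrightarrow> full (Suc t) H \<longrightarrow> \<not> has_system cyc I l H \<longrightarrow>
     n0 \<le> card V \<longrightarrow> finite C0 \<longrightarrow> t \<le> Suc (card C0) \<longrightarrow>
     real (card {f \<in> shadow H. card (nbrs H f) < d \<and> C0 \<subseteq> nbrs H f}) < \<delta> * real (card V) ^ (r - 1)"
proof -
  define q where "q = r - 1"
  have q: "2 \<le> q" "1 \<le> q" using r by (auto simp: q_def)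
  define m where "m = Suc (sum l I)"
  have lm: "Suc (l i) \<le> m" if "i \<in> I" for i using member_le_sum[OF that, of l] I by (simp add: m_def)
  obtain i1 where i1: "i1 \<in> I" using I by blast
  have m2: "2 \<le> m" using lm[OF i1] l[rule_format, OF i1] by simp
  then have m1: "1 \<le> m" by simp
  define b where "b = r * sum l I"
  from generic_structure[OF q(2) m1 \<delta>, of d b, where 'a = 'a] obtain n0 c0 where
   n0: "\<forall>(V :: 'a set) A \<Lambda>. finite V \<longrightarrow> n0 \<le> card V \<longrightarrow>
     A \<subseteq> {f. f \<subseteq> V \<and> card f = q} \<longrightarrow> \<delta> * real (card V) ^ q \<le> real (card A) \<longrightarrow>
     (\<forall>f\<in>A. finite (\<Lambda> f) \<and> card (\<Lambda> f) \<le> d) \<longrightarrow>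
     (\<exists>A' C. A' \<subseteq> A \<and> finite C \<and> card C \<le> d \<and> (\<forall>f\<in>A'. C \<subseteq> \<Lambda> f) \<and> c0 * real (card V) ^ q \<le> real (card A') \<and>
       robustly_generic q m b A' \<Lambda> C)"
    by (elim exE conjE)
  show ?thesis
  proof (intro exI[of _ n0] allI impI, rule ccontr)
    fix V :: "'a set" and H C0
    assume unif: "uniform r V H" and full: "full (Suc t) H" and nosys: "\<not> has_system cyc I l H"
      and n: "n0 \<le> card V" and C0: "finite C0" "t \<le> Suc (card C0)"
      and ge: "\<not> real (card {f \<in> shadow H. card (nbrs H f) < d \<and> C0 \<subseteq> nbrs H f}) < \<delta> * real (card V) ^ (r - 1)"
    define A where "A = {f \<in> shadow H. card (nbrs H f) < d \<and> C0 \<subseteq> nbrs H f}"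
    have finN: "finite (nbrs H f)" for f by (rule finite_nbrs[OF unif])
    have "\<exists>A' C. A' \<subseteq> A \<and> finite C \<and> card C \<le> d \<and> (\<forall>f\<in>A'. C \<subseteq> nbrs H f) \<and>
       c0 * real (card V) ^ q \<le> real (card A') \<and> robustly_generic q m b A' (nbrs H) C"
    proof (rule n0[rule_format, OF _ n])
      show "finite V" using unif by (simp add: uniform_def)
      show "A \<subseteq> {f. f \<subseteq> V \<and> card f = q}" using shadow_edge[OF unif] by (auto simp: A_def q_def)
      show "\<delta> * real (card V) ^ q \<le> real (card A)" using ge by (simp add: A_def q_def)
      show "finite (nbrs H f) \<and> card (nbrs H f) \<le> d" if "f \<in> A" for f using that finN by (auto simp: A_def)
    qed
    then obtain A' C where A': "A' \<subseteq> A" and C: "finite C" "\<forall>f\<in>A'. C \<subseteq> nbrs H f"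
      and gen': "robustly_generic q m b A' (nbrs H) C" by blast
    have gen: "\<exists>\<phi>. generic q m A' (nbrs H) C (B \<union> C) \<phi>" if "finite B" "card B \<le> b" for B
      using gen' that unfolding robustly_generic_def by auto
    \<comment> \<open>Two disjoint selections both have all of \<open>C0\<close> as neighbours, and
      genericity lets them share elements of \<open>C\<close> only.\<close>
    have "C0 \<subseteq> C"
    proof -
      obtain \<phi> where \<phi>: "generic q m A' (nbrs H) C ({} \<union> C) \<phi>" using gen[of "{}"] by auto
      let ?J0 = "sel q (\<lambda>_. 0)" and ?J1 = "sel q (\<lambda>_. 1)"
      have J: "?J0 \<in> sels q m" "?J1 \<in> sels q m" "?J0 \<inter> ?J1 = {}"
        using m2 unfolding sels_def sel_Int by fastforce+
      then have "nbrs H (\<phi> ` ?J0) \<inter> nbrs H (\<phi> ` ?J1) \<subseteq> C" "\<phi> ` ?J0 \<in> A'" "\<phi> ` ?J1 \<in> A'"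
        using \<phi> unfolding generic_def by blast+
      then show ?thesis using A' by (auto simp: A_def)
    qed
    from card_mono[OF C(1) this] have cC: "t \<le> Suc (card C)" using C0(2) by simp
    \<comment> \<open>Truncated subtraction: nothing is missing once \<open>C\<close> has
      \<open>t + 1\<close> elements.\<close>
    define j where "j = Suc t - card C"
    have j2: "j \<le> 2" using cC by (simp add: j_def)
    define sz where "sz i = (l i + 1) div 2 - (if i = i1 then j else 0)" for i
    have "sum sz I + j = Suc t"
    proof -
      have "sum sz I + j = (\<Sum>i\<in>I. sz i + (if i = i1 then j else 0))"
        using I i1 by (simp add: sum.distrib)
      also have "\<dots> = (\<Sum>i\<in>I. (l i + 1) div 2)"
        using l[rule_format, OF i1] j2 by (intro sum.cong) (auto simp: sz_def)
      finally show ?thesis using t by simp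
    qed
    then have "sum sz I \<le> card C" by (auto simp: j_def)
    from disjoint_pieces[OF I(1) C(1) this] obtain D where
      D: "\<And>i. i \<in> I \<Longrightarrow> D i \<subseteq> C \<and> card (D i) = sz i" "\<And>i j. i \<in> I \<Longrightarrow> j \<in> I \<Longrightarrow> i \<noteq> j \<Longrightarrow> D i \<inter> D j = {}"
      by blast
    have cN: "j \<le> card (nbrs H f - C)" "C \<subseteq> nbrs H f" if "f \<in> A'" for f
    proof -
      have "Suc t \<le> card (nbrs H f)" using that A' full by (auto simp: A_def full_def)
      then show "C \<subseteq> nbrs H f" "j \<le> card (nbrs H f - C)"
        using C that by (auto simp: card_Diff_subset j_def)
    qed
    have "has_system cyc I l H"
    proof (rule has_systemI[where C = C and D = D and r = r and b = b])
      fix i and B :: "'a set" assume i: "i \<in> I" and B: "finite B" "card B \<le> b"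
      obtain \<phi> where \<phi>: "generic q m A' (nbrs H) C (B \<union> C) \<phi>" using gen[OF B] by blast
      show "\<exists>E. loose cyc (l i) E \<and> (\<forall>j<l i. E j \<in> H \<and> E j \<inter> (B \<union> C) \<subseteq> D i)"
      proof (rule few_component[OF \<phi> q(1) l[rule_format, OF i] lm[OF i], where j = "if i = i1 then j else 0"])
        show "finite (D i)" using D(1)[OF i] C(1) finite_subset by blast
      qed (use cN D(1)[OF i] j2 in \<open>auto simp: sz_def\<close>)
    qed (use D I uniform_edge[OF unif] b_def in auto)
    then show False using nosys by blast
  qed
qed

text \<open>The case of few common neighbours. Members of the family for which they, or a poor set
  one exchange away, have \<open>t - 1\<close> neighbours in \<open>C\<close> are rare by the
  preceding lemma. Deleting them leaves at least half of the family, and all relevant poor sets then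
  have three neighbours outside \<open>C\<close>.\<close>

lemma few_poor:
  fixes I :: "'i set" and l :: "'i \<Rightarrow> nat" and \<delta> :: real
  assumes I: "finite I" "I \<noteq> {}" and l: "\<forall>i\<in>I. 5 \<le> l i" and r: "3 \<le> r"
    and t: "Suc t = (\<Sum>i\<in>I. (l i + 1) div 2)" and \<delta>: "\<delta> > 0"
    and d: "r * sum l I + 3 * (sum l I + 1) + 2 \<le> d"
  shows "\<exists>n0. \<forall>(V :: 'a set) H. uniform r V H \<longrightarrow> full (Suc t) H \<longrightarrow> \<not> has_system cyc I l H \<longrightarrow>
     n0 \<le> card V \<longrightarrow> real (card {f \<in> shadow H. card (nbrs H f) < d}) < \<delta> * real (card V) ^ (r - 1)"
proof -
  define q where "q = r - 1"
  have q: "2 \<le> q" "1 \<le> q" using r by (auto simp: q_def)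
  define m where "m = Suc (sum l I)"
  have lm: "Suc (l i) \<le> m" if "i \<in> I" for i using member_le_sum[OF that, of l] I by (simp add: m_def)
  have m1: "1 \<le> m" by (simp add: m_def)
  \<comment> \<open>At most d neighbours of f, and up to d further labels for each of at most d
    vertices v and q vertices x.\<close>
  define b where "b = d + d * (q * d)"
  define \<beta> where "\<beta> = r * sum l I"
  from generic_structure[OF q(2) m1 \<delta>, of b \<beta>, where 'a = 'a] obtain n1 c0 where c0: "c0 > 0" and
   n1: "\<forall>(V :: 'a set) A \<Lambda>. finite V \<longrightarrow> n1 \<le> card V \<longrightarrow>
     A \<subseteq> {f. f \<subseteq> V \<and> card f = q} \<longrightarrow> \<delta> * real (card V) ^ q \<le> real (card A) \<longrightarrow>
     (\<forall>f\<in>A. finite (\<Lambda> f) \<and> card (\<Lambda> f) \<le> b) \<longrightarrow>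
     (\<exists>A' C. A' \<subseteq> A \<and> finite C \<and> card C \<le> b \<and> (\<forall>f\<in>A'. C \<subseteq> \<Lambda> f) \<and> c0 * real (card V) ^ q \<le> real (card A') \<and>
       robustly_generic q m \<beta> A' \<Lambda> C)"
    by (elim exE conjE)
  \<comment> \<open>\<open>C\<close> has at most \<open>2 ^ b\<close> subsets, and a poor set spoils
    at most \<open>1 + d * q\<close> members: itself and those one exchange away. \<delta>1 can be
    fitted to this since \<open>c0\<close> is already known.\<close>
  define K where "K = real (2 ^ b) * real (1 + d * q)"
  have K: "K > 0" unfolding K_def of_nat_mult[symmetric] of_nat_0_less_iff by simp
  define \<delta>1 where "\<delta>1 = c0 / (2 * K)"
  have \<delta>1: "\<delta>1 > 0" using c0 K by (simp add: \<delta>1_def)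
  from few_poor_with_common_nbrs[OF I l r t \<delta>1, where 'a = 'a and cyc = cyc and d = d] obtain n2 where
    n2: "\<forall>(V :: 'a set) H C0. uniform r V H \<longrightarrow> full (Suc t) H \<longrightarrow> \<not> has_system cyc I l H \<longrightarrow>
     n2 \<le> card V \<longrightarrow> finite C0 \<longrightarrow> t \<le> Suc (card C0) \<longrightarrow>
     real (card {f \<in> shadow H. card (nbrs H f) < d \<and> C0 \<subseteq> nbrs H f}) < \<delta>1 * real (card V) ^ (r - 1)"
    by (elim exE)
  show ?thesis
  proof (intro exI[of _ "max n1 n2"] allI impI, rule ccontr)
    fix V :: "'a set" and H
    assume unif: "uniform r V H" and full: "full (Suc t) H" and nosys: "\<not> has_system cyc I l H"
      and n: "max n1 n2 \<le> card V"
      and ge: "\<not> real (card {f \<in> shadow H. card (nbrs H f) < d}) < \<delta> * real (card V) ^ (r - 1)"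
    define N where "N = real (card V) ^ q"
    have N: "N \<ge> 0" by (simp add: N_def)
    define A where "A = {f \<in> shadow H. card (nbrs H f) < d}"
    define Mp where "Mp g = (if card (nbrs H g) < d then nbrs H g else {})" for g
    define \<Lambda> where "\<Lambda> f = nbrs H f \<union> (\<Union>v\<in>nbrs H f. \<Union>x\<in>f. Mp (insert v (f - {x})))" for f
    have finN: "finite (nbrs H f)" for f by (rule finite_nbrs[OF unif])
    have Mp: "finite (Mp g)" "card (Mp g) \<le> d" for g using finN by (auto simp: Mp_def)
    have sh: "finite f" "card f = q" "f \<subseteq> V" if "f \<in> shadow H" for f
      using shadow_edge[OF unif that] by (auto simp: q_def)
    have \<Lambda>: "finite (\<Lambda> f) \<and> card (\<Lambda> f) \<le> b" if f: "f \<in> A" for f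
    proof
      have f': "finite f" "card f = q" "card (nbrs H f) \<le> d" using f sh by (auto simp: A_def)
      show "finite (\<Lambda> f)" using finN Mp f' by (auto simp: \<Lambda>_def)
      have "card (\<Union>v\<in>nbrs H f. \<Union>x\<in>f. Mp (insert v (f - {x}))) \<le>
          (\<Sum>v\<in>nbrs H f. card (\<Union>x\<in>f. Mp (insert v (f - {x}))))" by (rule card_UN_le[OF finN])
      also have "\<dots> \<le> (\<Sum>v\<in>nbrs H f. q * d)"
      proof (rule sum_mono)
        fix v
        have "card (\<Union>x\<in>f. Mp (insert v (f - {x}))) \<le> (\<Sum>x\<in>f. card (Mp (insert v (f - {x}))))"
          by (rule card_UN_le[OF f'(1)])
        also have "\<dots> \<le> (\<Sum>x\<in>f. d)" by (intro sum_mono Mp)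
        finally show "card (\<Union>x\<in>f. Mp (insert v (f - {x}))) \<le> q * d" using f' by simp
      qed
      also have "\<dots> \<le> d * (q * d)" using f'(3) by simp
      finally show "card (\<Lambda> f) \<le> b" unfolding \<Lambda>_def b_def
        using f'(3) card_Un_le[of "nbrs H f" "\<Union>v\<in>nbrs H f. \<Union>x\<in>f. Mp (insert v (f - {x}))"] by linarith
    qed
    have "\<exists>A' C. A' \<subseteq> A \<and> finite C \<and> card C \<le> b \<and> (\<forall>f\<in>A'. C \<subseteq> \<Lambda> f) \<and>
       c0 * real (card V) ^ q \<le> real (card A') \<and> robustly_generic q m \<beta> A' \<Lambda> C"
    proof (rule n1[rule_format])
      show "finite V" using unif by (simp add: uniform_def)
      show "n1 \<le> card V" using n by simp
      show "A \<subseteq> {f. f \<subseteq> V \<and> card f = q}" using sh by (auto simp: A_def)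
      show "\<delta> * real (card V) ^ q \<le> real (card A)" using ge by (simp add: A_def q_def)
    qed (rule \<Lambda>)
    then obtain A' C where A': "A' \<subseteq> A" and C: "finite C" "card C \<le> b"
      and cA': "c0 * N \<le> real (card A')" and gen': "robustly_generic q m \<beta> A' \<Lambda> C" unfolding N_def by blast
    define bad where "bad = {f \<in> A'. \<exists>g\<in>shadow H. card (nbrs H g) < d \<and> t \<le> Suc (card (C \<inter> nbrs H g)) \<and>
        (g = f \<or> (\<exists>x\<in>f. \<exists>z\<in>nbrs H f. g = insert z (f - {x})))}"
    define G where "G C0 = {g \<in> shadow H. card (nbrs H g) < d \<and> C0 \<subseteq> nbrs H g}" for C0
    \<comment> \<open>Exchanges are reversible: if g replaces x in f by z, then x is one of the
      fewer than d neighbours of g, and replacing z by x recovers f.\<close>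
    define R where "R g = insert g ((\<lambda>(x, z). insert x (g - {z})) ` (nbrs H g \<times> g))" for g
    have finG: "finite (G C0)" for C0 using finite_shadow[OF unif] by (simp add: G_def)
    have badsub: "bad \<subseteq> (\<Union>C0\<in>{C0 \<in> Pow C. t \<le> Suc (card C0)}. \<Union>g\<in>G C0. R g)"
    proof
      fix f assume "f \<in> bad"
      then obtain g where g: "g \<in> shadow H" "card (nbrs H g) < d" "t \<le> Suc (card (C \<inter> nbrs H g))"
        "g = f \<or> (\<exists>x\<in>f. \<exists>z\<in>nbrs H f. g = insert z (f - {x}))" by (auto simp: bad_def)
      have "f \<in> R g"
      proof (cases "g = f")
        case True
        then show ?thesis by (simp add: R_def)
      next
        case False
        then obtain x z where xz: "x \<in> f" "z \<in> nbrs H f" "g = insert z (f - {x})" using g by blast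
        have zf: "z \<notin> f" "insert z f \<in> H" using xz by (auto simp: nbrs_def)
        have "insert x g = insert z f" "x \<notin> g" using xz zf by auto
        then have "x \<in> nbrs H g" "z \<in> g" using zf xz(3) by (simp_all add: nbrs_def)
        then have "insert x (g - {z}) \<in> R g"
          unfolding R_def by (intro insertI2 image_eqI[of _ _ "(x, z)"]) simp_all
        moreover have "f = insert x (g - {z})" using xz zf by auto
        ultimately show ?thesis by (simp only:)
      qed
      then show "f \<in> (\<Union>C0\<in>{C0 \<in> Pow C. t \<le> Suc (card C0)}. \<Union>g\<in>G C0. R g)"
        using g by (intro UN_I[of "C \<inter> nbrs H g"] UN_I[of g]) (auto simp: G_def)
    qed
    have "real (card bad) \<le> real (card (\<Union>C0\<in>{C0 \<in> Pow C. t \<le> Suc (card C0)}. \<Union>g\<in>G C0. R g))"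
    proof (unfold of_nat_le_iff, rule card_mono[OF _ badsub])
      show "finite (\<Union>C0\<in>{C0 \<in> Pow C. t \<le> Suc (card C0)}. \<Union>g\<in>G C0. R g)"
        using C finG sh finN by (auto simp: R_def G_def)
    qed
    also have "\<dots> \<le> real (2 ^ b) * (\<delta>1 * N * real (1 + d * q))"
    proof (rule card_UN_le_const)
      show "finite {C0 \<in> Pow C. t \<le> Suc (card C0)}" using C by simp
      have "card {C0 \<in> Pow C. t \<le> Suc (card C0)} \<le> card (Pow C)" using C by (intro card_mono) auto
      also have "\<dots> = 2 ^ card C" using C by (simp add: card_Pow)
      also have "\<dots> \<le> 2 ^ b" using C by simp
      finally show "card {C0 \<in> Pow C. t \<le> Suc (card C0)} \<le> 2 ^ b" .
      show "0 \<le> \<delta>1 * N * real (1 + d * q)" using \<delta>1 N by simp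
      fix C0 assume C0: "C0 \<in> {C0 \<in> Pow C. t \<le> Suc (card C0)}"
      have "real (card (\<Union>g\<in>G C0. R g)) \<le> real (card (G C0)) * real (1 + d * q)"
      proof (rule card_UN_le_const[OF finG _ order_refl])
        fix g assume g: "g \<in> G C0"
        then have g': "finite g" "card g = q" "card (nbrs H g) \<le> d" using sh by (auto simp: G_def)
        have "card (R g) \<le> Suc (card ((\<lambda>(x, z). insert x (g - {z})) ` (nbrs H g \<times> g)))"
          unfolding R_def by (rule card_insert_le_m1) auto
        also have "\<dots> \<le> Suc (card (nbrs H g \<times> g))" using finN g' by (intro Suc_le_mono[THEN iffD2] card_image_le) auto
        also have "\<dots> \<le> 1 + d * q" using g' by (simp add: card_cartesian_product)
        finally show "real (card (R g)) \<le> real (1 + d * q)" by (simp only: of_nat_le_iff)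
      qed simp
      also have "\<dots> \<le> \<delta>1 * N * real (1 + d * q)"
      proof (rule mult_right_mono)
        have "finite C0" using C0 C finite_subset by blast
        then show "real (card (G C0)) \<le> \<delta>1 * N"
          using n2[rule_format, OF unif full nosys, of C0] n C0 unfolding G_def N_def q_def by simp
      qed simp
      finally show "real (card (\<Union>g\<in>G C0. R g)) \<le> \<delta>1 * N * real (1 + d * q)" .
    qed
    also have "\<dots> = \<delta>1 * K * N" by (simp add: K_def)
    also have "\<dots> = c0 * N / 2" using K by (simp add: \<delta>1_def)
    finally have cbad: "2 * card bad \<le> card A'" using cA' by linarith
    have finA': "finite A'" using A' finite_shadow[OF unif] by (auto simp: A_def intro: finite_subset)
    define A2 where "A2 = A' - bad"
    have "card A2 = card A' - card bad" unfolding A2_def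
      by (rule card_Diff_subset) (use finA' in \<open>auto simp: bad_def\<close>)
    then have A2c: "card A' \<le> 2 * card A2" using cbad by simp
    have gen: "\<exists>\<phi>. generic q m A2 \<Lambda> C (B \<union> C) \<phi>" if "finite B" "card B \<le> \<beta>" for B
      using gen' that A2c unfolding robustly_generic_def A2_def by blast
    have three: "3 \<le> card (nbrs H g - C)"
      if "f \<in> A2" "g \<in> shadow H" "card (nbrs H g) < d"
        "g = f \<or> (\<exists>x\<in>f. \<exists>z\<in>nbrs H f. g = insert z (f - {x}))" for f g
    proof -
      \<comment> \<open>At most \<open>t - 2\<close> of the at least \<open>t + 1\<close> neighbours
        lie in \<open>C\<close>.\<close>
      have "\<not> t \<le> Suc (card (C \<inter> nbrs H g))" using that by (auto simp: A2_def bad_def)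
      moreover have "Suc t \<le> card (nbrs H g)" using full that by (auto simp: full_def)
      moreover have "card (nbrs H g - C) = card (nbrs H g) - card (C \<inter> nbrs H g)"
        using finN C by (simp add: card_Diff_subset_Int Int_commute)
      ultimately show ?thesis by linarith
    qed
    have A2: "nbrs H f \<subseteq> \<Lambda> f \<and> 3 \<le> card (nbrs H f - C)" if "f \<in> A2" for f
      using three[OF that, of f] that A' by (auto simp: A2_def A_def \<Lambda>_def)
    have A2': "nbrs H (insert z (f - {x})) \<subseteq> \<Lambda> f \<and> 3 \<le> card (nbrs H (insert z (f - {x})) - C)"
      if "f \<in> A2" "x \<in> f" "z \<in> nbrs H f" "card (nbrs H (insert z (f - {x}))) < d" for f x z
    proof
      have "insert x (insert z (f - {x})) = insert z f" "x \<noteq> z" using that by (auto simp: nbrs_def)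
      then have "x \<in> nbrs H (insert z (f - {x}))" using that by (auto simp: nbrs_def)
      then have "insert z (f - {x}) \<in> shadow H" by (rule shadowI)
      then show "3 \<le> card (nbrs H (insert z (f - {x})) - C)" using that by (intro three) auto
      show "nbrs H (insert z (f - {x})) \<subseteq> \<Lambda> f" using that by (auto simp: \<Lambda>_def Mp_def)
    qed
    have cycle: "\<exists>E. loose True L E \<and> (\<forall>i<L. E i \<in> H \<and> E i \<inter> B = {})"
      if B: "finite B" "card B \<le> \<beta>" and L: "5 \<le> L" "L \<le> m" for L B
    proof -
      obtain \<phi> where \<phi>: "generic q m A2 \<Lambda> C (B \<union> C) \<phi>" using gen[OF B] by blast
      show ?thesis
      proof (cases "even L \<or> 3 \<le> q")
        case True
        then show ?thesis using L by (intro many_cycle[OF \<phi> q(1) True _ _ A2]) auto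
      next
        case False
        then have q2: "q = 2" "odd L" using q by auto
        have "r = 3" using q2(1) r unfolding q_def by linarith
        then have "uniform 3 V H" using unif by simp
        moreover have "card B + 3 * L + 2 \<le> d"
        proof (rule le_trans[OF _ d])
          show "card B + 3 * L + 2 \<le> r * sum l I + 3 * (sum l I + 1) + 2"
            using B(2) L(2) unfolding \<beta>_def m_def by (intro add_mono mult_le_mono) simp_all
        qed
        ultimately show ?thesis using L q2(2)
          by (intro many_odd_cycle[OF \<phi>[unfolded q2(1)] _ _ _ _ A2 A2' B(1)]) auto
      qed
    qed
    have "has_system cyc I l H"
    proof (rule has_systemI[where C = "{}" and D = "\<lambda>_. {}" and r = r and b = \<beta>])
      fix i and B :: "'a set" assume i: "i \<in> I" and B: "finite B" "card B \<le> \<beta>"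
      show "\<exists>E. loose cyc (l i) E \<and> (\<forall>j<l i. E j \<in> H \<and> E j \<inter> (B \<union> {}) \<subseteq> {})"
      proof (cases cyc)
        case True
        then show ?thesis using cycle[OF B l[rule_format, OF i]] lm[OF i] by auto
      next
        case False
        from cycle[OF B, of "Suc (l i)"] l[rule_format, OF i] lm[OF i] obtain E where
          "loose True (Suc (l i)) E" "\<forall>j<Suc (l i). E j \<in> H \<and> E j \<inter> B = {}" by auto
        then show ?thesis using False loose_path_of_cycle by (intro exI[of _ E]) auto
      qed
    qed (use I uniform_edge[OF unif] \<beta>_def in auto)
    then show False using nosys by blast
  qed
qed

section \<open>Counting cliques\<close>

text \<open>Turns bounds on cliques into bounds on edges.\<close>

lemma cliques_self: "uniform r V H \<Longrightarrow> cliques V r r H = H"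
proof
  assume u: "uniform r V H"
  then have fin: "finite V" by (simp add: uniform_def)
  show "cliques V r r H \<subseteq> H" by (auto simp: cliques_def)
  show "H \<subseteq> cliques V r r H"
  proof
    fix e assume e: "e \<in> H"
    have "e' = e" if "e' \<subseteq> e" "card e' = r" for e'
      using that uniform_edge[OF u e] card_subset_eq by metis
    then show "e \<in> cliques V r r H" using uniform_edge[OF u e] e by (auto simp: cliques_def)
  qed
qed

lemma cliques_empty: "r \<le> s \<Longrightarrow> cliques V r s {} = {}"
  unfolding cliques_def by (auto, metis obtain_subset_with_card_n)

lemma card_shadow_le:
  assumes unif: "uniform r V H"
  shows "card (shadow H) \<le> card V choose (r - 1)" and "card (shadow H) \<le> r * card H"
proof -
  have finV: "finite V" using unif by (simp add: uniform_def)
  have "card (shadow H) \<le> card {f. f \<subseteq> V \<and> card f = r - 1}"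
    using shadow_edge[OF unif] finV by (intro card_mono) auto
  then show "card (shadow H) \<le> card V choose (r - 1)" by (simp add: n_subsets[OF finV])
  have "shadow H = (\<lambda>(e, v). e - {v}) ` (SIGMA e:H. e)" by (auto simp: shadow_def image_iff)
  moreover have "finite (SIGMA e:H. e)"
    using uniform_finite[OF unif] uniform_edge[OF unif] by (intro finite_SigmaI) auto
  ultimately have "card (shadow H) \<le> card (SIGMA e:H. e)" by (simp only: card_image_le)
  also have "\<dots> = (\<Sum>e\<in>H. card e)"
    using uniform_finite[OF unif] uniform_edge[OF unif] by (simp add: card_SigmaI)
  also have "\<dots> = (\<Sum>e\<in>H. r)" using uniform_edge[OF unif] by (intro sum.cong) auto
  finally show "card (shadow H) \<le> r * card H" by (simp add: mult.commute)
qed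

lemma sum_card_nbrs_le:
  assumes unif: "uniform r V H"
  shows "(\<Sum>f\<in>shadow H. card (nbrs H f)) \<le> r * card H"
proof -
  have finN: "finite (nbrs H f)" for f by (rule finite_nbrs[OF unif])
  have "(\<Sum>f\<in>shadow H. card (nbrs H f)) = card (SIGMA f:shadow H. nbrs H f)"
    using finite_shadow[OF unif] finN by simp
  also have "\<dots> \<le> card (SIGMA e:H. e)"
  proof (rule card_inj_on_le[where f = "\<lambda>(f, v). (insert v f, v)"])
    show "inj_on (\<lambda>(f, v). (insert v f, v)) (SIGMA f:shadow H. nbrs H f)"
    proof (rule inj_onI, clarsimp)
      fix f f' v assume "insert v f = insert v f'" "v \<in> nbrs H f" "v \<in> nbrs H f'"
      then show "f = f'" by (auto simp: nbrs_def insert_ident)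
    qed
    show "finite (SIGMA e:H. e)" using uniform_finite[OF unif] uniform_edge[OF unif] by auto
  qed (auto simp: nbrs_def)
  also have "\<dots> = (\<Sum>e\<in>H. card e)"
    using uniform_finite[OF unif] uniform_edge[OF unif] by (simp add: card_SigmaI)
  also have "\<dots> = (\<Sum>e\<in>H. r)" using uniform_edge[OF unif] by (intro sum.cong) auto
  finally show ?thesis by (simp add: mult.commute)
qed

text \<open>Peeling at the threshold of the greedy embedding must remove everything. The order of
  magnitude is right and the constant poor, which is enough for the exceptional parts.\<close>

lemma cliques_le_shadow:
  assumes unif: "uniform r V H" and nosys: "\<not> has_system cyc I l H" and r: "3 \<le> r" "r \<le> s"
    and I: "finite I" "\<forall>i\<in>I. 5 \<le> l i"
  shows "card (cliques V r s H) \<le> (4 * r * (sum l I + 1) choose (s - r + 1)) * card (shadow H)"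
proof -
  have "1 \<le> r" using r by simp
  from peeling[OF unif this r(2), of "4 * r * (sum l I + 1)"] obtain H' where H': "H' \<subseteq> H"
    "full (Suc (4 * r * (sum l I + 1))) H'" "card (cliques V r s H) \<le> card (cliques V r s H') +
       (4 * r * (sum l I + 1) choose (s - r + 1)) * card (shadow H)" by blast
  have "H' = {}"
  proof (rule ccontr)
    assume "H' \<noteq> {}"
    have "has_system cyc I l H'"
      by (rule full_has_system[OF uniform_subset[OF unif H'(1)] H'(2) \<open>H' \<noteq> {}\<close> r(1) I(1)]) (use I(2) in fastforce)+
    then show False using nosys has_system_mono H'(1) by blast
  qed
  then show ?thesis using H'(3) cliques_empty[OF r(2), of V] by simp
qed

text \<open>A poor set lies in fewer than d edges, and poor sets are few. The other edges have a
  shadow of rich sets only, which is a small fraction of the whole shadow because codegrees sum to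
  at most r times the number of edges. The linear bound on edges is used twice: for all edges and
  for the others.\<close>

lemma full_few_edges:
  fixes I :: "'i set" and l :: "'i \<Rightarrow> nat" and \<epsilon> :: real
  assumes I: "finite I" "I \<noteq> {}" and l: "\<forall>i\<in>I. 5 \<le> l i" and r: "3 \<le> r"
    and t: "Suc t = (\<Sum>i\<in>I. (l i + 1) div 2)" and \<epsilon>: "\<epsilon> > 0"
  shows "\<exists>n0. \<forall>(V :: 'a set) H. uniform r V H \<longrightarrow> full (Suc t) H \<longrightarrow> \<not> has_system cyc I l H \<longrightarrow>
     n0 \<le> card V \<longrightarrow> real (card H) \<le> \<epsilon> * real (card V) ^ (r - 1)"
proof -
  define D where "D = 4 * r * (sum l I + 1)"
  \<comment> \<open>The first summands are required by \<open>few_poor\<close>; the last makes the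
    edges without a poor subset negligible.\<close>
  define d where "d = r * sum l I + 3 * (sum l I + 1) + 2 + nat \<lceil>2 * real r * real D ^ 2 / \<epsilon>\<rceil>"
  have d1: "r * sum l I + 3 * (sum l I + 1) + 2 \<le> d" by (simp add: d_def)
  have d0: "d > 0" by (simp add: d_def)
  have "2 * real r * real D ^ 2 / \<epsilon> \<le> real d" unfolding d_def by linarith
  then have d2: "real r * real D ^ 2 \<le> \<epsilon> / 2 * real d" using \<epsilon> by (simp add: field_simps)
  define \<delta> where "\<delta> = \<epsilon> / (2 * real d)"
  have \<delta>: "\<delta> > 0" using \<epsilon> d0 by (simp add: \<delta>_def)
  from few_poor[OF I l r t \<delta> d1, where 'a = 'a and cyc = cyc] obtain n0 where
    n0: "\<forall>(V :: 'a set) H. uniform r V H \<longrightarrow> full (Suc t) H \<longrightarrow> \<not> has_system cyc I l H \<longrightarrow>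
     n0 \<le> card V \<longrightarrow> real (card {f \<in> shadow H. card (nbrs H f) < d}) < \<delta> * real (card V) ^ (r - 1)"
    by (elim exE)
  show ?thesis
  proof (intro exI[of _ n0] allI impI)
    fix V :: "'a set" and H
    assume unif: "uniform r V H" and full: "full (Suc t) H" and nosys: "\<not> has_system cyc I l H"
      and n: "n0 \<le> card V"
    define N where "N = real (card V) ^ (r - 1)"
    have finN: "finite (nbrs H f)" for f by (rule finite_nbrs[OF unif])
    have edges: "card G \<le> D * card (shadow G)" if "G \<subseteq> H" for G
    proof -
      have u: "uniform r V G" by (rule uniform_subset[OF unif that])
      have "\<not> has_system cyc I l G" using nosys has_system_mono that by blast
      from cliques_le_shadow[OF u this r order_refl I(1) l] show ?thesis
        by (simp add: cliques_self[OF u] D_def)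
    qed
    have sN: "real (card (shadow H)) \<le> N"
    proof -
      have "card (shadow H) \<le> (card V choose (r - 1)) * fact (r - 1)"
        using card_shadow_le(1)[OF unif] by (rule le_trans) simp
      also have "\<dots> \<le> card V ^ (r - 1)" by (rule binomial_fact_pow)
      finally show ?thesis unfolding N_def by (metis of_nat_le_iff of_nat_power)
    qed
    define P where "P = {f \<in> shadow H. card (nbrs H f) < d}"
    have finP: "finite P" using finite_shadow[OF unif] by (simp add: P_def)
    have cP: "real (card P) < \<delta> * N" unfolding P_def N_def using n0 unif full nosys n by blast
    define G1 where "G1 = {e \<in> H. \<exists>f\<in>P. f \<subseteq> e}"
    have "G1 \<subseteq> (\<Union>f\<in>P. (\<lambda>v. insert v f) ` nbrs H f)"
    proof
      fix e assume "e \<in> G1"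
      then obtain f where f: "e \<in> H" "f \<in> P" "f \<subseteq> e" by (auto simp: G1_def)
      have e: "finite e" "card e = r" using uniform_edge[OF unif f(1)] by auto
      have "card f = r - 1" "finite f" using shadow_edge[OF unif, of f] f(2) by (auto simp: P_def)
      then have "card (e - f) = 1" using e f(3) r by (simp add: card_Diff_subset)
      then obtain v where "e - f = {v}" by (rule card_1_singletonE)
      then have v: "e = insert v f" "v \<notin> f" using f(3) by auto
      then have "v \<in> nbrs H f" using f(1) by (simp add: nbrs_def)
      then show "e \<in> (\<Union>f\<in>P. (\<lambda>v. insert v f) ` nbrs H f)" using f(2) v(1) by blast
    qed
    then have "card G1 \<le> card (\<Union>f\<in>P. (\<lambda>v. insert v f) ` nbrs H f)"
      using finP finN by (intro card_mono) auto
    also have "real \<dots> \<le> real (card P) * real d"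
    proof (rule card_UN_le_const[OF finP _ order_refl])
      fix f assume "f \<in> P"
      then have "card ((\<lambda>v. insert v f) ` nbrs H f) \<le> d"
        using card_image_le[OF finN, of "\<lambda>v. insert v f" f] by (simp add: P_def)
      then show "real (card ((\<lambda>v. insert v f) ` nbrs H f)) \<le> real d" by simp
    qed simp
    also have "\<dots> \<le> \<delta> * N * real d" using cP by (intro mult_right_mono) auto
    also have "\<dots> = \<epsilon> / 2 * N" using d0 by (simp add: \<delta>_def)
    finally have c1: "real (card G1) \<le> \<epsilon> / 2 * N" by simp
    define G2 where "G2 = H - G1"
    have "shadow G2 \<subseteq> shadow H - P"
    proof
      fix f assume f: "f \<in> shadow G2"
      then obtain e v where e: "e \<in> G2" "v \<in> e" "f = e - {v}" by (rule shadowE)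
      have "f \<in> shadow H" using f shadow_mono[of G2 H] by (auto simp: G2_def)
      moreover have "f \<notin> P" using e by (auto simp: G2_def G1_def)
      ultimately show "f \<in> shadow H - P" by blast
    qed
    then have "card (shadow G2) \<le> card (shadow H - P)"
      using finite_shadow[OF unif] by (intro card_mono) auto
    then have "card (shadow G2) * d \<le> card (shadow H - P) * d" by simp
    also have "\<dots> = (\<Sum>f\<in>shadow H - P. d)" by simp
    also have "\<dots> \<le> (\<Sum>f\<in>shadow H - P. card (nbrs H f))" by (intro sum_mono) (auto simp: P_def)
    also have "\<dots> \<le> (\<Sum>f\<in>shadow H. card (nbrs H f))"
      using finite_shadow[OF unif] by (intro sum_mono2) auto
    also have "\<dots> \<le> r * card H" by (rule sum_card_nbrs_le[OF unif])
    also have "\<dots> \<le> r * (D * card (shadow H))" using edges[of H] by simp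
    finally have rich: "card (shadow G2) * d \<le> r * (D * card (shadow H))" .
    have "card G2 * d \<le> D * card (shadow G2) * d" by (intro mult_le_mono1 edges) (auto simp: G2_def)
    also have "\<dots> = D * (card (shadow G2) * d)" by (rule mult.assoc)
    also have "\<dots> \<le> D * (r * (D * card (shadow H)))" using rich by (rule mult_le_mono2)
    also have "\<dots> = r * D ^ 2 * card (shadow H)" by (simp add: power2_eq_square)
    finally have "card G2 * d \<le> r * D ^ 2 * card (shadow H)" .
    then have "real (card G2) * real d \<le> real r * real D ^ 2 * real (card (shadow H))"
      by (metis of_nat_le_iff of_nat_mult of_nat_power)
    also have "\<dots> \<le> (\<epsilon> / 2 * real d) * N" by (rule mult_mono[OF d2 sN]) (use \<epsilon> in auto)
    finally have "real (card G2) * real d \<le> (\<epsilon> / 2 * N) * real d" by (simp add: mult_ac)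
    then have c2: "real (card G2) \<le> \<epsilon> / 2 * N" using d0 by simp
    have "card H \<le> card G1 + card G2"
      using card_Un_le[of G1 G2] by (simp add: G2_def G1_def Un_absorb1)
    then show "real (card H) \<le> \<epsilon> * real (card V) ^ (r - 1)" using c1 c2 unfolding N_def by linarith
  qed
qed

text \<open>Peeling at \<open>t\<close> yields the main term, one binomial coefficient per set of
  the shadow. The remainder is full, hence has few edges, and its cliques are linear in its
  edges.\<close>

lemma clique_upper_bound:
  fixes I :: "'i set" and l :: "'i \<Rightarrow> nat" and \<epsilon> :: real
  assumes I: "finite I" "I \<noteq> {}" and l: "\<forall>i\<in>I. 5 \<le> l i" and r: "3 \<le> r" "r \<le> s"
    and t: "Suc t = (\<Sum>i\<in>I. (l i + 1) div 2)" and \<epsilon>: "\<epsilon> > 0"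
  shows "\<exists>n0. \<forall>(V :: 'a set) H. uniform r V H \<longrightarrow> \<not> has_system cyc I l H \<longrightarrow> n0 \<le> card V \<longrightarrow>
     real (card (cliques V r s H)) \<le>
       real (t choose (s - r + 1)) * (real (card V) ^ (r - 1) / fact (r - 1)) + \<epsilon> * real (card V) ^ (r - 1)"
proof -
  define D where "D = (4 * r * (sum l I + 1) choose (s - r + 1))"
  \<comment> \<open>The added 1 covers \<open>D = 0\<close>, which occurs for large s.\<close>
  define \<epsilon>' where "\<epsilon>' = \<epsilon> / (real (D * r) + 1)"
  have \<epsilon>': "\<epsilon>' > 0" using \<epsilon> by (auto simp: \<epsilon>'_def intro!: divide_pos_pos add_nonneg_pos)
  have De: "real (D * r) * \<epsilon>' \<le> \<epsilon>" 
    unfolding \<epsilon>'_def times_divide_eq_right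
    by (subst pos_divide_le_eq) (use \<epsilon> in \<open>auto simp: algebra_simps intro!: add_pos_nonneg\<close>)
  from full_few_edges[OF I l r(1) t \<epsilon>', where 'a = 'a and cyc = cyc] obtain n0 where
    n0: "\<forall>(V :: 'a set) H. uniform r V H \<longrightarrow> full (Suc t) H \<longrightarrow> \<not> has_system cyc I l H \<longrightarrow>
     n0 \<le> card V \<longrightarrow> real (card H) \<le> \<epsilon>' * real (card V) ^ (r - 1)" by (elim exE)
  show ?thesis
  proof (intro exI[of _ n0] allI impI)
    fix V :: "'a set" and H
    assume unif: "uniform r V H" and nosys: "\<not> has_system cyc I l H" and n: "n0 \<le> card V"
    define N where "N = real (card V) ^ (r - 1)"
    have N: "N \<ge> 0" by (simp add: N_def)
    have "1 \<le> r" using r by simp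
    from peeling[OF unif this r(2), of t] obtain H' where H': "H' \<subseteq> H" "full (Suc t) H'"
      "card (cliques V r s H) \<le> card (cliques V r s H') + (t choose (s - r + 1)) * card (shadow H)" by blast
    have u': "uniform r V H'" by (rule uniform_subset[OF unif H'(1)])
    have nosys': "\<not> has_system cyc I l H'" using nosys has_system_mono H'(1) by blast
    have "card (cliques V r s H') \<le> D * card (shadow H')"
      unfolding D_def by (rule cliques_le_shadow[OF u' nosys' r I(1) l])
    also have "\<dots> \<le> D * (r * card H')" by (intro mult_le_mono2 card_shadow_le(2)[OF u'])
    finally have "real (card (cliques V r s H')) \<le> real (D * r * card H')" by (simp only: of_nat_le_iff mult.assoc)
    also have "\<dots> = real (D * r) * real (card H')" by simp
    also have "\<dots> \<le> real (D * r) * (\<epsilon>' * N)"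
      unfolding N_def using n0 u' H'(2) nosys' n by (intro mult_left_mono) auto
    also have "\<dots> = real (D * r) * \<epsilon>' * N" by simp
    also have "\<dots> \<le> \<epsilon> * N" using De N by (rule mult_right_mono)
    finally have 1: "real (card (cliques V r s H')) \<le> \<epsilon> * N" .
    have "card (shadow H) * fact (r - 1) \<le> (card V choose (r - 1)) * fact (r - 1)"
      using card_shadow_le(1)[OF unif] by simp
    also have "\<dots> \<le> card V ^ (r - 1)" by (rule binomial_fact_pow)
    finally have "real (card (shadow H) * fact (r - 1)) \<le> real (card V ^ (r - 1))" by (simp only: of_nat_le_iff)
    then have "real (card (shadow H)) \<le> N / fact (r - 1)" by (simp add: N_def field_simps)
    then have 2: "real (t choose (s - r + 1)) * real (card (shadow H)) \<le> real (t choose (s - r + 1)) * (N / fact (r - 1))"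
      by (intro mult_left_mono) auto
    have "real (card (cliques V r s H)) \<le> real (card (cliques V r s H')) + real (t choose (s - r + 1)) * real (card (shadow H))"
      using H'(3) by (metis of_nat_add of_nat_le_iff of_nat_mult)
    then show "real (card (cliques V r s H)) \<le>
       real (t choose (s - r + 1)) * (real (card V) ^ (r - 1) / fact (r - 1)) + \<epsilon> * real (card V) ^ (r - 1)"
      using 1 2 unfolding N_def by linarith
  qed
qed

section \<open>Copies and loose configurations\<close>

lemma r_graph_uniform: "r_graph r G \<longleftrightarrow> uniform r (verts G) (edges G)"
  by (auto simp: r_graph_def uniform_def)

lemma image_subsets_card:
  assumes "bij_betw f A B"
  shows "(\<lambda>e. f ` e) ` {e. e \<subseteq> A \<and> card e = r} = {e. e \<subseteq> B \<and> card e = r}"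
proof (intro equalityI subsetI)
  fix e assume "e \<in> (\<lambda>e. f ` e) ` {e. e \<subseteq> A \<and> card e = r}"
  then obtain e0 where e0: "e0 \<subseteq> A" "card e0 = r" "e = f ` e0" by blast
  have "inj_on f e0" using assms e0(1) bij_betw_imp_inj_on inj_on_subset by blast
  then show "e \<in> {e. e \<subseteq> B \<and> card e = r}"
    using e0 bij_betw_imp_surj_on[OF assms] by (auto simp: card_image)
next
  fix e assume "e \<in> {e. e \<subseteq> B \<and> card e = r}"
  then have e: "e \<subseteq> B" "card e = r" by auto
  define e0 where "e0 = {x \<in> A. f x \<in> e}"
  have im: "f ` e0 = e" using e(1) bij_betw_imp_surj_on[OF assms] by (auto simp: e0_def)
  have "inj_on f e0" by (rule inj_on_subset[OF bij_betw_imp_inj_on[OF assms]]) (auto simp: e0_def)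
  then have "card e0 = r" using card_image[of f e0] im e(2) by simp
  then show "e \<in> (\<lambda>e. f ` e) ` {e. e \<subseteq> A \<and> card e = r}"
    using im by (intro image_eqI[of _ _ e0]) (auto simp: e0_def)
qed

lemma num_copies_complete:
  assumes G: "r_graph r G"
  shows "num_copies (complete_r_graph r s) G = card (cliques (verts G) r s (edges G))"
proof -
  let ?K = "\<lambda>S. \<lparr>verts = S, edges = {e. e \<subseteq> S \<and> card e = r}\<rparr>"
  have fin: "finite (verts G)" using G by (simp add: r_graph_def)
  have "copies (complete_r_graph r s) G = ?K ` cliques (verts G) r s (edges G)"
  proof (intro equalityI subsetI)
    fix G' assume "G' \<in> copies (complete_r_graph r s) G"
    then obtain f where sub: "verts G' \<subseteq> verts G" "edges G' \<subseteq> edges G" and f: "bij_betw f {..<s} (verts G')"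
      and E: "edges G' = (\<lambda>e. f ` e) ` {e. e \<subseteq> {..<s} \<and> card e = r}"
      by (auto simp: copies_def subhypergraph_def isomorphic_def complete_r_graph_def)
    have E': "edges G' = {e. e \<subseteq> verts G' \<and> card e = r}" unfolding E by (rule image_subsets_card[OF f])
    have "card (verts G') = s" using bij_betw_same_card[OF f] by simp
    then have "verts G' \<in> cliques (verts G) r s (edges G)" using sub E' by (auto simp: cliques_def)
    moreover have "G' = ?K (verts G')" using E' by simp
    ultimately show "G' \<in> ?K ` cliques (verts G) r s (edges G)" by (rule rev_image_eqI)
  next
    fix G' assume "G' \<in> ?K ` cliques (verts G) r s (edges G)"
    then obtain S where S: "S \<in> cliques (verts G) r s (edges G)" "G' = ?K S" by blast
    have S': "S \<subseteq> verts G" "card S = s" using S(1) by (auto simp: cliques_def)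
    then have "finite S" using fin finite_subset by blast
    then obtain f where "bij_betw f {0..<card S} S" using ex_bij_betw_nat_finite by blast
    then have f: "bij_betw f {..<s} S" using S'(2) by (simp add: atLeast0LessThan)
    have "isomorphic (complete_r_graph r s) G'"
      unfolding isomorphic_def complete_r_graph_def S(2)
      by (intro exI[of _ f]) (simp add: f image_subsets_card[OF f])
    moreover have "subhypergraph G' G" using S by (auto simp: subhypergraph_def cliques_def)
    ultimately show "G' \<in> copies (complete_r_graph r s) G" by (simp add: copies_def)
  qed
  moreover have "inj_on ?K (cliques (verts G) r s (edges G))" by (rule inj_onI) simp
  ultimately show ?thesis by (simp add: num_copies_def card_image)
qed

section \<open>Loose configurations as expansions\<close>

text \<open>A common interface for paths and cycles: every vertex lies in an edge, so the edges
  determine the image of an embedding, and the degree bound serves the extremal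
  construction.\<close>

definition graph_of :: "nat \<Rightarrow> (nat \<Rightarrow> 'v set) \<Rightarrow> 'v hypergraph \<Rightarrow> bool" where
  "graph_of l ed F \<longleftrightarrow> inj_on ed {..<l} \<and> edges F = ed ` {..<l} \<and> verts F = (\<Union>i<l. ed i) \<and>
     (\<forall>i<l. card (ed i) = 2) \<and> (\<forall>v. card {i. i < l \<and> v \<in> ed i} \<le> 2)"

lemma card_le_2I: "A \<subseteq> {a, b} \<Longrightarrow> card A \<le> 2"
  using card_mono[of "{a, b}" A] by (simp add: card_insert_if split: if_splits)

lemma graph_of_path: "1 \<le> l \<Longrightarrow> graph_of l (\<lambda>i. {i, i + 1}) (path_graph l)"
  unfolding graph_of_def path_graph_def
proof (simp, intro conjI allI)
  show "inj_on (\<lambda>i. {i, Suc i}) {..<l}" by (auto simp: inj_on_def doubleton_eq_iff)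
  show "{{i, Suc i} |i. i < l} = (\<lambda>i. {i, Suc i}) ` {..<l}" by auto
  show "{..l} = (\<Union>i<l. {i, Suc i})" if "Suc 0 \<le> l"
  proof (intro equalityI subsetI)
    fix x assume "x \<in> {..l}"
    then show "x \<in> (\<Union>i<l. {i, Suc i})" using that by (cases "x < l") (auto intro!: bexI[of _ "x - 1"])
  qed auto
  fix v
  show "card {i. i < l \<and> (v = i \<or> v = Suc i)} \<le> 2" by (rule card_le_2I[of _ v "v - 1"]) auto
qed

lemma graph_of_cycle:
  assumes l: "3 \<le> l"
  shows "graph_of l (\<lambda>i. {i, (i + 1) mod l}) (cycle_graph l)"
proof -
  have m: "Suc i mod l = (if Suc i = l then 0 else Suc i)" if "i < l" for i using that by auto
  show ?thesis unfolding graph_of_def cycle_graph_def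
  proof (simp, intro conjI allI impI)
    show "inj_on (\<lambda>i. {i, Suc i mod l}) {..<l}"
    proof (rule inj_onI)
      fix i j assume "i \<in> {..<l}" "j \<in> {..<l}" "{i, Suc i mod l} = {j, Suc j mod l}"
      then show "i = j" using l m[of i] m[of j] by (auto simp: doubleton_eq_iff split: if_splits)
    qed
    show "{{i, Suc i mod l} |i. i < l} = (\<lambda>i. {i, Suc i mod l}) ` {..<l}" by auto
    show "{..<l} = (\<Union>i<l. {i, Suc i mod l})" using l by (auto intro: mod_less_divisor)
    fix i assume "i < l"
    then show "card {i, Suc i mod l} = 2" using l m[of i] by (simp add: card_insert_if)
  next
    fix v
    show "card {i. i < l \<and> (v = i \<or> v = Suc i mod l)} \<le> 2"
    proof (rule card_le_2I[of _ v "cprev l v"], rule subsetI)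
      fix i assume "i \<in> {i. i < l \<and> (v = i \<or> v = Suc i mod l)}"
      then have "i < l" "v = i \<or> v = (if Suc i = l then 0 else Suc i)" using m[of i] by auto
      then show "i \<in> {v, cprev l v}" by (auto simp: cprev_def split: if_splits)
    qed
  qed
qed

abbreviation expanded_edge :: "nat \<Rightarrow> 'v set \<Rightarrow> ('v + 'v set \<times> nat) set" where
  "expanded_edge r e \<equiv> Inl ` e \<union> Inr ` ({e} \<times> {..<r - 2})"

text \<open>It suffices to place the base vertices with the right incidences. Edges meet in base
  vertices only, so the other r - 2 vertices of each edge are private and can be matched arbitrarily
  with the new ones.\<close>

lemma expansion_embedding:
  assumes F: "graph_of l ed F" and r: "3 \<le> r"
    and E: "\<And>i. i < l \<Longrightarrow> finite (E i) \<and> card (E i) = r"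
    and g: "inj_on g (verts F)" "\<And>i v. i < l \<Longrightarrow> v \<in> verts F \<Longrightarrow> g v \<in> E i \<longleftrightarrow> v \<in> ed i"
    and int: "\<And>i j. i < l \<Longrightarrow> j < l \<Longrightarrow> i \<noteq> j \<Longrightarrow> E i \<inter> E j \<subseteq> g ` verts F"
  shows "\<exists>\<psi>. inj_on \<psi> (verts (expansion r F)) \<and> (\<forall>i<l. \<psi> ` expanded_edge r (ed i) = E i) \<and>
     \<psi> ` verts (expansion r F) = (\<Union>i<l. E i)"
proof -
  have inj: "inj_on ed {..<l}" and ed: "edges F = ed ` {..<l}" "verts F = (\<Union>i<l. ed i)"
    "\<And>i. i < l \<Longrightarrow> card (ed i) = 2" using F by (auto simp: graph_of_def)
  have sub: "g ` ed i \<subseteq> E i" if "i < l" for i using g(2) that ed(2) by blast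
  have "\<exists>b. bij_betw b {..<r - 2} (E i - g ` ed i)" if i: "i < l" for i
  proof -
    have "inj_on g (ed i)" using g(1) by (rule inj_on_subset) (use ed(2) i in auto)
    then have "card (g ` ed i) = 2" using ed(3)[OF i] by (simp add: card_image)
    then have "card (E i - g ` ed i) = r - 2"
      using E[OF i] sub[OF i] by (simp add: card_Diff_subset finite_subset)
    then show ?thesis
      using ex_bij_betw_nat_finite[of "E i - g ` ed i"] E[OF i] by (simp add: atLeast0LessThan)
  qed
  then obtain b where b: "\<And>i. i < l \<Longrightarrow> bij_betw (b i) {..<r - 2} (E i - g ` ed i)" by metis
  \<comment> \<open>New vertices are tagged by their base edge as a set; this recovers its
    index.\<close>
  define ix where "ix e = inv_into {..<l} ed e" for e
  have ix: "ix (ed i) = i" if "i < l" for i using inv_into_f_f[OF inj] that by (simp add: ix_def)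
  define \<psi> where "\<psi> x = (case x of Inl v \<Rightarrow> g v | Inr (e, j) \<Rightarrow> b (ix e) j)" for x
  have bi: "b i j \<in> E i - g ` ed i" if "i < l" "j < r - 2" for i j
    using bij_betw_apply[OF b[OF that(1)]] that(2) by simp
  have bi': "b i j \<notin> g ` verts F" if "i < l" "j < r - 2" for i j
  proof
    assume "b i j \<in> g ` verts F"
    then obtain v where "v \<in> verts F" "b i j = g v" by blast
    then show False using bi[OF that] g(2)[OF that(1), of v] by auto
  qed
  have edge: "\<psi> ` expanded_edge r (ed i) = E i" if i: "i < l" for i
  proof -
    have "expanded_edge r (ed i) = Inl ` ed i \<union> (\<lambda>j. Inr (ed i, j)) ` {..<r - 2}" by auto
    then have "\<psi> ` expanded_edge r (ed i) = g ` ed i \<union> b i ` {..<r - 2}"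
      using ix[OF i] by (simp only: image_Un image_image) (simp add: \<psi>_def)
    also have "b i ` {..<r - 2} = E i - g ` ed i" using b[OF i] by (rule bij_betw_imp_surj_on)
    finally show ?thesis using sub[OF i] by blast
  qed
  have V: "verts (expansion r F) = (\<Union>i<l. expanded_edge r (ed i))"
    unfolding expansion_def using ed by auto
  have "inj_on \<psi> (verts (expansion r F))"
  proof (rule inj_onI)
    fix x y assume x: "x \<in> verts (expansion r F)" and y: "y \<in> verts (expansion r F)" and eq: "\<psi> x = \<psi> y"
    have cx: "(\<exists>v\<in>verts F. x = Inl v) \<or> (\<exists>i<l. \<exists>j<r - 2. x = Inr (ed i, j))"
      using x ed by (auto simp: expansion_def)
    have cy: "(\<exists>v\<in>verts F. y = Inl v) \<or> (\<exists>i<l. \<exists>j<r - 2. y = Inr (ed i, j))"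
      using y ed by (auto simp: expansion_def)
    have LR: False if "v \<in> verts F" "i < l" "j < r - 2" "\<psi> (Inl v) = \<psi> (Inr (ed i, j))" for v i j
    proof -
      have "g v = b i j" using that(4) ix[OF that(2)] by (simp add: \<psi>_def)
      then show False using bi'[OF that(2,3)] that(1) by (metis imageI)
    qed
    have RR: "i = i' \<and> j = j'" if "i < l" "j < r - 2" "i' < l" "j' < r - 2"
      "\<psi> (Inr (ed i, j)) = \<psi> (Inr (ed i', j'))" for i j i' j'
    proof -
      have e: "b i j = b i' j'" using that ix by (simp add: \<psi>_def)
      have "i = i'"
      proof (rule ccontr)
        assume "i \<noteq> i'"
        then have "b i j \<in> g ` verts F"
          using int[OF that(1,3)] bi[OF that(1,2)] bi[OF that(3,4)] e by auto
        then show False using bi'[OF that(1,2)] by blast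
      qed
      moreover have "j = j'"
        using e that bij_betw_imp_inj_on[OF b[OF that(1)]] \<open>i = i'\<close> by (auto simp: inj_on_def)
      ultimately show ?thesis by blast
    qed
    from cx cy show "x = y"
    proof (elim disjE bexE exE conjE)
      fix v w assume "v \<in> verts F" "w \<in> verts F" "x = Inl v" "y = Inl w"
      then show "x = y" using eq g(1) by (auto simp: \<psi>_def inj_on_def)
    next
      fix v i j assume "v \<in> verts F" "x = Inl v" "i < l" "j < r - 2" "y = Inr (ed i, j)"
      then show "x = y" using LR[of v i j] eq by simp
    next
      fix v i j assume "v \<in> verts F" "y = Inl v" "i < l" "j < r - 2" "x = Inr (ed i, j)"
      then show "x = y" using LR[of v i j] eq by simp
    next
      fix i j i' j' assume "i < l" "j < r - 2" "x = Inr (ed i, j)" "i' < l" "j' < r - 2" "y = Inr (ed i', j')"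
      then show "x = y" using RR[of i j i' j'] eq by simp
    qed
  qed
  moreover have "\<psi> ` verts (expansion r F) = (\<Union>i<l. E i)"
    unfolding V image_UN using edge by simp
  ultimately show ?thesis using edge by blast
qed

text \<open>Vertex j of the cycle lies in the base edges j - 1 and j, so it is sent to the unique
  common vertex of the corresponding hyperedges.\<close>

lemma loose_cycle_joints:
  assumes E: "loose True l E" and l: "4 \<le> l"
  shows "\<exists>u. inj_on u {..<l} \<and> (\<forall>i<l. \<forall>j<l. u j \<in> E i \<longleftrightarrow> j \<in> {i, (i + 1) mod l}) \<and>
    (\<forall>i<l. \<forall>j<l. i \<noteq> j \<longrightarrow> E i \<inter> E j \<subseteq> u ` {..<l})"
proof -
  have cp: "cprev l j < l" "cprev l j \<noteq> j" if "j < l" for j using that l by (auto simp: cprev_def)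
  have "card (E (cprev l j) \<inter> E j) = 1" if j: "j < l" for j
  proof (cases j)
    case 0
    have "card (E 0 \<inter> E (l - 1)) = 1" using E l unfolding loose_def by auto
    then show ?thesis using 0 by (simp add: cprev_def Int_commute)
  next
    case (Suc i)
    then show ?thesis using E j unfolding loose_def by (auto simp: cprev_def)
  qed
  then have "\<exists>x. E (cprev l j) \<inter> E j = {x}" if "j < l" for j using that by (meson card_1_singletonE)
  then obtain u where u: "\<And>j. j < l \<Longrightarrow> E (cprev l j) \<inter> E j = {u j}" by metis
  have adj: "i = cprev l j \<or> j = cprev l i" if "x \<in> E i" "x \<in> E j" "i < l" "j < l" "i \<noteq> j" for i j x
  proof -
    have *: "a = cprev l b \<or> b = cprev l a" if "a < b" "b < l" "x \<in> E a" "x \<in> E b" for a b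
    proof (rule ccontr)
      assume "\<not> ?thesis"
      then have "b \<noteq> Suc a" "\<not> (a = 0 \<and> Suc b = l)" by (auto simp: cprev_def)
      then have "E a \<inter> E b = {}" using E that unfolding loose_def by auto
      then show False using that by blast
    qed
    from that(5) consider "i < j" | "j < i" by linarith
    then show ?thesis using *[of i j] *[of j i] that by cases auto
  qed
  \<comment> \<open>A third edge through \<open>u j\<close> would be adjacent to both j and its
    predecessor; three mutually adjacent edges exist only for l = 3.\<close>
  have inc: "i = j \<or> i = cprev l j" if "u j \<in> E i" "i < l" "j < l" for i j
  proof (rule ccontr)
    assume no: "\<not> ?thesis"
    have uj: "u j \<in> E j" "u j \<in> E (cprev l j)" using u[OF that(3)] by blast+
    have 1: "j = cprev l i" using adj[OF that(1) uj(1) that(2,3)] no by blast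
    have 2: "i = cprev l (cprev l j) \<or> cprev l j = cprev l i"
      using adj[OF that(1) uj(2) that(2) cp(1)[OF that(3)]] no by blast
    show False using 1 2 no that l by (auto simp: cprev_def split: if_splits)
  qed
  have inc': "u j \<in> E j" "u j \<in> E (cprev l j)" if "j < l" for j using u[OF that] by blast+
  have ed: "j \<in> {i, (i + 1) mod l} \<longleftrightarrow> i = j \<or> i = cprev l j" if "i < l" "j < l" for i j
  proof (cases "Suc i = l")
    case True
    then show ?thesis using that by (auto simp: cprev_def)
  next
    case False
    then show ?thesis using that by (auto simp: cprev_def split: if_splits)
  qed
  show ?thesis
  proof (intro exI[of _ u] conjI allI impI)
    show "inj_on u {..<l}"
    proof (rule inj_onI, rule ccontr)
      fix j j' assume j: "j \<in> {..<l}" "j' \<in> {..<l}" "u j = u j'" "j \<noteq> j'"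
      then have 1: "j' = cprev l j" using inc[of j j'] inc'(1)[of j'] by auto
      have 2: "cprev l j' = j \<or> cprev l j' = cprev l j"
        using inc[of j "cprev l j'"] inc'(2)[of j'] j cp by auto
      show False using 1 2 j l by (auto simp: cprev_def split: if_splits)
    qed
  next
    fix i j assume ij: "i < l" "j < l"
    show "u j \<in> E i \<longleftrightarrow> j \<in> {i, (i + 1) mod l}" unfolding ed[OF ij] using inc[of j i] inc'[OF ij(2)] ij by blast
    assume "i \<noteq> j"
    show "E i \<inter> E j \<subseteq> u ` {..<l}"
    proof
      fix x assume x: "x \<in> E i \<inter> E j"
      then have "i = cprev l j \<or> j = cprev l i" using adj[of x i j] ij \<open>i \<noteq> j\<close> by blast
      then show "x \<in> u ` {..<l}" using x u[OF ij(1)] u[OF ij(2)] ij by blast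
    qed
  qed
qed

text \<open>Inner vertices are forced. The two ends are arbitrary vertices off the neighbouring
  joint, which exist because the edges have at least two vertices.\<close>

lemma loose_path_joints:
  assumes E: "loose False l E" and l: "2 \<le> l" and c: "\<And>i. i < l \<Longrightarrow> 2 \<le> card (E i)"
  shows "\<exists>u. inj_on u {..l} \<and> (\<forall>i<l. \<forall>j\<le>l. u j \<in> E i \<longleftrightarrow> j \<in> {i, i + 1}) \<and>
    (\<forall>i<l. \<forall>j<l. i \<noteq> j \<longrightarrow> E i \<inter> E j \<subseteq> u ` {..l})"
proof -
  have "card (E j \<inter> E (Suc j)) = 1" if "Suc j < l" for j using E that unfolding loose_def by auto
  then have "\<exists>x. E j \<inter> E (Suc j) = {x}" if "Suc j < l" for j using that by (meson card_1_singletonE)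
  then obtain w where w: "\<And>j. Suc j < l \<Longrightarrow> E j \<inter> E (Suc j) = {w j}" by metis
  have ex: "\<exists>x\<in>E i. x \<notin> {y}" if "i < l" for i y
    by (rule fresh_element) (use c[OF that] in auto)
  obtain a where a: "a \<in> E 0" "a \<noteq> w 0" using ex[of 0 "w 0"] l by auto
  obtain b where b: "b \<in> E (l - 1)" "b \<noteq> w (l - 2)" using ex[of "l - 1" "w (l - 2)"] l by auto
  define u where "u j = (if j = 0 then a else if j = l then b else w (j - 1))" for j
  have adj: "j = Suc i \<and> x = w i" if "x \<in> E i" "x \<in> E j" "i < j" "j < l" for i j x
  proof -
    have "j = Suc i"
    proof (rule ccontr)
      assume "j \<noteq> Suc i"
      then have "E i \<inter> E j = {}" using E that unfolding loose_def by auto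
      then show False using that by blast
    qed
    then show ?thesis using w[of i] that by auto
  qed
  have uin: "u j \<in> E j" if "j < l" for j
    using that a w[of "j - 1"] by (cases j) (auto simp: u_def)
  have uin': "u (Suc j) \<in> E j" if "j < l" for j
  proof (cases "Suc j = l")
    case True
    then have "j = l - 1" by simp
    then show ?thesis using True b l by (simp add: u_def)
  next
    case False
    then show ?thesis using w[of j] that by (auto simp: u_def)
  qed
  have inc: "i = j \<or> Suc i = j" if ij: "u j \<in> E i" "i < l" "j \<le> l" for i j
  proof (rule ccontr)
    assume no: "\<not> (i = j \<or> Suc i = j)"
    consider "j = 0" | "j = l" "j \<noteq> 0" | "0 < j" "j < l" using ij by linarith
    then show False
    proof cases
      case 1
      then have "a \<in> E i" "0 < i" using ij no by (auto simp: u_def)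
      then show False using adj[of a 0 i] a ij by auto
    next
      case 2
      then have "b \<in> E i" "i < l - 1" using ij no l by (auto simp: u_def)
      then have "l - 1 = Suc i \<and> b = w i" using adj[of b i "l - 1"] b l by auto
      then show False using b by (metis diff_Suc_1 diff_Suc_eq_diff_pred numeral_2_eq_2 One_nat_def)
    next
      case 3
      have m: "u j \<in> E j" "u j \<in> E (j - 1)" using uin[of j] uin'[of "j - 1"] 3 by auto
      show False
      proof (cases "i < j")
        case True
        then have "i < j - 1" using no by linarith
        then show False using adj[OF ij(1) m(1) True] 3 no by simp
      next
        case False
        then have "j - 1 < i" using 3 by linarith
        then show False using adj[OF m(2) ij(1)] ij(2) 3 no by simp
      qed
    qed
  qed
  show ?thesis
  proof (intro exI[of _ u] conjI allI impI)
    have "u j \<noteq> u j'" if j: "j < j'" "j' \<le> l" for j j'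
    proof
      assume eq: "u j = u j'"
      have "u j \<in> E (j' - 1)" using uin'[of "j' - 1"] j eq by simp
      then have 1: "j' = Suc j" using inc[of j "j' - 1"] j by auto
      show False
      proof (cases "j' < l")
        case True
        then show False using inc[of j j'] uin[of j'] eq 1 by simp
      next
        case False
        then have j0: "j' = l" "0 < j" using j 1 l by auto
        then have "u j' \<in> E (j - 1)" "j - 1 < l" using uin'[of "j - 1"] eq 1 by auto
        then show False using inc[of j' "j - 1"] 1 j j0(2) by auto
      qed
    qed
    then show "inj_on u {..l}" by (intro linorder_inj_onI') auto
  next
    fix i j assume ij: "i < l" "j \<le> l"
    show "u j \<in> E i \<longleftrightarrow> j \<in> {i, i + 1}" using inc[of j i] uin[of i] uin'[of i] ij by auto
  next
    fix i j assume ij: "i < l" "j < l" "i \<noteq> j"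
    have *: "E a \<inter> E b \<subseteq> u ` {..l}" if ab: "a < b" "b < l" for a b
    proof
      fix x assume "x \<in> E a \<inter> E b"
      then have "b = Suc a" "x = w a" using adj[of x a b] ab by auto
      then have "x = u b" using ab by (simp add: u_def)
      then show "x \<in> u ` {..l}" using ab by auto
    qed
    from ij(3) consider "i < j" | "j < i" by linarith
    then show "E i \<inter> E j \<subseteq> u ` {..l}" using *[of i j] *[of j i] ij by cases auto
  qed
qed

definition base_graph :: "bool \<Rightarrow> nat \<Rightarrow> nat hypergraph" where
  "base_graph cyc l = (if cyc then cycle_graph l else path_graph l)"

definition base_edge :: "bool \<Rightarrow> nat \<Rightarrow> nat \<Rightarrow> nat set" where
  "base_edge cyc l i = (if cyc then {i, (i + 1) mod l} else {i, i + 1})"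

lemma graph_of_base: "3 \<le> l \<Longrightarrow> graph_of l (base_edge cyc l) (base_graph cyc l)"
  using graph_of_cycle[of l] graph_of_path[of l] unfolding base_edge_def[abs_def] base_graph_def
  by (cases cyc) simp_all

lemma loose_expansion:
  assumes E: "loose cyc l E" and l: "4 \<le> l" and r: "3 \<le> r"
    and card: "\<And>i. i < l \<Longrightarrow> finite (E i) \<and> card (E i) = r"
  shows "\<exists>\<psi>. inj_on \<psi> (verts (expansion r (base_graph cyc l))) \<and>
     (\<forall>i<l. \<psi> ` expanded_edge r (base_edge cyc l i) = E i) \<and>
     \<psi> ` verts (expansion r (base_graph cyc l)) = (\<Union>i<l. E i)"
proof -
  have "\<exists>g. inj_on g (verts (base_graph cyc l)) \<and>
      (\<forall>i<l. \<forall>v\<in>verts (base_graph cyc l). g v \<in> E i \<longleftrightarrow> v \<in> base_edge cyc l i) \<and>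
      (\<forall>i<l. \<forall>j<l. i \<noteq> j \<longrightarrow> E i \<inter> E j \<subseteq> g ` verts (base_graph cyc l))"
  proof (cases cyc)
    case True
    then show ?thesis using loose_cycle_joints[of l E] E l
      by (simp add: base_graph_def base_edge_def cycle_graph_def Ball_def)
  next
    case False
    have "2 \<le> card (E i)" if "i < l" for i using card[OF that] r by simp
    then show ?thesis using loose_path_joints[of l E] E l False
      by (simp add: base_graph_def base_edge_def path_graph_def Ball_def)
  qed
  then obtain g where g: "inj_on g (verts (base_graph cyc l))"
      "\<forall>i<l. \<forall>v\<in>verts (base_graph cyc l). g v \<in> E i \<longleftrightarrow> v \<in> base_edge cyc l i"
      "\<forall>i<l. \<forall>j<l. i \<noteq> j \<longrightarrow> E i \<inter> E j \<subseteq> g ` verts (base_graph cyc l)" by blast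
  show ?thesis
  proof (rule expansion_embedding[OF graph_of_base r card g(1)])
    show "3 \<le> l" using l by simp
  qed (use g in blast)+
qed

lemma edges_expansion_base:
  assumes "3 \<le> l"
  shows "edges (expansion r (base_graph cyc l)) = (\<lambda>i. expanded_edge r (base_edge cyc l i)) ` {..<l}"
proof -
  have "edges (base_graph cyc l) = base_edge cyc l ` {..<l}"
    using graph_of_base[OF assms] by (simp add: graph_of_def)
  then show ?thesis by (simp add: expansion_def image_image)
qed

text \<open>Every vertex of an expansion lies in an edge, so disjointness of edges across components
  makes the glued map injective.\<close>

lemma copies_of_has_system:
  fixes G :: "'a hypergraph"
  assumes sys: "has_system cyc I l (edges G)" and G: "r_graph r G" and r: "3 \<le> r"
    and l: "\<forall>i\<in>I. 5 \<le> l i" and Q: "\<forall>i\<in>I. Q i = expansion r (base_graph cyc (l i))"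
  shows "copies (disjoint_union I Q) G \<noteq> {}"
proof -
  obtain E where E: "\<And>i. i \<in> I \<Longrightarrow> loose cyc (l i) (E i)" "\<And>i j. i \<in> I \<Longrightarrow> j < l i \<Longrightarrow> E i j \<in> edges G"
    "\<And>i i' j j'. i \<in> I \<Longrightarrow> i' \<in> I \<Longrightarrow> i \<noteq> i' \<Longrightarrow> j < l i \<Longrightarrow> j' < l i' \<Longrightarrow> E i j \<inter> E i' j' = {}"
    using sys unfolding has_system_def by metis
  have unif: "uniform r (verts G) (edges G)" using G by (simp add: r_graph_uniform)
  have "\<exists>\<psi>. inj_on \<psi> (verts (Q i)) \<and> (\<forall>j<l i. \<psi> ` expanded_edge r (base_edge cyc (l i) j) = E i j) \<and>
     \<psi> ` verts (Q i) = (\<Union>j<l i. E i j)" if i: "i \<in> I" for i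
  proof -
    have "4 \<le> l i" using l i by force
    moreover have "finite (E i j) \<and> card (E i j) = r" if "j < l i" for j
      using uniform_edge[OF unif E(2)[OF i that]] by blast
    ultimately show ?thesis using loose_expansion[OF E(1)[OF i] _ r] Q i by simp
  qed
  then obtain \<psi> where \<psi>: "\<And>i. i \<in> I \<Longrightarrow> inj_on (\<psi> i) (verts (Q i))"
    "\<And>i j. i \<in> I \<Longrightarrow> j < l i \<Longrightarrow> \<psi> i ` expanded_edge r (base_edge cyc (l i) j) = E i j"
    "\<And>i. i \<in> I \<Longrightarrow> \<psi> i ` verts (Q i) = (\<Union>j<l i. E i j)" by metis
  define f where "f = (\<lambda>(i, x). \<psi> i x)"
  let ?U = "disjoint_union I Q"
  define G' where "G' = \<lparr>verts = f ` verts ?U, edges = (\<lambda>e. f ` e) ` edges ?U\<rparr>"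
  have fP: "f ` Pair i ` e = \<psi> i ` e" for i e by (simp add: f_def image_image)
  have "inj_on f (verts ?U)"
  proof (rule inj_onI)
    fix a b assume a: "a \<in> verts ?U" and b: "b \<in> verts ?U" and eq: "f a = f b"
    obtain i x where ix: "a = (i, x)" "i \<in> I" "x \<in> verts (Q i)" using a by (auto simp: disjoint_union_def)
    obtain i' x' where ix': "b = (i', x')" "i' \<in> I" "x' \<in> verts (Q i')" using b by (auto simp: disjoint_union_def)
    have e: "\<psi> i x = \<psi> i' x'" using eq ix ix' by (simp add: f_def)
    have "\<psi> i x \<in> (\<Union>j<l i. E i j)" "\<psi> i' x' \<in> (\<Union>j<l i'. E i' j)" using \<psi>(3) ix ix' by blast+
    then have "i = i'" using E(3)[OF ix(2) ix'(2)] e by fastforce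
    then show "a = b" using e ix ix' inj_onD[OF \<psi>(1)[OF ix(2)]] by auto
  qed
  then have "isomorphic ?U G'"
    unfolding isomorphic_def G'_def by (intro exI[of _ f]) (simp add: bij_betw_def)
  moreover have "subhypergraph G' G" unfolding subhypergraph_def
  proof
    show "verts G' \<subseteq> verts G"
    proof
      fix y assume "y \<in> verts G'"
      then obtain i x where "i \<in> I" "x \<in> verts (Q i)" "y = \<psi> i x"
        by (auto simp: G'_def disjoint_union_def f_def)
      then have "y \<in> (\<Union>j<l i. E i j)" using \<psi>(3) by blast
      then show "y \<in> verts G" using E(2)[OF \<open>i \<in> I\<close>] uniform_edge[OF unif] by blast
    qed
    show "edges G' \<subseteq> edges G"
    proof
      fix e assume "e \<in> edges G'"
      then obtain i e0 where i: "i \<in> I" "e0 \<in> edges (Q i)" "e = \<psi> i ` e0"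
        by (auto simp: G'_def disjoint_union_def fP)
      have "3 \<le> l i" using l i(1) by force
      then obtain j where "j < l i" "e0 = expanded_edge r (base_edge cyc (l i) j)"
        using i Q edges_expansion_base[of "l i" r cyc] by auto
      then show "e \<in> edges G" using \<psi>(2)[OF i(1)] E(2)[OF i(1)] i(3) by simp
    qed
  qed
  ultimately show ?thesis by (auto simp: copies_def)
qed

section \<open>The extremal construction and asymptotics\<close>

lemma card_edges_expansion_base:
  assumes l: "3 \<le> l"
  shows "card (edges (expansion r (base_graph cyc l))) = l"
    and "card {e \<in> edges (expansion r (base_graph cyc l)). x \<in> e} \<le> 2"
    and "finite (edges (expansion r (base_graph cyc l)))"
proof -
  let ?e = "\<lambda>i. expanded_edge r (base_edge cyc l i)"
  have inj: "inj_on (base_edge cyc l) {..<l}" and deg: "\<And>v. card {i. i < l \<and> v \<in> base_edge cyc l i} \<le> 2"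
    using graph_of_base[OF l, of cyc] by (auto simp: graph_of_def)
  have "inj_on ?e {..<l}"
  proof (rule inj_onI)
    fix i j assume ij: "i \<in> {..<l}" "j \<in> {..<l}" "?e i = ?e j"
    have "Inl -` ?e i = Inl -` ?e j" using ij(3) by simp
    then have "base_edge cyc l i = base_edge cyc l j" by (auto simp: vimage_def)
    then show "i = j" using inj ij by (auto simp: inj_on_def)
  qed
  then show "card (edges (expansion r (base_graph cyc l))) = l"
    unfolding edges_expansion_base[OF l] by (simp add: card_image)
  show "finite (edges (expansion r (base_graph cyc l)))" unfolding edges_expansion_base[OF l] by simp
  have "\<exists>I. finite I \<and> card I \<le> 2 \<and> {e \<in> edges (expansion r (base_graph cyc l)). x \<in> e} \<subseteq> ?e ` I"
  proof (cases x)
    case (Inl v)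
    then show ?thesis unfolding edges_expansion_base[OF l] using deg[of v]
      by (intro exI[of _ "{i. i < l \<and> v \<in> base_edge cyc l i}"]) auto
  next
    case (Inr p)
    show ?thesis
    proof (cases "\<exists>i<l. base_edge cyc l i = fst p")
      case True
      then obtain i where i: "i < l" "base_edge cyc l i = fst p" by blast
      have "j = i" if "j < l" "x \<in> ?e j" for j
        using that i Inr inj by (auto simp: inj_on_def)
      then show ?thesis unfolding edges_expansion_base[OF l] by (intro exI[of _ "{i}"]) auto
    next
      case False
      then show ?thesis unfolding edges_expansion_base[OF l] using Inr by (intro exI[of _ "{}"]) auto
    qed
  qed
  then obtain I where I: "finite I" "card I \<le> 2" "{e \<in> edges (expansion r (base_graph cyc l)). x \<in> e} \<subseteq> ?e ` I" by blast
  have "card {e \<in> edges (expansion r (base_graph cyc l)). x \<in> e} \<le> card (?e ` I)"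
    using I by (intro card_mono) auto
  also have "\<dots> \<le> card I" by (rule card_image_le[OF I(1)])
  finally show "card {e \<in> edges (expansion r (base_graph cyc l)). x \<in> e} \<le> 2" using I(2) by simp
qed

lemma S_graph_r_graph: "r_graph r (S_graph r n t)"
  by (auto simp: r_graph_def S_graph_def)

text \<open>Every vertex of \<open>Q i\<close> lies in at most two of its \<open>l i\<close> edges, so a copy of \<open>Q i\<close> needs at least
  half as many vertices of the fixed set as it has edges.\<close>

lemma S_graph_no_copies:
  assumes I: "finite I" and l: "\<forall>i\<in>I. 5 \<le> l i" and t: "Suc t = (\<Sum>i\<in>I. (l i + 1) div 2)"
    and Q: "\<forall>i\<in>I. Q i = expansion r (base_graph cyc (l i))"
  shows "copies (disjoint_union I Q) (S_graph r n t) = {}"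
proof (rule equals0I)
  fix G' assume "G' \<in> copies (disjoint_union I Q) (S_graph r n t)"
  then obtain f where f: "bij_betw f (verts (disjoint_union I Q)) (verts G')"
    and E: "(\<lambda>e. f ` e) ` edges (disjoint_union I Q) \<subseteq> edges (S_graph r n t)"
    by (auto simp: copies_def isomorphic_def subhypergraph_def)
  define T where "T i = {x \<in> verts (Q i). f (i, x) < t}" for i
  have inj: "inj_on f (SIGMA i:I. T i)"
    by (rule inj_on_subset[OF bij_betw_imp_inj_on[OF f]]) (auto simp: disjoint_union_def T_def)
  have sub: "f ` (SIGMA i:I. T i) \<subseteq> {..<t}" by (auto simp: T_def)
  have finS: "finite (SIGMA i:I. T i)" by (rule inj_on_finite[OF inj sub]) simp
  have finT: "finite (T i)" if "i \<in> I" for i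
  proof -
    have "Pair i ` T i \<subseteq> (SIGMA i:I. T i)" using that by auto
    then have "finite (Pair i ` T i)" using finS finite_subset by blast
    then show ?thesis by (rule finite_imageD) (auto simp: inj_on_def)
  qed
  have "(l i + 1) div 2 \<le> card (T i)" if i: "i \<in> I" for i
  proof -
    have l3: "3 \<le> l i" using l i by force
    have Qi: "Q i = expansion r (base_graph cyc (l i))" using Q i by blast
    have "edges (Q i) \<subseteq> (\<Union>x\<in>T i. {e \<in> edges (Q i). x \<in> e})"
    proof
      fix e assume e: "e \<in> edges (Q i)"
      then have "f ` (Pair i ` e) \<in> edges (S_graph r n t)"
        using E i by (auto simp: disjoint_union_def)
      then obtain y where "y \<in> f ` (Pair i ` e)" "y < t" by (auto simp: S_graph_def)
      then obtain x where x: "x \<in> e" "f (i, x) < t" by auto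
      have "e \<subseteq> verts (Q i)"
      proof -
        have "verts (base_graph cyc (l i)) = (\<Union>j<l i. base_edge cyc (l i) j)"
          "edges (base_graph cyc (l i)) = base_edge cyc (l i) ` {..<l i}"
          using graph_of_base[OF l3, of cyc] by (auto simp: graph_of_def)
        then show ?thesis using e unfolding Qi expansion_def by auto
      qed
      then show "e \<in> (\<Union>x\<in>T i. {e \<in> edges (Q i). x \<in> e})" using x e by (auto simp: T_def)
    qed
    then have "l i \<le> card (\<Union>x\<in>T i. {e \<in> edges (Q i). x \<in> e})"
      using card_mono[of "\<Union>x\<in>T i. {e \<in> edges (Q i). x \<in> e}" "edges (Q i)"]
        card_edges_expansion_base(1,3)[OF l3, of r cyc] finT[OF i] by (simp add: Qi)
    also have "\<dots> \<le> (\<Sum>x\<in>T i. card {e \<in> edges (Q i). x \<in> e})" by (rule card_UN_le[OF finT[OF i]])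
    also have "\<dots> \<le> (\<Sum>x\<in>T i. 2)"
      unfolding Qi by (intro sum_mono card_edges_expansion_base(2)[OF l3])
    finally show ?thesis by simp
  qed
  then have "Suc t \<le> (\<Sum>i\<in>I. card (T i))" unfolding t by (rule sum_mono)
  also have "\<dots> = card (SIGMA i:I. T i)" using I finT by simp
  also have "\<dots> \<le> card {..<t}" by (rule card_inj_on_le[OF inj sub]) simp
  finally show False by simp
qed

text \<open>Only r - 1 vertices of such a clique lie outside the fixed set, so each of its r-subsets
  meets it. Cliques with more vertices in the fixed set are of lower order.\<close>

lemma S_graph_cliques_ge:
  assumes r: "1 \<le> r" "r \<le> s" and n: "t \<le> n"
  shows "(t choose (s - r + 1)) * ((n - t) choose (r - 1)) \<le> num_copies (complete_r_graph r s) (S_graph r n t)"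
proof -
  let ?A = "{A. A \<subseteq> {..<t} \<and> card A = s - r + 1}" and ?B = "{B. B \<subseteq> {t..<n} \<and> card B = r - 1}"
  have "card (?A \<times> ?B) \<le> card (cliques {..<n} r s (edges (S_graph r n t)))"
  proof (rule card_inj_on_le[where f = "\<lambda>(A, B). A \<union> B"])
    show "inj_on (\<lambda>(A, B). A \<union> B) (?A \<times> ?B)"
    proof (rule inj_onI, clarify)
      fix A B A' B' assume *: "A \<subseteq> {..<t}" "B \<subseteq> {t..<n}" "A' \<subseteq> {..<t}" "B' \<subseteq> {t..<n}" "A \<union> B = A' \<union> B'"
      have "A = (A \<union> B) \<inter> {..<t}" "B = (A \<union> B) \<inter> {t..<n}" using * by auto
      moreover have "A' = (A' \<union> B') \<inter> {..<t}" "B' = (A' \<union> B') \<inter> {t..<n}" using * by auto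
      ultimately show "A = A' \<and> B = B'" using *(5) by metis
    qed
    show "(\<lambda>(A, B). A \<union> B) ` (?A \<times> ?B) \<subseteq> cliques {..<n} r s (edges (S_graph r n t))"
    proof (rule image_subsetI, clarify)
      fix A B assume A: "A \<subseteq> {..<t}" "card A = s - r + 1" and B: "B \<subseteq> {t..<n}" "card B = r - 1"
      have fin: "finite A" "finite B" using A B finite_subset by blast+
      have "A \<inter> B = {}" using A B by force
      then have "card (A \<union> B) = s" using fin A B r by (simp add: card_Un_disjoint)
      moreover have sub: "A \<union> B \<subseteq> {..<n}" using A B n by auto
      moreover have "e \<in> edges (S_graph r n t)" if e: "e \<subseteq> A \<union> B" "card e = r" for e
      proof -
        have "\<not> e \<subseteq> B" using card_mono[OF fin(2), of e] e B r by auto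
        then have "e \<inter> {..<t} \<noteq> {}" using e A by blast
        then show ?thesis using e sub by (auto simp: S_graph_def)
      qed
      ultimately show "A \<union> B \<in> cliques {..<n} r s (edges (S_graph r n t))" by (auto simp: cliques_def)
    qed
    show "finite (cliques {..<n} r s (edges (S_graph r n t)))"
      by (rule finite_subset[of _ "Pow {..<n}"]) (auto simp: cliques_def)
  qed
  then show ?thesis
    unfolding num_copies_complete[OF S_graph_r_graph] by (simp add: card_cartesian_product n_subsets S_graph_def)
qed

section \<open>Asymptotics\<close>

lemma binomial_ge_power: "Suc m ^ q \<le> ((m + q) choose q) * fact q"
proof (induction q)
  case 0
  then show ?case by simp
next
  case (Suc q)
  have "Suc m ^ Suc q \<le> Suc (m + q) * (((m + q) choose q) * fact q)"
    unfolding power_Suc using Suc by (intro mult_le_mono) auto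
  also have "\<dots> = (Suc q * (Suc (m + q) choose Suc q)) * fact q"
    unfolding Suc_times_binomial by (simp only: mult.assoc)
  also have "\<dots> = ((m + Suc q) choose Suc q) * fact (Suc q)" by (simp add: algebra_simps)
  finally show ?case .
qed

text \<open>Serves the extremal number and the construction alike: one inherits the lower bound, the
  other the upper. The value \<open>c = 0\<close> is the case of large s.\<close>

lemma sandwich_smallo:
  fixes f :: "nat \<Rightarrow> real" and c :: real
  assumes c: "c \<ge> 0"
    and upper: "\<And>\<epsilon>. \<epsilon> > 0 \<Longrightarrow> \<exists>n0. \<forall>n\<ge>n0. f n \<le> c * (real n ^ q / fact q) + \<epsilon> * real n ^ q"
    and lower: "\<And>n. t \<le> n \<Longrightarrow> c * real ((n - t) choose q) \<le> f n"
  shows "(\<lambda>n. f n - c * (real n ^ q / fact q)) \<in> o(\<lambda>n. real n ^ q)"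
proof (rule landau_o.smallI)
  fix \<epsilon> :: real assume \<epsilon>: "\<epsilon> > 0"
  obtain n0 where n0: "\<And>n. n \<ge> n0 \<Longrightarrow> f n \<le> c * (real n ^ q / fact q) + \<epsilon> * real n ^ q"
    using upper[OF \<epsilon>] by blast
  \<comment> \<open>With this shift \<open>(n - a) ^ q\<close> is at most q! times the binomial
    coefficient. By Bernoulli the relative loss against \<open>n ^ q\<close> is at most
    \<open>q * a / n\<close>, which \<open>n1\<close> makes at most \<epsilon> after multiplication
    by c.\<close>
  define a where "a = t + q"
  define n1 where "n1 = max (max n0 (a + 1)) (nat \<lceil>c * real q * real a / \<epsilon>\<rceil>)"
  have "norm (f n - c * (real n ^ q / fact q)) \<le> \<epsilon> * norm (real n ^ q)" if n: "n \<ge> n1" for n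
  proof -
    have na: "n \<ge> n0" "n > a" "c * real q * real a / \<epsilon> \<le> real n" using n unfolding n1_def by linarith+
    have "real n ^ q * (1 - real q * (real a / real n)) \<le> real n ^ q * (1 - real a / real n) ^ q"
      using Bernoulli_inequality[of "- (real a / real n)" q] na(2) by (intro mult_left_mono) auto
    also have "\<dots> = (real n - real a) ^ q" using na(2) by (simp add: power_mult_distrib[symmetric] algebra_simps)
    also have "\<dots> = real ((n - a) ^ q)" using na(2) by (simp add: of_nat_diff)
    also have "\<dots> \<le> real (((n - t) choose q) * fact q)"
    proof -
      have "(n - a) ^ q \<le> Suc (n - a) ^ q" by (intro power_mono) auto
      also have "\<dots> \<le> ((n - a + q) choose q) * fact q" by (rule binomial_ge_power)
      also have "n - a + q = n - t" using na(2) by (simp add: a_def)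
      finally show ?thesis by (simp only: of_nat_le_iff)
    qed
    finally have "real n ^ q * (1 - real q * (real a / real n)) / fact q \<le> real ((n - t) choose q)"
      by (simp add: field_simps)
    then have "c * (real n ^ q * (1 - real q * (real a / real n)) / fact q) \<le> c * real ((n - t) choose q)"
      using c by (intro mult_left_mono) auto
    also have "\<dots> \<le> f n" using na(2) by (intro lower) (simp add: a_def)
    finally have 1: "c * (real n ^ q / fact q) - c * real q * (real a / real n) * (real n ^ q / fact q) \<le> f n"
      by (simp add: algebra_simps diff_divide_distrib)
    have "c * real q * (real a / real n) \<le> \<epsilon>"
      using na \<epsilon> by (simp add: field_simps)
    moreover have "real n ^ q / fact q \<le> real n ^ q" 
      using mult_left_mono[OF fact_ge_1[of q, where 'a = real], of "real n ^ q"] by (simp add: divide_le_eq)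
    ultimately have "c * real q * (real a / real n) * (real n ^ q / fact q) \<le> \<epsilon> * real n ^ q"
      using c \<epsilon> by (intro mult_mono) auto
    then have "\<bar>f n - c * (real n ^ q / fact q)\<bar> \<le> \<epsilon> * real n ^ q"
      using 1 n0[OF na(1)] unfolding abs_le_iff by linarith
    then show ?thesis by simp
  qed
  then show "\<forall>\<^sub>F n in sequentially. norm (f n - c * (real n ^ q / fact q)) \<le> \<epsilon> * norm (real n ^ q)"
    unfolding eventually_sequentially by blast
qed

theorem theorem2p8:
  fixes r k s t :: nat
    and l :: "nat \<Rightarrow> nat"
    and Q :: "nat \<Rightarrow> (nat + nat set \<times> nat) hypergraph"
  assumes "r \<ge> 3" and "k \<ge> 1" and "\<forall>i\<in>{1..k}. l i \<ge> 5" and "s \<ge> r"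
    and "t = (\<Sum>i=1..k. (l i + 1) div 2) - 1"
    and "(\<forall>i\<in>{1..k}. Q i = expansion r (path_graph (l i))) \<or>
         (\<forall>i\<in>{1..k}. Q i = expansion r (cycle_graph (l i)))"
  shows "(s \<le> t + r - 1 \<longrightarrow>
            (\<lambda>n. real (ex_r r n (complete_r_graph r s) (disjoint_union {1..k} Q)))
              \<sim>[at_top] (\<lambda>n. real (num_copies (complete_r_graph r s) (S_graph r n t))) \<and>
            (\<lambda>n. real (num_copies (complete_r_graph r s) (S_graph r n t))
                   - real (t choose (s - r + 1)) * (real n ^ (r - 1) / fact (r - 1)))
              \<in> o(\<lambda>n. real n ^ (r - 1)) \<and>
            (\<lambda>n. real (ex_r r n (complete_r_graph r s) (disjoint_union {1..k} Q))
                   - real (t choose (s - r + 1)) * (real n ^ (r - 1) / fact (r - 1)))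
              \<in> o(\<lambda>n. real n ^ (r - 1)))
       \<and> (s \<ge> t + r \<longrightarrow>
            (\<lambda>n. real (ex_r r n (complete_r_graph r s) (disjoint_union {1..k} Q)))
              \<in> o(\<lambda>n. real n ^ (r - 1)))"
proof -
  let ?I = "{1..k}" and ?K = "complete_r_graph r s"
  let ?F = "disjoint_union ?I Q"
  define ex where "ex n = real (ex_r r n ?K ?F)" for n
  define ns where "ns n = real (num_copies ?K (S_graph r n t))" for n
  define c where "c = real (t choose (s - r + 1))"
  obtain cyc where Q: "\<forall>i\<in>?I. Q i = expansion r (base_graph cyc (l i))"
    using assms(6)
  proof
    assume "\<forall>i\<in>?I. Q i = expansion r (path_graph (l i))"
    then show thesis using that[of False] by (simp add: base_graph_def)
  next
    assume "\<forall>i\<in>?I. Q i = expansion r (cycle_graph (l i))"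
    then show thesis using that[of True] by (simp add: base_graph_def)
  qed
  have I: "finite ?I" "?I \<noteq> {}" "1 \<in> ?I" using assms(2) by auto
  note l = assms(3) and r = assms(1,4)
  have "1 \<le> (l 1 + 1) div 2" using l I(3) by force
  also have "\<dots> \<le> (\<Sum>i\<in>?I. (l i + 1) div 2)" by (rule member_le_sum[OF I(3) _ I(1)]) simp
  finally have t: "Suc t = (\<Sum>i\<in>?I. (l i + 1) div 2)" using assms(5) by simp
  let ?Gs = "\<lambda>n. {num_copies ?K G | G :: nat hypergraph. r_graph r G \<and> card (verts G) = n \<and> copies ?F G = {}}"
  \<comment> \<open>Holds for every n, even below \<open>t\<close>, so the maximum is over a
    nonempty set and is attained.\<close>
  have S: "num_copies ?K (S_graph r n t) \<in> ?Gs n" for n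
    using S_graph_no_copies[OF I(1) l t Q, of n] S_graph_r_graph[of r n t]
    by (intro CollectI exI[of _ "S_graph r n t"]) (simp add: S_graph_def)
  have ns_ex: "ns n \<le> ex n" for n
    unfolding ns_def ex_def ex_r_def of_nat_le_iff by (rule Max_ge[OF finite_num_copies_values S])
  have upper: "\<exists>n0. \<forall>n\<ge>n0. ex n \<le> c * (real n ^ (r - 1) / fact (r - 1)) + \<epsilon> * real n ^ (r - 1)"
    if \<epsilon>: "\<epsilon> > 0" for \<epsilon> :: real
  proof -
    from clique_upper_bound[OF I(1,2) l r t \<epsilon>, where 'a = nat and cyc = cyc] obtain n0 where
      n0: "\<forall>(V :: nat set) H. uniform r V H \<longrightarrow> \<not> has_system cyc ?I l H \<longrightarrow> n0 \<le> card V \<longrightarrow>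
       real (card (cliques V r s H)) \<le>
         c * (real (card V) ^ (r - 1) / fact (r - 1)) + \<epsilon> * real (card V) ^ (r - 1)"
      unfolding c_def by (elim exE)
    have "ex n \<le> c * (real n ^ (r - 1) / fact (r - 1)) + \<epsilon> * real n ^ (r - 1)" if n: "n \<ge> n0" for n
    proof -
      have "ex_r r n ?K ?F \<in> ?Gs n" unfolding ex_r_def
        by (rule Max_in[OF finite_num_copies_values]) (use S in blast)
      then obtain G :: "nat hypergraph" where G: "r_graph r G" "card (verts G) = n" "copies ?F G = {}"
        "ex_r r n ?K ?F = num_copies ?K G" by blast
      have "\<not> has_system cyc ?I l (edges G)"
        using copies_of_has_system[OF _ G(1) r(1) l Q] G(3) by blast
      then show ?thesis
        using n0[rule_format, of "verts G" "edges G"] G n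
        by (simp add: ex_def num_copies_complete r_graph_uniform[symmetric])
    qed
    then show ?thesis by blast
  qed
  have lower: "c * real ((n - t) choose (r - 1)) \<le> ns n" if "t \<le> n" for n
  proof -
    have "1 \<le> r" using r by simp
    from S_graph_cliques_ge[OF this r(2) that] show ?thesis
      unfolding c_def ns_def of_nat_mult[symmetric] of_nat_le_iff .
  qed
  have c0: "c \<ge> 0" by (simp add: c_def)
  have ex_o: "(\<lambda>n. ex n - c * (real n ^ (r - 1) / fact (r - 1))) \<in> o(\<lambda>n. real n ^ (r - 1))"
    by (rule sandwich_smallo[OF c0 upper]) (use lower ns_ex order_trans in blast)+
  have ns_o: "(\<lambda>n. ns n - c * (real n ^ (r - 1) / fact (r - 1))) \<in> o(\<lambda>n. real n ^ (r - 1))"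
  proof (rule sandwich_smallo[OF c0 _ lower])
    fix \<epsilon> :: real assume "\<epsilon> > 0"
    from upper[OF this] show "\<exists>n0. \<forall>n\<ge>n0. ns n \<le> c * (real n ^ (r - 1) / fact (r - 1)) + \<epsilon> * real n ^ (r - 1)"
      using ns_ex order_trans by blast
  qed
  have "ex \<sim>[at_top] ns" if s: "s \<le> t + r - 1"
  proof -
    \<comment> \<open>Exactly in this range the binomial coefficient is positive, so that the
      leading term yields an asymptotic equivalence.\<close>
    have "s - r + 1 \<le> t" using s r by linarith
    then have c: "c / fact (r - 1) \<noteq> 0" by (simp add: c_def)
    have eq: "(\<lambda>n. c * (real n ^ (r - 1) / fact (r - 1))) = (\<lambda>n. (c / fact (r - 1)) * real n ^ (r - 1))"
      by (simp add: fun_eq_iff)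
    have o: "o(\<lambda>n. c * (real n ^ (r - 1) / fact (r - 1))) = o(\<lambda>n. real n ^ (r - 1))"
      unfolding eq by (rule landau_o.small.cmult[OF c])
    have "ex \<sim>[at_top] (\<lambda>n. c * (real n ^ (r - 1) / fact (r - 1)))"
      "ns \<sim>[at_top] (\<lambda>n. c * (real n ^ (r - 1) / fact (r - 1)))"
      unfolding asymp_equiv_altdef o using ex_o ns_o by simp_all
    then show ?thesis using asymp_equiv_trans asymp_equiv_sym by blast
  qed
  moreover have "ex \<in> o(\<lambda>n. real n ^ (r - 1))" if "s \<ge> t + r"
  proof -
    have "c = 0" using that r by (simp add: c_def)
    then show ?thesis using ex_o by simp
  qed
  ultimately show ?thesis
    using ex_o ns_o unfolding ex_def[abs_def] ns_def[abs_def] c_def by blast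
qed

end
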